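(* Let $A,B\subset\varGamma$ be nonempty, disjoint, measurable sets, $\tau_{AB}=\inf\{t\ge0:X_t\in A\cup B\}$, and let $f_{AB}=+\infty$ on $A$ and $f_{AB}=0$ on $B$. Let $h_{AB}$ be the solution of the boundary value problem $$\int_\varGamma\bigl(h(y)-h(x)\bigr)L(x,\mathrm{d}y)=0\ \text{ for }x\in(A\cup B)^c,\qquad h(x)=\mathbf{1}_B(x)\ \text{ for }x\in A\cup B.$$ Then for any $x\in(A\cup B)^c$ satisfying $\mathsf{E}_{\mathsf{R}^x}[e^{\tau_{AB}}]<+\infty$: (i) the problem $$\bar\gamma_{\rm sto}(x)=\inf\left\{\mathsf{E}_{\mathsf{Q}}\Bigl[f_{AB}(X_{\tau_{AB}})+\log\frac{\mathrm{d}\mathsf{Q}}{\mathrm{d}\mathsf{R}^x}\Bigr]\;:\;\mathsf{Q}\in\mathcal{P}(\Omega)\right\}$$ admits a unique minimizer given by $$\mathsf{P}_{AB}^x=\frac{h_{AB}(X_{\tau_{AB}})}{h_{AB}(x)}\,\mathsf{R}^x=\int_\varGamma\mathsf{R}^{x,X_{\tau_{AB}}=\eta}\,\frac{h_{AB}(\eta)}{h_{AB}(x)}\,\mathsf{R}^x_{\tau_{AB}}(\mathrm{d}\eta);$$ (ii) the associated value function is given by $\bar\gamma_{\rm sto}(x)=-\log h_{AB}(x)$; (iii) $\mathsf{P}^x_{AB}\in\mathcal{P}(\Omega)$ solves the martingale problem $\mathsf{MP}(\overline L_{AB},\delta_x)$ with Lévy kernel $$\overline L_{AB}(\omega,\m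athrm{d}t\,\mathrm{d}y)=\mathbf{1}_{[0,\tau_{AB})}(t)\,\frac{h_{AB}(y)}{h_{AB}(X_{t^-}(\omega))}\,L(X_{t^-}(\omega),\mathrm{d}y)\,\mathrm{d}t,\qquad\omega\in\Omega.$$
   Context: Setting. $\varGamma$ is a Polish space, $\mathbb{R}^+=[0,+\infty)$, $\Omega=D(\mathbb{R}^+;\varGamma)$ is the Skorokhod space of càdlàg paths, with canonical process $X_t(\omega)=\omega_t$, $E_\varGamma=\varGamma\times\varGamma$. $(\Omega,\mathcal{F},\mathfrak{F},\mathsf{R})$ is the complete right-continuous filtered space obtained by $\mathsf{R}$-completing $\sigma(X_t:t\ge0)$ and the right-continuous extension of the canonical filtration; $\tau_{AB}$ is then an $\mathfrak{F}$-stopping time. $\mathcal{T}=\{t\ge0:X_t\neq X_{t^-}\}$, $\mathcal{T}_t=\mathcal{T}\cap[0,t]$, $\mathcal{T}_0=\emptyset$. Lévy kernels and martingale problem. A Markovian Lévy kernel is a random nonnegative measure on $\mathbb{R}^+\times\varGamma$ of the form $\overline L(\omega,\mathrm{d}t\,\mathrm{d}y)=L_t(X_{t^-}(\omega),\mathrm{d}y)\,\mathrm{d}t$, with $\{L_t(x,\cdot)\}$ a Borel family of Radon measures on $\varGamma$; it is called $\mathfrak{F}$-predictable if the filtration $\mathcal{G}_t=\sigma(\overline L((0,s]\times C):s\le t,\ C\subset\varGamma\text{ Borel})$ is contained in $\mathfrak{F}$. A path measure $\mathsf{P}\in\mathcal{P}(\Omega)$ solves the martingale problem $\mathsf{MP}(\overline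 L,\mu)$ if there is a right-continuous filtration $\mathfrak{F}$ such that $\overline L$ is $\mathfrak{F}$-predictable and (1) $\mathsf{P}(X_0\in\cdot)=\mu$; (2) for every bounded Borel $\varphi:\mathbb{R}^+\times E_\varGamma\to\mathbb{R}$, the process $\sum_{s\in\mathcal{T}_t}\varphi_s(X_{s^-},X_s)-\iint_{(0,t]\times\varGamma}\varphi_s(X_{s^-},y)\,\overline L(\mathrm{d}s\,\mathrm{d}y)$ is a $\mathsf{P}$-martingale w.r.t. $\mathfrak{F}$. The same definition is applied to the kernel with the indicator $\mathbf 1_{[0,\tau_{AB})}(t)$. Reference measure. $\{L(x,\cdot)\}_{x\in\varGamma}$ is a Borel family of nonnegative measures on $\varGamma$ with $\sup_x\int_\varGamma L(x,\mathrm{d}y)<+\infty$. $\mathsf{R}\in\mathcal{P}(\Omega)$ is the unique path measure (with initial law $\mathsf{R}_0$) admitting the Lévy kernel $L(X_{t^-},\mathrm{d}y)\,\mathrm{d}t$; $\mathsf{R}^x=\mathsf{R}(\cdot\,|\,X_0=x)$ is the law of the process with rate $L$ started at $x$. It is assumed that $X$ under $\mathsf{R}$ is positive in the sense of Meyn–Tweedie (so that there is a unique invariant probability measure). It is assumed throughout that the boundary value problem for $h_{AB}$ has a unique solution. Notation. $\mathsf{R}^x_{\tau}=(X_\tau)_\#\mathsf{R}^x$, and $\mathsf{R}^{x,X_\tau=\eta}$ is the conditional measure of $\mathsf{R}^x$ given $X_\tau=\eta$ (disintegration). $\mathsf{E}_{\mathsf{Q}}[\log(\mathrm{d}\mathsf{Q}/\mathrm{d}\mathsf{R}^x)]$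 is the relative entropy of $\mathsf{Q}$ w.r.t. $\mathsf{R}^x$, equal to $+\infty$ if $\mathsf{Q}\not\ll\mathsf{R}^x$. Values of $f_{AB}$ on $(A\cup B)^c$ are irrelevant.
   Formalization: Parts (i) and (iii) assume h_AB(x) ≠ 0 (otherwise P_AB is undefined and all costs are infinite); in (iii) the martingale problem is up to τ_AB: only jumps at times s ≤ τ_AB are summed, since later jumps are not compensated by the kernel. *)

theory Defs
  imports "HOL-Probability.Probability"
begin

section \<open>Path space\<close>

text \<open>The state space is a type of class \<open>polish_space\<close>; only its topology and Borel sets are used.
  A path on \<open>[0, \<infinity>)\<close> is an extensional function of a real variable, so that two paths agreeing on
  \<open>[0, \<infinity>)\<close> are equal. The Borel sigma-algebra of the Skorokhod topology is the one generated by
  the coordinates.\<close>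

definition cadlag_paths :: "(real \<Rightarrow> 'a::polish_space) set" where
  "cadlag_paths = {\<omega> \<in> extensional {0..}.
     (\<forall>t\<ge>0. (\<omega> \<longlongrightarrow> \<omega> t) (at_right t)) \<and> (\<forall>t>0. \<exists>l. (\<omega> \<longlongrightarrow> l) (at_left t))}"

definition path_space :: "(real \<Rightarrow> 'a::polish_space) measure" where
  "path_space = restrict_space (Pi\<^sub>M {0..} (\<lambda>_. borel)) cadlag_paths"

definition path_measures :: "(real \<Rightarrow> 'a::polish_space) measure set" where
  "path_measures = space (prob_algebra path_space)"

text \<open>Convention \<open>X\<^bsub>0-\<^esub> = X\<^sub>0\<close>; in particular \<open>0\<close> is never a jump time.\<close>

definition left_lim :: "(real \<Rightarrow> 'a::polish_space) \<Rightarrow> real \<Rightarrow> 'a" where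
  "left_lim \<omega> t = (if t \<le> 0 then \<omega> 0 else Lim (at_left t) \<omega>)"

definition jump_times :: "(real \<Rightarrow> 'a::polish_space) \<Rightarrow> real set" where
  "jump_times \<omega> = {t. 0 \<le> t \<and> \<omega> t \<noteq> left_lim \<omega> t}"

definition pure_jump :: "(real \<Rightarrow> 'a::polish_space) \<Rightarrow> bool" where
  "pure_jump \<omega> \<longleftrightarrow> (\<forall>t\<ge>0. finite (jump_times \<omega> \<inter> {..t})) \<and>
     (\<forall>s t. 0 \<le> s \<and> s \<le> t \<and> jump_times \<omega> \<inter> {s<..t} = {} \<longrightarrow> \<omega> s = \<omega> t)"

definition hitting_time :: "'a set \<Rightarrow> (real \<Rightarrow> 'a::polish_space) \<Rightarrow> ereal" where
  "hitting_time D \<omega> = Inf (ereal ` {t. 0 \<le> t \<and> \<omega> t \<in> D})"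

text \<open>The value at \<open>\<sigma> \<omega> = \<infinity>\<close> is a dummy (it is \<open>\<omega> 0\<close>).\<close>

definition stopped_value :: "((real \<Rightarrow> 'a::polish_space) \<Rightarrow> ereal) \<Rightarrow> (real \<Rightarrow> 'a) \<Rightarrow> 'a" where
  "stopped_value \<sigma> \<omega> = \<omega> (real_of_ereal (\<sigma> \<omega>))"

section \<open>Martingale problem\<close>

text \<open>The filtrations are indexed by \<open>real\<close> because the library's filtrations are indexed by
  a type; only the times \<open>t \<ge> 0\<close> matter. They consist of sub-sigma-algebras of the completion of the
  path measure, so that they may contain its null sets.\<close>

definition is_martingale ::
    "'w measure \<Rightarrow> (real \<Rightarrow> 'w measure) \<Rightarrow> (real \<Rightarrow> 'w \<Rightarrow> real) \<Rightarrow> bool" where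
  "is_martingale M F Z \<longleftrightarrow>
     (\<forall>t\<ge>0. Z t \<in> borel_measurable (F t) \<and> integrable M (Z t)) \<and>
     (\<forall>s t. 0 \<le> s \<and> s \<le> t \<longrightarrow> (AE \<omega> in M. real_cond_exp M (F s) (Z t) \<omega> = Z s \<omega>))"

definition right_continuous_filtration :: "'w measure \<Rightarrow> (real \<Rightarrow> 'w measure) \<Rightarrow> bool" where
  "right_continuous_filtration M F \<longleftrightarrow> filtration (space M) F \<and> (\<forall>t. subalgebra M (F t)) \<and>
     (\<forall>t\<ge>0. sets (F t) = (\<Inter>s\<in>{t<..}. sets (F s)))"

text \<open>The Markovian Levy kernel \<open>k\<^sub>t(X\<^bsub>t-\<^esub>, dy) dt\<close>, a measure on time \<open>\<times>\<close> states for every path.\<close>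

definition levy_kernel ::
    "(real \<Rightarrow> 'a \<Rightarrow> 'a measure) \<Rightarrow> (real \<Rightarrow> 'a::polish_space) \<Rightarrow> (real \<times> 'a) measure" where
  "levy_kernel k \<omega> = measure_of UNIV (sets (borel \<Otimes>\<^sub>M borel))
     (\<lambda>C. \<integral>\<^sup>+ t\<in>{0..}. emeasure (k t (left_lim \<omega> t)) {y. (t, y) \<in> C} \<partial>lborel)"

definition kernel_predictable ::
    "((real \<Rightarrow> 'a::polish_space) \<Rightarrow> (real \<times> 'a) measure) \<Rightarrow> (real \<Rightarrow> (real \<Rightarrow> 'a) measure) \<Rightarrow> bool" where
  "kernel_predictable Lbar F \<longleftrightarrow> (\<forall>t s C. 0 \<le> s \<and> s \<le> t \<and> C \<in> sets borel \<longrightarrow>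
     (\<lambda>\<omega>. emeasure (Lbar \<omega>) ({0<..s} \<times> C)) \<in> borel_measurable (F t))"

definition compensated_jumps ::
    "((real \<Rightarrow> 'a::polish_space) \<Rightarrow> ereal) \<Rightarrow> ((real \<Rightarrow> 'a) \<Rightarrow> (real \<times> 'a) measure) \<Rightarrow>
     (real \<times> 'a \<times> 'a \<Rightarrow> real) \<Rightarrow> real \<Rightarrow> (real \<Rightarrow> 'a) \<Rightarrow> real" where
  "compensated_jumps \<sigma> Lbar \<phi> t \<omega> =
     (\<Sum>s\<in>{s \<in> jump_times \<omega>. s \<le> t \<and> ereal s \<le> \<sigma> \<omega>}. \<phi> (s, left_lim \<omega> s, \<omega> s))
     - (LINT (s, y) : {0<..t} \<times> UNIV | Lbar \<omega>. \<phi> (s, left_lim \<omega> s, y))"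

text \<open>The martingale problem for the process up to the time \<open>\<sigma>\<close>. For \<open>\<sigma> = \<infinity>\<close> this is the usual
  martingale problem \<open>solves_MP\<close>. A kernel with the factor \<open>1\<^bsub>[0,\<sigma>)\<^esub>(t)\<close> does not see the process after
  \<open>\<sigma>\<close>, so only the jumps up to \<open>\<sigma>\<close> are compensated.
  The requirement that there are almost surely finitely many jumps up to each
  \<open>t\<close> says that the sum of jumps is well defined (take \<open>\<phi> = 1\<close>); it is explicit because a sum over
  an infinite set is \<open>0\<close> by convention.\<close>

definition solves_MP_upto ::
    "((real \<Rightarrow> 'a::polish_space) \<Rightarrow> ereal) \<Rightarrow> (real \<Rightarrow> 'a) measure \<Rightarrow>
     ((real \<Rightarrow> 'a) \<Rightarrow> (real \<times> 'a) measure) \<Rightarrow> 'a measure \<Rightarrow> bool" where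
  "solves_MP_upto \<sigma> P Lbar \<mu> \<longleftrightarrow> P \<in> path_measures \<and>
     (\<exists>F. right_continuous_filtration (completion P) F \<and>
        (\<forall>t\<ge>0. (\<lambda>\<omega>. \<omega> t) \<in> F t \<rightarrow>\<^sub>M borel) \<and>
        (\<forall>t\<ge>0. {\<omega> \<in> space P. \<sigma> \<omega> \<le> ereal t} \<in> sets (F t)) \<and>
        kernel_predictable Lbar F \<and>
        distr P borel (\<lambda>\<omega>. \<omega> 0) = \<mu> \<and>
        (AE \<omega> in P. \<forall>t\<ge>0. finite {s \<in> jump_times \<omega>. s \<le> t \<and> ereal s \<le> \<sigma> \<omega>}) \<and>
        (\<forall>\<phi> \<in> borel_measurable (borel \<Otimes>\<^sub>M borel \<Otimes>\<^sub>M borel). bounded (range \<phi>) \<longrightarrow>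
           is_martingale (completion P) F (compensated_jumps \<sigma> Lbar \<phi>)))"

abbreviation solves_MP ::
    "(real \<Rightarrow> 'a::polish_space) measure \<Rightarrow> ((real \<Rightarrow> 'a) \<Rightarrow> (real \<times> 'a) measure) \<Rightarrow> 'a measure \<Rightarrow> bool" where
  "solves_MP \<equiv> solves_MP_upto (\<lambda>_. \<infinity>)"

section \<open>Reference process\<close>

definition bounded_rate_kernel :: "('a::polish_space \<Rightarrow> 'a measure) \<Rightarrow> bool" where
  "bounded_rate_kernel L \<longleftrightarrow> (\<forall>x. sets (L x) = sets borel) \<and>
     (\<forall>C \<in> sets borel. (\<lambda>x. emeasure (L x) C) \<in> borel_measurable borel) \<and>
     (SUP x. emeasure (L x) UNIV) < \<infinity>"

text \<open>The martingale problem constrains jumps only and says nothing about a continuous motion between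
  them (for \<open>L = 0\<close> every continuous process solves it), so uniqueness is uniqueness
  among jump processes.\<close>

definition jump_process_law ::
    "('a::polish_space \<Rightarrow> 'a measure) \<Rightarrow> 'a measure \<Rightarrow> (real \<Rightarrow> 'a) measure \<Rightarrow> bool" where
  "jump_process_law L \<mu> P \<longleftrightarrow>
     P \<in> path_measures \<and> (AE \<omega> in P. pure_jump \<omega>) \<and> solves_MP P (levy_kernel (\<lambda>_. L)) \<mu>"

definition unique_jump_process_law ::
    "('a::polish_space \<Rightarrow> 'a measure) \<Rightarrow> 'a measure \<Rightarrow> (real \<Rightarrow> 'a) measure \<Rightarrow> bool" where
  "unique_jump_process_law L \<mu> P \<longleftrightarrow>
     jump_process_law L \<mu> P \<and> (\<forall>Q. jump_process_law L \<mu> Q \<longrightarrow> Q = P)"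

text \<open>The family \<open>R\<^sup>x = R(\<cdot> | X\<^sub>0 = x)\<close>. Conditioning determines it only for almost every \<open>x\<close>
  under the initial law; the martingale problem started at \<open>x\<close> fixes it for every \<open>x\<close>.\<close>

definition started_family ::
    "('a::polish_space \<Rightarrow> 'a measure) \<Rightarrow> 'a measure \<Rightarrow> (real \<Rightarrow> 'a) measure \<Rightarrow>
     ('a \<Rightarrow> (real \<Rightarrow> 'a) measure) \<Rightarrow> bool" where
  "started_family L R0 R Rx \<longleftrightarrow> Rx \<in> borel \<rightarrow>\<^sub>M prob_algebra path_space \<and> R = R0 \<bind> Rx \<and>
     (\<forall>x. unique_jump_process_law L (return borel x) (Rx x))"

text \<open>Positivity in the sense of Meyn and Tweedie: \<open>\<psi>\<close>-irreducibility (the expected occupation time of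
  every \<open>\<psi>\<close>-positive set is positive from every starting point) and existence of an invariant
  probability measure.\<close>

definition psi_irreducible :: "('a::polish_space \<Rightarrow> (real \<Rightarrow> 'a) measure) \<Rightarrow> bool" where
  "psi_irreducible Rx \<longleftrightarrow> (\<exists>\<psi>. sigma_finite_measure \<psi> \<and> sets \<psi> = sets borel \<and> emeasure \<psi> UNIV > 0 \<and>
     (\<forall>C \<in> sets borel. emeasure \<psi> C > 0 \<longrightarrow>
        (\<forall>x. (\<integral>\<^sup>+ \<omega>. (\<integral>\<^sup>+ t\<in>{0..}. indicator C (\<omega> t) \<partial>lborel) \<partial>Rx x) > 0)))"

definition invariant_prob :: "('a::polish_space \<Rightarrow> (real \<Rightarrow> 'a) measure) \<Rightarrow> 'a measure \<Rightarrow> bool" where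
  "invariant_prob Rx \<pi> \<longleftrightarrow> \<pi> \<in> space (prob_algebra borel) \<and>
     (\<forall>t\<ge>0. \<forall>C \<in> sets borel.
        (\<integral>\<^sup>+ x. emeasure (Rx x) {\<omega> \<in> space path_space. \<omega> t \<in> C} \<partial>\<pi>) = emeasure \<pi> C)"

definition positive_process :: "('a::polish_space \<Rightarrow> (real \<Rightarrow> 'a) measure) \<Rightarrow> bool" where
  "positive_process Rx \<longleftrightarrow> psi_irreducible Rx \<and> (\<exists>\<pi>. invariant_prob Rx \<pi>)"

section \<open>Boundary value problem and variational problem\<close>

definition bvp_solution ::
    "('a::polish_space \<Rightarrow> 'a measure) \<Rightarrow> 'a set \<Rightarrow> 'a set \<Rightarrow> ('a \<Rightarrow> real) \<Rightarrow> bool" where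
  "bvp_solution L A B h \<longleftrightarrow> h \<in> borel_measurable borel \<and> bounded (range h) \<and>
     (\<forall>x. x \<notin> A \<union> B \<longrightarrow> (LINT y|L x. h y - h x) = 0) \<and>
     (\<forall>x \<in> A \<union> B. h x = indicator B x)"

text \<open>The value outside \<open>A \<union> B\<close> is irrelevant.\<close>

definition f_AB :: "'a set \<Rightarrow> 'a \<Rightarrow> ennreal" where
  "f_AB A y = (if y \<in> A then \<infinity> else 0)"

text \<open>For a probability measure \<open>R\<close> the negative part of \<open>log(dQ/dR)\<close> is always \<open>Q\<close>-integrable, so
  non-integrability means that the integral is \<open>+\<infinity>\<close>.\<close>

definition relative_entropy :: "'w measure \<Rightarrow> 'w measure \<Rightarrow> ereal" where
  "relative_entropy Q R =
     (if absolutely_continuous R Q \<and> integrable Q (entropy_density (exp 1) R Q)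
      then ereal (KL_divergence (exp 1) R Q) else \<infinity>)"

text \<open>Hitting times are measurable only with respect to completions in general.\<close>

definition sto_cost ::
    "'a set \<Rightarrow> 'a set \<Rightarrow> (real \<Rightarrow> 'a::polish_space) measure \<Rightarrow> (real \<Rightarrow> 'a) measure \<Rightarrow> ereal" where
  "sto_cost A B R Q =
     enn2ereal (\<integral>\<^sup>+ \<omega>. f_AB A (stopped_value (hitting_time (A \<union> B)) \<omega>) \<partial>completion Q)
     + relative_entropy Q R"

definition gamma_sto :: "'a set \<Rightarrow> 'a set \<Rightarrow> (real \<Rightarrow> 'a::polish_space) measure \<Rightarrow> ereal" where
  "gamma_sto A B R = (INF Q\<in>path_measures. sto_cost A B R Q)"

text \<open>\<open>h(X\<^sub>\<tau>) / h(x) \<cdot> R\<close>, as a measure on the (uncompleted) path space.\<close>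

definition P_AB ::
    "'a set \<Rightarrow> 'a set \<Rightarrow> ('a \<Rightarrow> real) \<Rightarrow> 'a \<Rightarrow> (real \<Rightarrow> 'a::polish_space) measure \<Rightarrow> (real \<Rightarrow> 'a) measure" where
  "P_AB A B h x R = restr_to_subalg
     (density (completion R) (\<lambda>\<omega>. ennreal (h (stopped_value (hitting_time (A \<union> B)) \<omega>) / h x)))
     path_space"

definition levy_kernel_AB ::
    "('a \<Rightarrow> 'a measure) \<Rightarrow> 'a set \<Rightarrow> 'a set \<Rightarrow> ('a \<Rightarrow> real) \<Rightarrow> (real \<Rightarrow> 'a::polish_space) \<Rightarrow> (real \<times> 'a) measure" where
  "levy_kernel_AB L A B h \<omega> = density (levy_kernel (\<lambda>_. L) \<omega>)
     (\<lambda>(t, y). indicator {s. ereal s < hitting_time (A \<union> B) \<omega>} t * ennreal (h y / h (left_lim \<omega> t)))"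

definition law_of :: "'w measure \<Rightarrow> ('w \<Rightarrow> 'a::polish_space) \<Rightarrow> 'a measure" where
  "law_of R Y = distr (completion R) borel Y"

text \<open>\<open>K \<eta>\<close> is a version of the conditional measure \<open>R(\<cdot> | Y = \<eta>)\<close>.\<close>

definition conditional_measures ::
    "(real \<Rightarrow> 'a::polish_space) measure \<Rightarrow> ((real \<Rightarrow> 'a) \<Rightarrow> 'a) \<Rightarrow> ('a \<Rightarrow> (real \<Rightarrow> 'a) measure) \<Rightarrow> bool" where
  "conditional_measures R Y K \<longleftrightarrow> K \<in> borel \<rightarrow>\<^sub>M prob_algebra path_space \<and>
     (\<forall>C \<in> sets path_space. \<forall>D \<in> sets borel.
        emeasure (completion R) {\<omega> \<in> C. Y \<omega> \<in> D} = (\<integral>\<^sup>+ \<eta>\<in>D. emeasure (K \<eta>) C \<partial>law_of R Y))"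

definition exp_ext :: "ereal \<Rightarrow> ennreal" where
  "exp_ext t = (if t = \<infinity> then \<infinity> else ennreal (exp (real_of_ereal t)))"

definition neg_log :: "real \<Rightarrow> ereal" where
  "neg_log u = (if u = 0 then \<infinity> else ereal (- ln u))"

end

theory Submission
  imports Defs
begin

text \<open>
  A finite relative entropy forces \<open>Q\<close> to be absolutely continuous with respect to \<open>R\<^sup>x\<close>, and the cost
  \<open>f\<^bsub>AB\<^esub>\<close> forces \<open>Q\<close> to charge only the event that the path hits \<open>B\<close> before \<open>A\<close>. Hence the minimizer is
  \<open>R\<^sup>x\<close> conditioned on this event, and the value is minus the logarithm of its probability. Since \<open>h\<close> is harmonic off
  \<open>A \<union> B\<close>, the process \<open>h (X\<^bsub>t \<and> \<tau>\<^esub>)\<close> is a bounded martingale that converges to \<open>1\<^sub>B (X\<^sub>\<tau>)\<close>, so the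
  probability is \<open>h x\<close> and this martingale, divided by \<open>h x\<close>, is the density process of the conditioned law.

  The martingale problem for the conditioned law is Girsanov's theorem for this density process. Almost all paths are
  piecewise constant, so no stochastic integration is needed: the sum of jumps is integrated against the
  density process along partitions of the time interval, and dominated convergence with the integrable number of jumps
  as bound gives the compensator formula for predictable integrands, the stopping at \<open>\<tau>\<close>, and the product
  formula.
\<close>

section \<open>Pure jump paths\<close>

text \<open>Nothing is known beforehand about the sign of \<open>h\<close> or about how close it
  comes to \<open>0\<close>, so the kernel with the factor \<open>h y / h z\<close> has no a priori
  bound on its rate. Two facts absorb this. As long as the path has not reached
  \<open>A \<union> B\<close>, the value of \<open>h\<close> along it is a conditional probability,
  hence nonnegative, and a compensator argument carries the sign over to almost every target of a
  jump; so truncating the quotient at \<open>0\<close> is harmless. And the product of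
  \<open>\<bar>h z\<bar>\<close> with the total transformed rate at \<open>z\<close> is bounded,
  which makes the compensator finite in mean under the conditioned law.

  The other obstacle is null sets. The given filtration lives in the completion of \<open>R\<close>
  but need not contain its null sets, while the path properties hold only almost surely. Events
  about \<open>\<tau>\<close> are therefore first written with rational times, adaptedness of jump
  sums is stated for versions, and the final martingale uses the filtration augmented by the null
  sets of the conditioned law.\<close>

abbreviation jumps_in :: "(real \<Rightarrow> 'a::polish_space) \<Rightarrow> real \<Rightarrow> real \<Rightarrow> real set" where
  "jumps_in \<omega> s t \<equiv> jump_times \<omega> \<inter> {s<..t}"

lemma jump_times_pos: "u \<in> jump_times \<omega> \<Longrightarrow> 0 < u"
  by (auto simp: jump_times_def left_lim_def split: if_splits)

lemma pure_jump_finite: "pure_jump \<omega> \<Longrightarrow> finite (jumps_in \<omega> s t)"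
proof -
  assume "pure_jump \<omega>"
  then have "finite (jump_times \<omega> \<inter> {..max 0 t})" unfolding pure_jump_def by auto
  then show ?thesis by (rule finite_subset[rotated]) auto
qed

lemma pure_jump_const:
  "pure_jump \<omega> \<Longrightarrow> 0 \<le> s \<Longrightarrow> s \<le> t \<Longrightarrow> jumps_in \<omega> s t = {} \<Longrightarrow> \<omega> s = \<omega> t"
  unfolding pure_jump_def by blast

lemma pure_jump_countable:
  assumes "pure_jump \<omega>" shows "countable (jump_times \<omega>)"
proof -
  have "jump_times \<omega> \<subseteq> (\<Union>n::nat. jumps_in \<omega> 0 (real n))"
    by (auto dest: jump_times_pos intro: real_arch_simple)
  moreover have "countable (\<Union>n::nat. jumps_in \<omega> 0 (real n))"
    using pure_jump_finite[OF assms] by (intro countable_UN) (auto intro: countable_finite)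
  ultimately show ?thesis by (rule countable_subset)
qed

lemma pure_jump_const_right:
  assumes "pure_jump \<omega>" "0 \<le> t"
  obtains e where "0 < e" "\<And>u. t \<le> u \<Longrightarrow> u < t + e \<Longrightarrow> \<omega> u = \<omega> t"
proof -
  let ?J = "jumps_in \<omega> t (t + 1)"
  have fin: "finite (insert (t + 1) ?J)" using pure_jump_finite[OF assms(1)] by simp
  \<comment> \<open>\<open>t + 1\<close> is a sentinel: with it the minimum exists even if no jump
    follows \<open>t\<close> within unit time.\<close>
  define m where "m = Min (insert (t + 1) ?J)"
  have m: "m \<in> insert (t + 1) ?J" unfolding m_def using fin by (intro Min_in) auto
  have le: "m \<le> v" if "v \<in> insert (t + 1) ?J" for v unfolding m_def using fin that by (intro Min_le) auto
  show ?thesis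
  proof (rule that[of "m - t"])
    show "0 < m - t" using m by auto
    fix u assume u: "t \<le> u" "u < t + (m - t)"
    have "v \<notin> jumps_in \<omega> t u" for v
      using le[of v] le[of "t + 1"] u by auto
    then have "jumps_in \<omega> t u = {}" by blast
    then show "\<omega> u = \<omega> t" using pure_jump_const[OF assms(1,2) u(1)] by simp
  qed
qed

text \<open>The witness is the last jump before \<open>t\<close>, or \<open>0\<close> if there is
  none. From then on the path is at rest, so its left limit at \<open>t\<close> is an actual value
  of the path. The clause on jump times lets a caller peel off one jump at a time.\<close>

lemma pure_jump_const_left:
  assumes "pure_jump \<omega>" "0 < t"
  obtains v where "0 \<le> v" "v < t" "\<And>u. v \<le> u \<Longrightarrow> u < t \<Longrightarrow> \<omega> u = left_lim \<omega> t"
    "jump_times \<omega> \<inter> {v<..<t} = {}"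
proof -
  let ?J = "jump_times \<omega> \<inter> {0<..<t}"
  have fin: "finite (insert 0 ?J)"
    by (intro finite.insertI finite_subset[OF _ pure_jump_finite[OF assms(1), of 0 t]]) auto
  define m where "m = Max (insert 0 ?J)"
  have m: "m \<in> insert 0 ?J" unfolding m_def using fin by (intro Max_in) auto
  have le: "w \<le> m" if "w \<in> insert 0 ?J" for w unfolding m_def using fin that by (intro Max_ge) auto
  have m0: "0 \<le> m" "m < t" using m assms(2) by auto
  have c: "\<omega> u = \<omega> m" if "m \<le> u" "u < t" for u
  proof -
    have "v \<notin> jumps_in \<omega> m u" for v
      using le[of v] that m0 by auto
    then have "jumps_in \<omega> m u = {}" by blast
    then show ?thesis using pure_jump_const[OF assms(1) m0(1) that(1)] by simp
  qed
  have "(\<omega> \<longlongrightarrow> \<omega> m) (at_left t)"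
  proof (rule tendsto_eventually)
    show "eventually (\<lambda>u. \<omega> u = \<omega> m) (at_left t)"
      unfolding eventually_at_left_field by (rule exI[of _ m], use m0(2) in \<open>blast intro: c less_imp_le\<close>)
  qed
  then have lim: "left_lim \<omega> t = \<omega> m"
    unfolding left_lim_def using assms(2) tendsto_Lim[of "at_left t" \<omega> "\<omega> m"] by simp
  have "v \<notin> jump_times \<omega> \<inter> {m<..<t}" for v using le[of v] m0 by auto
  then have empty: "jump_times \<omega> \<inter> {m<..<t} = {}" by blast
  show ?thesis
  proof (rule that[OF m0 _ empty])
    show "\<omega> u = left_lim \<omega> t" if "m \<le> u" "u < t" for u unfolding lim using that by (rule c)
  qed
qed

lemma cadlag_right: "\<omega> \<in> cadlag_paths \<Longrightarrow> 0 \<le> t \<Longrightarrow> (\<omega> \<longlongrightarrow> \<omega> t) (at_right t)"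
  by (auto simp: cadlag_paths_def)

section \<open>Survival and hitting times on pure jump paths\<close>

text \<open>Quantifying over rational times makes the event a countable combination of coordinates.
  On pure jump paths it is \<open>u \<le> \<tau>\<close>: it looks only at times strictly before
  \<open>u\<close>, so it can weight a jump at \<open>u\<close> predictably, the jump at
  \<open>\<tau>\<close> included. The companion \<open>alive\<close> is
  \<open>u < \<tau>\<close>.\<close>

definition alive_before :: "'a set \<Rightarrow> real \<Rightarrow> (real \<Rightarrow> 'a) \<Rightarrow> bool" where
  "alive_before D u \<omega> \<longleftrightarrow> (\<forall>q\<in>\<rat>. 0 \<le> q \<and> q < u \<longrightarrow> \<omega> q \<notin> D)"

definition alive :: "'a set \<Rightarrow> real \<Rightarrow> (real \<Rightarrow> 'a) \<Rightarrow> bool" where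
  "alive D u \<omega> \<longleftrightarrow> alive_before D u \<omega> \<and> \<omega> u \<notin> D"

text \<open>Off a null set this is the event that the path is in \<open>C\<close> when it first hits \<open>D\<close>,
  written with rational times only, so that its measurability is plain.\<close>

definition hits_in :: "'a set \<Rightarrow> 'a set \<Rightarrow> (real \<Rightarrow> 'a) \<Rightarrow> bool" where
  "hits_in D C \<omega> \<longleftrightarrow> (\<exists>q\<in>\<rat>. 0 \<le> q \<and> \<omega> q \<in> D \<inter> C \<and> (\<forall>r\<in>\<rat>. 0 \<le> r \<and> r < q \<longrightarrow> \<omega> r \<notin> D - C))"

text \<open>The path rests at its value for a while after \<open>r\<close>, so a rational time
  slightly later still sees it. This is how statements over rational times reach all real
  times.\<close>

lemma rational_after:
  assumes "pure_jump \<omega>" "0 \<le> r" "r < (u::real)"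
  obtains q where "q \<in> \<rat>" "r < q" "q < u" "\<omega> q = \<omega> r"
proof -
  obtain e where e: "0 < e" "\<And>v. r \<le> v \<Longrightarrow> v < r + e \<Longrightarrow> \<omega> v = \<omega> r"
    using pure_jump_const_right[OF assms(1,2)] by blast
  obtain q where "q \<in> \<rat>" "r < q" "q < min u (r + e)"
    using Rats_dense_in_real[of r "min u (r + e)"] assms(3) e(1) by auto
  then show ?thesis using that e(2)[of q] by auto
qed

lemma alive_before_iff:
  assumes "pure_jump \<omega>"
  shows "alive_before D u \<omega> \<longleftrightarrow> (\<forall>r. 0 \<le> r \<and> r < u \<longrightarrow> \<omega> r \<notin> D)"
proof
  assume a: "alive_before D u \<omega>"
  show "\<forall>r. 0 \<le> r \<and> r < u \<longrightarrow> \<omega> r \<notin> D"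
  proof (intro allI impI)
    fix r assume r: "0 \<le> r \<and> r < u"
    then obtain q where "q \<in> \<rat>" "r < q" "q < u" "\<omega> q = \<omega> r"
      using rational_after[OF assms, of r u] by auto
    then show "\<omega> r \<notin> D" using a r unfolding alive_before_def by force
  qed
qed (auto simp: alive_before_def)

lemma alive_iff:
  assumes "pure_jump \<omega>" "0 \<le> u"
  shows "alive D u \<omega> \<longleftrightarrow> (\<forall>r. 0 \<le> r \<and> r \<le> u \<longrightarrow> \<omega> r \<notin> D)"
  unfolding alive_def alive_before_iff[OF assms(1)] using assms(2) by (auto simp: le_less)

text \<open>The infimum is attained for an arbitrary set \<open>D\<close>, since the path is
  constant just after it: a visit to \<open>D\<close> close behind the infimum has the value of the
  path at the infimum. Mere right-continuity would call for a closed \<open>D\<close>.\<close>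

lemma hitting_time_cases [consumes 1]:
  assumes "pure_jump \<omega>"
  obtains (inf) "hitting_time D \<omega> = \<infinity>" "\<And>r. 0 \<le> r \<Longrightarrow> \<omega> r \<notin> D"
  | (fin) T where "0 \<le> T" "hitting_time D \<omega> = ereal T" "\<omega> T \<in> D" "\<And>r. 0 \<le> r \<Longrightarrow> r < T \<Longrightarrow> \<omega> r \<notin> D"
proof (cases "\<exists>r\<ge>0. \<omega> r \<in> D")
  case False
  then have *: "{t. 0 \<le> t \<and> \<omega> t \<in> D} = {}" by auto
  have "hitting_time D \<omega> = \<infinity>" unfolding hitting_time_def * by (simp add: top_ereal_def)
  with False show ?thesis using inf by blast
next
  case True
  let ?S = "{t. 0 \<le> t \<and> \<omega> t \<in> D}"
  have ne: "?S \<noteq> {}" and bdd: "bdd_below ?S" using True by (auto intro: bdd_belowI[of _ 0])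
  define T where "T = Inf ?S"
  have T0: "0 \<le> T" unfolding T_def using ne by (intro cInf_greatest) auto
  have below: "\<omega> r \<notin> D" if "0 \<le> r" "r < T" for r
    using cInf_lower[OF _ bdd, of r] that unfolding T_def by auto
  have TD: "\<omega> T \<in> D"
  proof -
    obtain e where e: "0 < e" "\<And>v. T \<le> v \<Longrightarrow> v < T + e \<Longrightarrow> \<omega> v = \<omega> T"
      using pure_jump_const_right[OF assms T0] by blast
    obtain r where r: "r \<in> ?S" "r < T + e"
      using cInf_lessD[OF ne, of "T + e"] e(1) unfolding T_def by auto
    with below have "T \<le> r" by force
    with e(2)[of r] r show ?thesis by auto
  qed
  have "hitting_time D \<omega> = ereal T"
    unfolding hitting_time_def
  proof (rule antisym)
    show "Inf (ereal ` ?S) \<le> ereal T" using TD T0 by (intro Inf_lower) auto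
    show "ereal T \<le> Inf (ereal ` ?S)" using below by (intro Inf_greatest) force
  qed
  then show ?thesis using fin T0 TD below by blast
qed

lemma alive_before_hitting:
  assumes "pure_jump \<omega>"
  shows "alive_before D u \<omega> \<longleftrightarrow> ereal u \<le> hitting_time D \<omega>"
  unfolding alive_before_iff[OF assms]
  using assms(1)
proof (cases rule: hitting_time_cases[where D = D])
  case (fin T)
  show "(\<forall>r. 0 \<le> r \<and> r < u \<longrightarrow> \<omega> r \<notin> D) \<longleftrightarrow> ereal u \<le> hitting_time D \<omega>"
    unfolding fin(2) ereal_less_eq using fin(1,3,4) by (meson less_le_trans not_le)
qed auto

lemma alive_hitting:
  assumes "pure_jump \<omega>" "0 \<le> u"
  shows "alive D u \<omega> \<longleftrightarrow> ereal u < hitting_time D \<omega>"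
  unfolding alive_iff[OF assms]
  using assms(1)
proof (cases rule: hitting_time_cases[where D = D])
  case (fin T)
  show "(\<forall>r. 0 \<le> r \<and> r \<le> u \<longrightarrow> \<omega> r \<notin> D) \<longleftrightarrow> ereal u < hitting_time D \<omega>"
    unfolding fin(2) less_ereal.simps using fin(1,3,4) by (meson le_less_trans not_le)
qed auto

lemma alive_before_imp: "pure_jump \<omega> \<Longrightarrow> alive_before D t \<omega> \<Longrightarrow> 0 \<le> s \<Longrightarrow> s < t \<Longrightarrow> alive D s \<omega>"
  by (auto simp: alive_iff alive_before_iff)

text \<open>As \<open>v\<close> increases to \<open>u\<close>, the condition
  \<open>v < \<tau>\<close> settles at \<open>u \<le> \<tau>\<close>. So weights taken at left ends
  of partition cells converge to the predictable weight \<open>alive_before\<close>, not to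
  \<open>alive\<close>.\<close>

lemma alive_left_limit:
  assumes "pure_jump \<omega>" "0 < u"
  shows "eventually (\<lambda>v. alive D v \<omega> \<longleftrightarrow> alive_before D u \<omega>) (at_left u)"
proof (cases "alive_before D u \<omega>")
  case True
  then show ?thesis
    using assms alive_before_imp[OF assms(1) True] by (auto simp: eventually_at_left_field intro!: exI[of _ 0])
next
  case False
  then obtain r where r: "0 \<le> r" "r < u" "\<omega> r \<in> D" using alive_before_iff[OF assms(1)] by blast
  then have "\<not> alive D v \<omega>" if "r < v" for v using alive_iff[OF assms(1), of v D] that by auto
  then show ?thesis using False r
    by (auto simp: eventually_at_left_field intro!: exI[of _ r])
qed

text \<open>The two notions part only at the single instant \<open>\<tau>\<close>. Jump sums must
  keep them apart, because \<open>\<tau>\<close> can be a jump time, but a time integral cannot tell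
  the difference.\<close>

lemma alive_eq_before:
  assumes "pure_jump \<omega>" "0 \<le> u" "ereal u \<noteq> hitting_time D \<omega>"
  shows "alive D u \<omega> \<longleftrightarrow> alive_before D u \<omega>"
  using assms by (auto simp: alive_hitting alive_before_hitting)

text \<open>The hitting time may be irrational, so the rational witness sits slightly after it. That
  is why \<open>hits_in\<close> forbids only earlier visits to \<open>D - C\<close>: time already
  spent in \<open>D \<inter> C\<close> since the hit does no harm.\<close>

lemma hits_in_iff:
  assumes "pure_jump \<omega>"
  shows "hits_in D C \<omega> \<longleftrightarrow> hitting_time D \<omega> < \<infinity> \<and> stopped_value (hitting_time D) \<omega> \<in> C"
  using assms(1)
proof (cases rule: hitting_time_cases[where D = D])
  case inf
  then show ?thesis by (auto simp: hits_in_def)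
next
  case (fin T)
  have sv: "stopped_value (hitting_time D) \<omega> = \<omega> T" using fin by (simp add: stopped_value_def)
  obtain q0 where q0: "q0 \<in> \<rat>" "T < q0" "\<omega> q0 = \<omega> T" "q0 < T + 1"
    using rational_after[OF assms fin(1), of "T + 1"] by auto
  show ?thesis
  proof (cases "\<omega> T \<in> C")
    case True
    obtain e where e: "0 < e" "\<And>v. T \<le> v \<Longrightarrow> v < T + e \<Longrightarrow> \<omega> v = \<omega> T"
      using pure_jump_const_right[OF assms fin(1)] by blast
    obtain q where q: "q \<in> \<rat>" "T < q" "q < T + e"
      using Rats_dense_in_real[of T "T + e"] e by auto
    have "\<omega> r \<notin> D - C" if "0 \<le> r" "r < q" for r
      using fin(4)[of r] e(2)[of r] that q True by (cases "r < T") auto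
    then show ?thesis using q e(2)[of q] fin True sv unfolding hits_in_def
      by (auto intro!: bexI[of _ q])
  next
    case False
    have "\<not> hits_in D C \<omega>"
    proof
      assume "hits_in D C \<omega>"
      then obtain q where q: "q \<in> \<rat>" "0 \<le> q" "\<omega> q \<in> D \<inter> C" "\<And>r. r \<in> \<rat> \<Longrightarrow> 0 \<le> r \<Longrightarrow> r < q \<Longrightarrow> \<omega> r \<notin> D - C"
        unfolding hits_in_def by auto
      \<comment> \<open>Before \<open>T\<close> the path is outside \<open>D\<close>, and at
        \<open>T\<close> it is outside \<open>C\<close>, so a witness comes strictly later; then a
        rational time between \<open>T\<close> and \<open>q\<close> sees the forbidden value
        \<open>\<omega> T\<close>.\<close>
      have "T < q" using fin(4)[of q] q False by (cases "q = T") force+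
      then obtain r where "r \<in> \<rat>" "T < r" "r < q" "\<omega> r = \<omega> T"
        using rational_after[OF assms fin(1), of q] by auto
      then show False using q(4)[of r] fin False by auto
    qed
    then show ?thesis using False sv by simp
  qed
qed

text \<open>Induction on the number of jumps, removing the last one \<open>m\<close>. The path is
  constant from \<open>m\<close> to \<open>t\<close>, and just before \<open>m\<close> it already
  has the value \<open>left_lim \<omega> m\<close>, so the induction hypothesis applies up to that
  earlier time.\<close>

lemma pure_jump_telescope:
  fixes g :: "'a::polish_space \<Rightarrow> real"
  assumes "pure_jump \<omega>" "0 \<le> s" "s \<le> t"
  shows "(\<Sum>u\<in>jumps_in \<omega> s t. g (\<omega> u) - g (left_lim \<omega> u)) = g (\<omega> t) - g (\<omega> s)"
  using assms(3)
proof (induction "card (jumps_in \<omega> s t)" arbitrary: t rule: less_induct)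
  case less
  show ?case
  proof (cases "jumps_in \<omega> s t = {}")
    case True
    then show ?thesis using pure_jump_const[OF assms(1,2) less(2)] by simp
  next
    case False
    have fin: "finite (jumps_in \<omega> s t)" using pure_jump_finite[OF assms(1)] .
    define m where "m = Max (jumps_in \<omega> s t)"
    have m: "m \<in> jumps_in \<omega> s t" unfolding m_def using fin False by (intro Max_in)
    have mle: "w \<le> m" if "w \<in> jumps_in \<omega> s t" for w unfolding m_def using fin that by (intro Max_ge)
    have "v \<notin> jumps_in \<omega> m t" for v using mle[of v] m by auto
    then have "jumps_in \<omega> m t = {}" by blast
    then have wt: "\<omega> t = \<omega> m" using pure_jump_const[OF assms(1), of m t] m assms(2) by auto
    obtain v where v: "0 \<le> v" "v < m" "\<And>u. v \<le> u \<Longrightarrow> u < m \<Longrightarrow> \<omega> u = left_lim \<omega> m"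
      "jump_times \<omega> \<inter> {v<..<m} = {}"
      using pure_jump_const_left[OF assms(1), of m] m assms(2) by auto
    \<comment> \<open>At \<open>v\<close> all jumps before \<open>m\<close> are over; the maximum
      keeps the new end point from falling below \<open>s\<close>.\<close>
    define r where "r = max s v"
    have r: "s \<le> r" "r < m" "\<omega> r = left_lim \<omega> m" using v m unfolding r_def by auto
    have eq: "jumps_in \<omega> s t = insert m (jumps_in \<omega> s r)"
    proof (intro equalityI subsetI)
      fix w assume w: "w \<in> jumps_in \<omega> s t"
      have "w \<le> r" if "w < m" "\<not> w \<le> v" 
        using v(4) that w by auto
      then show "w \<in> insert m (jumps_in \<omega> s r)"
        using w mle[OF w] unfolding r_def by force
    qed (use m r in auto)
    have nin: "m \<notin> jumps_in \<omega> s r" using r by auto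
    have "card (jumps_in \<omega> s r) < card (jumps_in \<omega> s t)"
      unfolding eq using nin pure_jump_finite[OF assms(1)] by simp
    from less(1)[OF this r(1)] show ?thesis
      unfolding eq using nin pure_jump_finite[OF assms(1), of s r] r wt by simp
  qed
qed

section \<open>Measurability along paths\<close>

text \<open>Sampling the path at the next grid point to the right gives jointly measurable
  approximations, and right-continuity gives their limit. Clamping the time changes nothing between
  \<open>0\<close> and \<open>T\<close> and uses coordinates up to \<open>T\<close> only, so
  \<open>N\<close> may be the sigma-algebra at time \<open>T\<close>.\<close>

lemma progressive_measurable:
  fixes N :: "(real \<Rightarrow> 'a::polish_space) measure"
  assumes sp: "space N \<subseteq> cadlag_paths" and T: "0 \<le> T"
    and X: "\<And>u. 0 \<le> u \<Longrightarrow> u \<le> T \<Longrightarrow> (\<lambda>\<omega>. \<omega> u) \<in> N \<rightarrow>\<^sub>M borel"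
  shows "(\<lambda>(u, \<omega>). \<omega> (max 0 (min T u))) \<in> borel \<Otimes>\<^sub>M N \<rightarrow>\<^sub>M borel"
proof -
  let ?v = "\<lambda>u. max 0 (min T u)"
  \<comment> \<open>The \<open>+ 1\<close> after the floor puts the grid point strictly beyond the
    current time, as convergence along \<open>at_right\<close> demands; the \<open>min\<close> with
    \<open>T\<close> keeps it from looking into the future.\<close>
  define a where "a n i = max 0 (min T ((real_of_int i + 1) / real (Suc n)))" for n :: nat and i :: int
  define k where "k n u = \<lfloor>real (Suc n) * ?v u\<rfloor>" for n :: nat and u :: real
  have meas: "(\<lambda>p. (snd p) (a n (k n (fst p)))) \<in> borel \<Otimes>\<^sub>M N \<rightarrow>\<^sub>M borel" for n
  proof (rule measurable_compose_countable[where f = "\<lambda>i p. snd p (a n i)" and g = "\<lambda>p. k n (fst p)"])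
    show "(\<lambda>p. snd p (a n i)) \<in> borel \<Otimes>\<^sub>M N \<rightarrow>\<^sub>M borel" for i
      by (rule measurable_compose[OF measurable_snd X]) (auto simp: a_def T)
    show "(\<lambda>p. k n (fst p)) \<in> borel \<Otimes>\<^sub>M N \<rightarrow>\<^sub>M count_space UNIV"
      unfolding k_def by measurable
  qed
  have lim: "(\<lambda>n. \<omega> (a n (k n u))) \<longlonglongrightarrow> \<omega> (?v u)" if "\<omega> \<in> cadlag_paths" for \<omega> :: "real \<Rightarrow> 'a" and u
  proof (cases "?v u = T")
    case True
    \<comment> \<open>Here every grid point to the right lies beyond \<open>T\<close>, and clamping
      brings it back to \<open>T\<close> itself.\<close>
    have "a n (k n u) = T" for n
    proof -
      have "real (Suc n) * T < real_of_int (k n u) + 1" unfolding k_def True by linarith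
      then have "T \<le> (real_of_int (k n u) + 1) / real (Suc n)" by (simp add: field_simps)
      then show ?thesis unfolding a_def using T by auto
    qed
    with True show ?thesis by simp
  next
    case False
    define v where "v = ?v u"
    have v: "0 \<le> v" "v < T" using False T unfolding v_def by auto
    define b where "b n = (real_of_int (k n u) + 1) / real (Suc n)" for n
    have b1: "v < b n" and b2: "b n \<le> v + inverse (real (Suc n))" for n
    proof -
      define N where "N = real (Suc n)"
      have N: "0 < N" unfolding N_def by simp
      have "real_of_int (k n u) \<le> N * v" "N * v < real_of_int (k n u) + 1"
        unfolding k_def v_def N_def by linarith+
      then show "v < b n" "b n \<le> v + inverse (real (Suc n))"
        unfolding b_def N_def[symmetric] using N by (simp_all add: field_simps)
    qed
    have blim: "b \<longlonglongrightarrow> v"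
    proof (rule tendsto_sandwich[where f = "\<lambda>_. v" and h = "\<lambda>n. v + inverse (real (Suc n))"])
      show "(\<lambda>n. v + inverse (real (Suc n))) \<longlonglongrightarrow> v"
        using tendsto_add[OF tendsto_const LIMSEQ_inverse_real_of_nat, of v] by simp
    qed (simp_all add: b2 less_imp_le[OF b1] del: of_nat_Suc)
    have ev: "eventually (\<lambda>n. b n = a n (k n u)) sequentially"
      using order_tendstoD(2)[OF blim v(2)]
    proof eventually_elim
      case (elim n)
      have "a n (k n u) = max 0 (min T (b n))" unfolding a_def b_def ..
      then show ?case using elim b1[of n] v by simp
    qed
    have "filterlim b (at_right v) sequentially"
      unfolding filterlim_at by (intro conjI always_eventually allI blim) (use b1 in \<open>auto simp: less_imp_neq[symmetric]\<close>)
    from filterlim_compose[OF cadlag_right[OF that v(1)] this]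
    have "(\<lambda>n. \<omega> (b n)) \<longlonglongrightarrow> \<omega> v" .
    then have "(\<lambda>n. \<omega> (a n (k n u))) \<longlonglongrightarrow> \<omega> v"
      by (rule Lim_transform_eventually) (use ev in \<open>auto elim: eventually_mono\<close>)
    then show ?thesis unfolding v_def .
  qed
  have "(\<lambda>p. (snd p) (?v (fst p))) \<in> borel \<Otimes>\<^sub>M N \<rightarrow>\<^sub>M borel"
    by (rule borel_measurable_LIMSEQ_metric[where f = "\<lambda>n p. (snd p) (a n (k n (fst p)))", OF meas])
       (use lim sp in \<open>auto simp: space_pair_measure\<close>)
  then show ?thesis by (simp add: case_prod_beta')
qed

lemma
  fixes P :: "'b \<Rightarrow> real \<Rightarrow> bool"
  assumes "\<And>q. Measurable.pred M (\<lambda>x. P x q)"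
  shows pred_all_rat: "Measurable.pred M (\<lambda>x. \<forall>q\<in>\<rat>. P x q)"
    and pred_ex_rat: "Measurable.pred M (\<lambda>x. \<exists>q\<in>\<rat>. P x q)"
  using assms unfolding pred_def
  by (intro sets.sets_Collect_countable_All' sets.sets_Collect_countable_Ex' countable_rat; simp)+

lemma progressive_measurable_alive:
  fixes N :: "(real \<Rightarrow> 'a::polish_space) measure"
  assumes sp: "space N \<subseteq> cadlag_paths" and T: "0 \<le> T"
    and X: "\<And>u. 0 \<le> u \<Longrightarrow> u \<le> T \<Longrightarrow> (\<lambda>\<omega>. \<omega> u) \<in> N \<rightarrow>\<^sub>M borel" and D: "D \<in> sets borel"
  shows "Measurable.pred (borel \<Otimes>\<^sub>M N) (\<lambda>(u, \<omega>). alive D (max 0 (min T u)) \<omega>)"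
proof -
  have pD: "Measurable.pred borel (\<lambda>y. y \<notin> D)" using D by measurable
  have "Measurable.pred (borel \<Otimes>\<^sub>M N) (\<lambda>p. 0 \<le> q \<and> q < max 0 (min T (fst p)) \<longrightarrow> snd p q \<notin> D)" for q
  proof (cases "0 \<le> q \<and> q \<le> T")
    case True
    have "Measurable.pred (borel \<Otimes>\<^sub>M N) (\<lambda>p. snd p q \<notin> D)"
      by (rule measurable_compose[OF measurable_snd measurable_compose[OF X pD]]) (use True in auto)
    moreover have "Measurable.pred (borel \<Otimes>\<^sub>M N) (\<lambda>p. 0 \<le> q \<and> q < max 0 (min T (fst p)))"
      by measurable
    ultimately show ?thesis by (rule pred_intros_logic(4)[rotated])
  next
    case False
    \<comment> \<open>Coordinates outside the interval from \<open>0\<close> to \<open>T\<close>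
      need not be measurable for \<open>N\<close>, but for them the premise is false.\<close>
    then have "\<not> (0 \<le> q \<and> q < max 0 (min T u))" for u using T by auto
    then have "(\<lambda>p. 0 \<le> q \<and> q < max 0 (min T (fst p)) \<longrightarrow> snd p q \<notin> D) = (\<lambda>_ :: real \<times> (real \<Rightarrow> 'a). True)"
      by blast
    then show ?thesis by (simp only:) simp
  qed
  then have "Measurable.pred (borel \<Otimes>\<^sub>M N) (\<lambda>p. \<forall>q\<in>\<rat>. 0 \<le> q \<and> q < max 0 (min T (fst p)) \<longrightarrow> snd p q \<notin> D)"
    by (rule pred_all_rat)
  moreover have "Measurable.pred (borel \<Otimes>\<^sub>M N) (\<lambda>p. snd p (max 0 (min T (fst p))) \<notin> D)"
    by (rule measurable_compose[OF _ pD]) (use progressive_measurable[OF sp T X] in \<open>simp add: case_prod_beta'\<close>)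
  ultimately show ?thesis unfolding alive_def alive_before_def case_prod_beta'
    by (rule pred_intros_logic(3))
qed

lemma alive_measurable:
  fixes N :: "(real \<Rightarrow> 'a::polish_space) measure"
  assumes T: "0 \<le> T"
    and X: "\<And>u. 0 \<le> u \<Longrightarrow> u \<le> T \<Longrightarrow> (\<lambda>\<omega>. \<omega> u) \<in> N \<rightarrow>\<^sub>M borel" and D: "D \<in> sets borel"
  shows "Measurable.pred N (alive D T)"
proof -
  have pD: "Measurable.pred borel (\<lambda>y. y \<notin> D)" using D by measurable
  have "Measurable.pred N (\<lambda>\<omega>. 0 \<le> q \<and> q < T \<longrightarrow> \<omega> q \<notin> D)" for q
    using measurable_compose[OF X pD, of q] by (cases "0 \<le> q \<and> q < T") auto
  then have "Measurable.pred N (\<lambda>\<omega>. \<forall>q\<in>\<rat>. 0 \<le> q \<and> q < T \<longrightarrow> \<omega> q \<notin> D)"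
    by (rule pred_all_rat)
  moreover have "Measurable.pred N (\<lambda>\<omega>. \<omega> T \<notin> D)"
    by (rule measurable_compose[OF X[OF T order_refl] pD])
  ultimately show ?thesis unfolding alive_def alive_before_def
    by (rule pred_intros_logic(3))
qed

lemma coordinate_measurable: "0 \<le> u \<Longrightarrow> (\<lambda>\<omega>. \<omega> u) \<in> path_space \<rightarrow>\<^sub>M borel"
  unfolding path_space_def by (intro measurable_restrict_space1 measurable_component_singleton) simp

lemma space_path_space: "space path_space = cadlag_paths"
  unfolding path_space_def by (auto simp: space_restrict_space space_PiM cadlag_paths_def PiE_def)

lemma hits_in_measurable:
  fixes N :: "(real \<Rightarrow> 'a::polish_space) measure"
  assumes X: "\<And>u. 0 \<le> u \<Longrightarrow> (\<lambda>\<omega>. \<omega> u) \<in> N \<rightarrow>\<^sub>M borel" and D: "D \<in> sets borel" and C: "C \<in> sets borel"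
  shows "Measurable.pred N (hits_in D C)"
proof -
  have pD: "Measurable.pred borel (\<lambda>y. y \<notin> D - C)" "Measurable.pred borel (\<lambda>y. y \<in> D \<inter> C)"
    using D C by measurable
  have A: "Measurable.pred N (\<lambda>\<omega>. 0 \<le> r \<and> r < q \<longrightarrow> \<omega> r \<notin> D - C)" for r q :: real
    using measurable_compose[OF X pD(1), of r] by (cases "0 \<le> r \<and> r < q") auto
  have B: "Measurable.pred N (\<lambda>\<omega>. 0 \<le> q \<and> \<omega> q \<in> D \<inter> C)" for q :: real
    using measurable_compose[OF X pD(2), of q] by (cases "0 \<le> q") auto
  have "Measurable.pred N (\<lambda>\<omega>. \<exists>q\<in>\<rat>. (0 \<le> q \<and> \<omega> q \<in> D \<inter> C) \<and> (\<forall>r\<in>\<rat>. 0 \<le> r \<and> r < q \<longrightarrow> \<omega> r \<notin> D - C))"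
    by (intro pred_ex_rat pred_intros_logic(3) pred_all_rat A B)
  then show ?thesis unfolding hits_in_def by (simp add: conj_assoc)
qed

text \<open>This is \<open>progressive_measurable\<close> over the one-point space
  \<open>{\<omega>}\<close>, with the clamping bound then sent to infinity.\<close>

lemma cadlag_measurable:
  assumes "\<omega> \<in> cadlag_paths"
  shows "(\<lambda>t. \<omega> (max 0 t)) \<in> borel \<rightarrow>\<^sub>M borel"
proof (rule borel_measurable_LIMSEQ_metric)
  fix n :: nat
  have "(\<lambda>(u, \<omega>'). \<omega>' (max 0 (min (real n) u))) \<in> borel \<Otimes>\<^sub>M count_space {\<omega>} \<rightarrow>\<^sub>M borel"
    using assms by (intro progressive_measurable) auto
  from measurable_compose[OF _ this, of "\<lambda>t. (t, \<omega>)"]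
  show "(\<lambda>t. \<omega> (max 0 (min (real n) t))) \<in> borel_measurable borel" by simp
next
  fix t :: real
  obtain n0 :: nat where "t \<le> real n0" using real_arch_simple by blast
  then have "eventually (\<lambda>n. \<omega> (max 0 (min (real n) t)) = \<omega> (max 0 t)) sequentially"
    by (intro eventually_sequentiallyI[of n0]) (use \<open>t \<le> real n0\<close> in \<open>auto simp: min_absorb2\<close>)
  then show "(\<lambda>n. \<omega> (max 0 (min (real n) t))) \<longlonglongrightarrow> \<omega> (max 0 t)" by (rule tendsto_eventually)
qed

lemma left_lim_eq: "t \<notin> jump_times \<omega> \<Longrightarrow> left_lim \<omega> t = \<omega> (max 0 t)"
  by (auto simp: jump_times_def left_lim_def max_def)

lemma left_lim_measurable:
  assumes "\<omega> \<in> cadlag_paths" "pure_jump \<omega>"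
  shows "left_lim \<omega> \<in> borel \<rightarrow>\<^sub>M borel"
  by (rule measurable_discrete_difference[OF cadlag_measurable[OF assms(1)] pure_jump_countable[OF assms(2)]])
     (auto simp: left_lim_eq)

lemma AE_left_lim: "pure_jump \<omega> \<Longrightarrow> AE t in lborel. left_lim \<omega> t = \<omega> (max 0 t)"
  by (rule AE_I'[OF countable_imp_null_set_lborel[OF pure_jump_countable]]) (use left_lim_eq in \<open>force+\<close>)

lemma AE_neq_ereal: "AE u in lborel. ereal u \<noteq> c"
  by (rule AE_I'[OF countable_imp_null_set_lborel, of "{real_of_ereal c}"]) auto

section \<open>Bounded rate kernels\<close>

definition rate_sup :: "('a::polish_space \<Rightarrow> 'a measure) \<Rightarrow> real" where
  "rate_sup L = enn2real (SUP z. emeasure (L z) UNIV)"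

locale rate_kernel =
  fixes L :: "'a::polish_space \<Rightarrow> 'a measure"
  assumes L: "bounded_rate_kernel L"
begin

lemma sets_L[simp, measurable_cong]: "sets (L z) = sets borel"
  using L by (simp add: bounded_rate_kernel_def)

lemma space_L[simp]: "space (L z) = UNIV"
  using sets_eq_imp_space_eq[OF sets_L] by simp

lemma rate_nonneg: "0 \<le> rate_sup L"
  by (simp add: rate_sup_def)

lemma emeasure_L_le: "emeasure (L z) C \<le> ennreal (rate_sup L)"
proof -
  have "emeasure (L z) C \<le> emeasure (L z) UNIV" using emeasure_space[of "L z" C] by simp
  also have "\<dots> \<le> (SUP z. emeasure (L z) UNIV)" by (rule SUP_upper) simp
  also have "\<dots> = ennreal (rate_sup L)"
    using L by (simp add: rate_sup_def bounded_rate_kernel_def less_top)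
  finally show ?thesis .
qed

lemma finite_L: "finite_measure (L z)"
  by standard (use emeasure_L_le[of z UNIV] in \<open>auto simp: top_unique\<close>)

text \<open>Scaling into the subprobability kernels brings in the measurability of integrals against
  a kernel. The \<open>+ 1\<close> keeps the divisor positive when all rates vanish.\<close>

definition sub_L :: "'a \<Rightarrow> 'a measure" where
  "sub_L z = density (L z) (\<lambda>_. ennreal (1 / (rate_sup L + 1)))"

lemma sub_L_measurable: "sub_L \<in> borel \<rightarrow>\<^sub>M subprob_algebra borel"
proof (rule measurable_subprob_algebra)
  fix z
  have "ennreal (1 / (rate_sup L + 1)) * emeasure (L z) UNIV \<le> ennreal (1 / (rate_sup L + 1)) * ennreal (rate_sup L)"
    by (intro mult_left_mono emeasure_L_le) simp
  also have "\<dots> = ennreal (rate_sup L / (rate_sup L + 1))"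
    using rate_nonneg by (simp add: ennreal_mult[symmetric])
  also have "\<dots> \<le> 1" using rate_nonneg by simp
  finally show "subprob_space (sub_L z)"
    by (intro subprob_spaceI) (auto simp: sub_L_def emeasure_density_const)
  show "sets (sub_L z) = sets borel" by (simp add: sub_L_def)
next
  fix C :: "'a set" assume C: "C \<in> sets borel"
  then have "(\<lambda>z. ennreal (1 / (rate_sup L + 1)) * emeasure (L z) C) \<in> borel_measurable borel"
    using L by (auto simp: bounded_rate_kernel_def)
  then show "(\<lambda>z. emeasure (sub_L z) C) \<in> borel_measurable borel"
    using C by (simp add: sub_L_def emeasure_density_const)
qed

lemma nn_integral_L_measurable:
  assumes f: "(\<lambda>(p, y). f p y) \<in> borel_measurable (M \<Otimes>\<^sub>M borel)" and g: "g \<in> M \<rightarrow>\<^sub>M borel"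
  shows "(\<lambda>p. \<integral>\<^sup>+ y. f p y \<partial>L (g p)) \<in> borel_measurable M"
proof -
  have eq: "(\<integral>\<^sup>+ y. f p y \<partial>L (g p)) = ennreal (rate_sup L + 1) * (\<integral>\<^sup>+ y. f p y \<partial>sub_L (g p))" if "p \<in> space M" for p
  proof -
    have [measurable]: "f p \<in> borel_measurable borel"
      using measurable_compose[OF measurable_Pair1'[OF that] f] by simp
    have "(\<integral>\<^sup>+ y. f p y \<partial>sub_L (g p)) = ennreal (1 / (rate_sup L + 1)) * (\<integral>\<^sup>+ y. f p y \<partial>L (g p))"
      unfolding sub_L_def by (subst nn_integral_density) (auto simp: nn_integral_cmult)
    moreover have "ennreal (rate_sup L + 1) * ennreal (1 / (rate_sup L + 1)) = 1"
      using rate_nonneg by (simp add: ennreal_mult[symmetric] del: ennreal_plus)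
    ultimately show ?thesis by (simp add: mult.assoc[symmetric] del: ennreal_plus)
  qed
  have "(\<lambda>p. \<integral>\<^sup>+ y. f p y \<partial>sub_L (g p)) \<in> borel_measurable M"
    by (rule nn_integral_measurable_subprob_algebra2[OF f])
       (rule measurable_compose[OF g sub_L_measurable])
  then show ?thesis by (subst measurable_cong[OF eq]) auto
qed

lemma integral_L_measurable:
  fixes f :: "_ \<Rightarrow> _ \<Rightarrow> real"
  assumes f: "(\<lambda>(p, y). f p y) \<in> borel_measurable (M \<Otimes>\<^sub>M borel)" and g: "g \<in> M \<rightarrow>\<^sub>M borel"
    and i: "\<And>p. p \<in> space M \<Longrightarrow> integrable (L (g p)) (f p)"
  shows "(\<lambda>p. \<integral>y. f p y \<partial>L (g p)) \<in> borel_measurable M"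
proof -
  have eq: "(\<integral>y. f p y \<partial>L (g p)) =
      enn2real (\<integral>\<^sup>+ y. ennreal (f p y) \<partial>L (g p)) - enn2real (\<integral>\<^sup>+ y. ennreal (- f p y) \<partial>L (g p))"
    if "p \<in> space M" for p
    by (rule real_lebesgue_integral_def[OF i[OF that]])
  have f': "(\<lambda>p. f (fst p) (snd p)) \<in> borel_measurable (M \<Otimes>\<^sub>M borel)" using f by (simp add: case_prod_beta')
  have "(\<lambda>p. \<integral>\<^sup>+ y. ennreal (f p y) \<partial>L (g p)) \<in> borel_measurable M"
    "(\<lambda>p. \<integral>\<^sup>+ y. ennreal (- f p y) \<partial>L (g p)) \<in> borel_measurable M"
    using f' by (auto intro!: nn_integral_L_measurable g simp: case_prod_beta')
  then show ?thesis by (subst measurable_cong[OF eq]) auto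
qed

lemma integrable_L:
  fixes f :: "'a \<Rightarrow> real"
  assumes "f \<in> borel_measurable borel" "\<And>y. \<bar>f y\<bar> \<le> c"
  shows "integrable (L z) f"
proof -
  interpret finite_measure "L z" by (rule finite_L)
  show ?thesis using assms by (intro integrable_const_bound[of _ c]) auto
qed

lemma integral_L_bound:
  fixes f :: "'a \<Rightarrow> real"
  assumes f: "f \<in> borel_measurable borel" "\<And>y. \<bar>f y\<bar> \<le> c"
  shows "\<bar>\<integral>y. f y \<partial>L z\<bar> \<le> c * rate_sup L"
proof -
  interpret finite_measure "L z" by (rule finite_L)
  have "\<bar>\<integral>y. f y \<partial>L z\<bar> \<le> (\<integral>y. \<bar>f y\<bar> \<partial>L z)" by (rule integral_abs_bound)
  also have "\<dots> \<le> (\<integral>y. c \<partial>L z)"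
    using f by (intro integral_mono integrable_abs integrable_L[of f c] integrable_const) auto
  also have "\<dots> = c * measure (L z) UNIV" by simp
  also have "\<dots> \<le> c * rate_sup L"
    using order_trans[OF abs_ge_zero f(2)[of undefined]] emeasure_L_le[of z UNIV] rate_nonneg
    by (intro mult_left_mono) (auto simp: emeasure_eq_measure)
  finally show ?thesis .
qed

subsection \<open>Integration with respect to the Levy kernel\<close>

text \<open>\<open>measure_of\<close> yields the zero measure unless the set function is countably
  additive, so additivity has to be proved for each path. The left limits are first replaced by
  current values, which differ at countably many times only and are measurable in time.\<close>

lemma
  assumes w: "\<omega> \<in> cadlag_paths" "pure_jump \<omega>"
  shows sets_levy: "sets (levy_kernel (\<lambda>_. L) \<omega>) = sets (borel \<Otimes>\<^sub>M borel)"
    and emeasure_levy: "C \<in> sets (borel \<Otimes>\<^sub>M borel) \<Longrightarrow> emeasure (levy_kernel (\<lambda>_. L) \<omega>) C =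
      (\<integral>\<^sup>+ t\<in>{0..}. (\<integral>\<^sup>+ y. indicator C (t, y) \<partial>L (\<omega> (max 0 t))) \<partial>lborel)"
proof -
  have sa: "sigma_algebra UNIV (sets (borel \<Otimes>\<^sub>M borel :: (real \<times> 'a) measure))"
    using sets.sigma_algebra_axioms[of "borel \<Otimes>\<^sub>M borel :: (real \<times> 'a) measure"] by (simp add: space_pair_measure)
  then show sets: "sets (levy_kernel (\<lambda>_. L) \<omega>) = sets (borel \<Otimes>\<^sub>M borel)"
    unfolding levy_kernel_def by (rule sigma_algebra.sets_measure_of_eq)
  let ?m = "\<lambda>C. \<integral>\<^sup>+ t\<in>{0..}. emeasure (L (left_lim \<omega> t)) {y. (t, y) \<in> C} \<partial>lborel"
  let ?n = "\<lambda>C. \<integral>\<^sup>+ t\<in>{0..}. (\<integral>\<^sup>+ y. indicator C (t, y) \<partial>L (\<omega> (max 0 t))) \<partial>lborel"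
  have [measurable]: "(\<lambda>t. \<omega> (max 0 t)) \<in> borel \<rightarrow>\<^sub>M borel" by (rule cadlag_measurable[OF w(1)])
  have slice: "{y. (t, y) \<in> C} \<in> sets borel" if "C \<in> sets (borel \<Otimes>\<^sub>M borel)" for t :: real and C :: "(real \<times> 'a) set"
    using sets_Pair1[OF that, of t] by (simp add: vimage_def)
  have eq: "?m C = ?n C" if C: "C \<in> sets (borel \<Otimes>\<^sub>M borel)" for C
  proof (rule nn_integral_cong_AE)
    show "AE t in lborel. emeasure (L (left_lim \<omega> t)) {y. (t, y) \<in> C} * indicator {0..} t =
       (\<integral>\<^sup>+ y. indicator C (t, y) \<partial>L (\<omega> (max 0 t))) * indicator {0..} t"
      using AE_left_lim[OF w(2)]
    proof eventually_elim
      case (elim t)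
      have "(\<integral>\<^sup>+ y. indicator C (t, y) \<partial>L z) = emeasure (L z) {y. (t, y) \<in> C}" for z
        using slice[OF C, of t] nn_integral_indicator[of "{y. (t, y) \<in> C}" "L z"] by (simp add: indicator_def)
      then show ?case using elim by simp
    qed
  qed
  have pos: "positive (sets (borel \<Otimes>\<^sub>M borel)) ?m" by (auto simp: positive_def)
  have ca: "countably_additive (sets (borel \<Otimes>\<^sub>M borel)) ?m"
  proof (rule countably_additiveI)
    fix A :: "nat \<Rightarrow> (real \<times> 'a) set"
    assume A: "range A \<subseteq> sets (borel \<Otimes>\<^sub>M borel)" "disjoint_family A" "(\<Union>i. A i) \<in> sets (borel \<Otimes>\<^sub>M borel)"
    have Ai[measurable]: "A i \<in> sets (borel \<Otimes>\<^sub>M borel)" for i using A by auto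
    have mi: "(\<lambda>t. \<integral>\<^sup>+ y. indicator (A i) (t, y) \<partial>L (\<omega> (max 0 t))) \<in> borel_measurable borel" for i
      by (rule nn_integral_L_measurable) auto
    have "(\<Sum>i. ?m (A i)) = (\<Sum>i. ?n (A i))" using eq[OF Ai] by simp
    also have "\<dots> = (\<integral>\<^sup>+ t. (\<Sum>i. (\<integral>\<^sup>+ y. indicator (A i) (t, y) \<partial>L (\<omega> (max 0 t))) * indicator {0..} t) \<partial>lborel)"
      by (intro nn_integral_suminf[symmetric] borel_measurable_times_ennreal) (simp_all add: mi)
    also have "\<dots> = ?n (\<Union>i. A i)"
    proof (intro nn_integral_cong)
      fix t
      have "(\<integral>\<^sup>+ y. indicator (\<Union>i. A i) (t, y) \<partial>L (\<omega> (max 0 t))) = (\<integral>\<^sup>+ y. (\<Sum>i. indicator (A i) (t, y)) \<partial>L (\<omega> (max 0 t)))"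
        using A(2) by (simp add: suminf_indicator)
      also have "\<dots> = (\<Sum>i. \<integral>\<^sup>+ y. indicator (A i) (t, y) \<partial>L (\<omega> (max 0 t)))"
        by (rule nn_integral_suminf) measurable
      finally show "(\<Sum>i. (\<integral>\<^sup>+ y. indicator (A i) (t, y) \<partial>L (\<omega> (max 0 t))) * indicator {0..} t) =
         (\<integral>\<^sup>+ y. indicator (\<Union>i. A i) (t, y) \<partial>L (\<omega> (max 0 t))) * indicator {0..} t" by simp
    qed
    also have "\<dots> = ?m (\<Union>i. A i)" using eq[OF A(3)] by simp
    finally show "(\<Sum>i. ?m (A i)) = ?m (\<Union>i. A i)" .
  qed
  show "emeasure (levy_kernel (\<lambda>_. L) \<omega>) C = ?n C" if C: "C \<in> sets (borel \<Otimes>\<^sub>M borel)"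
    unfolding eq[OF C, symmetric]
    unfolding levy_kernel_def by (rule emeasure_measure_of_sigma[OF sa pos ca C])
qed

lemma nn_integral_levy:
  assumes w: "\<omega> \<in> cadlag_paths" "pure_jump \<omega>" and f: "f \<in> borel_measurable (borel \<Otimes>\<^sub>M borel)"
  shows "(\<integral>\<^sup>+ p. f p \<partial>levy_kernel (\<lambda>_. L) \<omega>) = (\<integral>\<^sup>+ t\<in>{0..}. (\<integral>\<^sup>+ y. f (t, y) \<partial>L (\<omega> (max 0 t))) \<partial>lborel)"
  using f
proof (induction rule: borel_measurable_induct)
  case (cong f g)
  then show ?case by (simp add: space_pair_measure)
next
  case (set A)
  then show ?case using emeasure_levy[OF w set] sets_levy[OF w] by (subst nn_integral_indicator) auto
next
  case (mult u c)
  note [measurable] = mult(2) cadlag_measurable[OF w(1)]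
  have [measurable]: "u \<in> borel_measurable (levy_kernel (\<lambda>_. L) \<omega>)" 
    using mult(2) measurable_cong_sets[OF sets_levy[OF w] refl] by blast
  have "(\<lambda>t. \<integral>\<^sup>+ y. u (t, y) \<partial>L (\<omega> (max 0 t))) \<in> borel_measurable borel"
    by (rule nn_integral_L_measurable) auto
  then show ?case using mult.IH by (simp add: nn_integral_cmult mult.assoc)
next
  case (add u v)
  note [measurable] = add(1,3) cadlag_measurable[OF w(1)]
  have [measurable]: "u \<in> borel_measurable (levy_kernel (\<lambda>_. L) \<omega>)" "v \<in> borel_measurable (levy_kernel (\<lambda>_. L) \<omega>)"
    using add(1,3) measurable_cong_sets[OF sets_levy[OF w] refl] by blast+
  have "(\<lambda>t. \<integral>\<^sup>+ y. u (t, y) \<partial>L (\<omega> (max 0 t))) \<in> borel_measurable borel"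
     "(\<lambda>t. \<integral>\<^sup>+ y. v (t, y) \<partial>L (\<omega> (max 0 t))) \<in> borel_measurable borel"
    by (rule nn_integral_L_measurable; auto)+
  then show ?case using add.IH by (simp add: nn_integral_add distrib_right)
next
  case (seq U)
  note [measurable] = seq(1) cadlag_measurable[OF w(1)]
  have [measurable]: "U i \<in> borel_measurable (levy_kernel (\<lambda>_. L) \<omega>)" for i
    using seq(1) measurable_cong_sets[OF sets_levy[OF w] refl] by blast
  have m: "(\<lambda>t. \<integral>\<^sup>+ y. U i (t, y) \<partial>L (\<omega> (max 0 t))) \<in> borel_measurable borel" for i
    by (rule nn_integral_L_measurable; auto)
  have inc: "incseq (\<lambda>i y. U i (t, y))" for t using seq(3) by (auto simp: incseq_def le_fun_def)
  have "(\<integral>\<^sup>+ p. (SUP i. U i p) \<partial>levy_kernel (\<lambda>_. L) \<omega>) = (SUP i. \<integral>\<^sup>+ p. U i p \<partial>levy_kernel (\<lambda>_. L) \<omega>)"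
    by (rule nn_integral_monotone_convergence_SUP) (use seq in auto)
  also have "\<dots> = (SUP i. \<integral>\<^sup>+ t. (\<integral>\<^sup>+ y. U i (t, y) \<partial>L (\<omega> (max 0 t))) * indicator {0..} t \<partial>lborel)"
    using seq.IH by simp
  also have "\<dots> = (\<integral>\<^sup>+ t. (SUP i. (\<integral>\<^sup>+ y. U i (t, y) \<partial>L (\<omega> (max 0 t))) * indicator {0..} t) \<partial>lborel)"
    by (rule nn_integral_monotone_convergence_SUP[symmetric])
       (use m inc in \<open>auto simp: incseq_def le_fun_def intro!: mult_right_mono nn_integral_mono\<close>)
  also have "\<dots> = (\<integral>\<^sup>+ t. (\<integral>\<^sup>+ y. (SUP i. U i (t, y)) \<partial>L (\<omega> (max 0 t))) * indicator {0..} t \<partial>lborel)"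
    by (intro nn_integral_cong, subst nn_integral_monotone_convergence_SUP[OF inc])
       (auto simp: SUP_mult_right_ennreal)
  finally show ?case by (simp add: image_comp)
qed

lemma levy_measurable:
  assumes "\<omega> \<in> cadlag_paths" "pure_jump \<omega>" "f \<in> borel_measurable (borel \<Otimes>\<^sub>M borel)"
  shows "f \<in> borel_measurable (levy_kernel (\<lambda>_. L) \<omega>)"
  using assms(3) measurable_cong_sets[OF sets_levy[OF assms(1,2)] refl] by blast

text \<open>The nonnegative formula is applied to positive and negative parts. The bound on the
  absolute value makes both finite, but slices are integrable only for almost every time, so the
  inner Bochner integral needs care.\<close>

lemma levy_set_integral:
  fixes f :: "real \<times> 'a \<Rightarrow> real"
  assumes w: "\<omega> \<in> cadlag_paths" "pure_jump \<omega>" and f: "f \<in> borel_measurable (borel \<Otimes>\<^sub>M borel)"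
    and fin: "(\<integral>\<^sup>+ t\<in>{0<..T}. (\<integral>\<^sup>+ y. ennreal \<bar>f (t, y)\<bar> \<partial>L (\<omega> (max 0 t))) \<partial>lborel) < \<infinity>"
  shows "(LINT p : {0<..T} \<times> UNIV | levy_kernel (\<lambda>_. L) \<omega>. f p) =
     (LINT t : {0<..T} | lborel. (\<integral>y. f (t, y) \<partial>L (\<omega> (max 0 t))))"
proof -
  let ?N = "levy_kernel (\<lambda>_. L) \<omega>"
  note [measurable] = f cadlag_measurable[OF w(1)]
  define g where "g p = indicator ({0<..T} \<times> UNIV) p * f p" for p
  have g[measurable]: "g \<in> borel_measurable (borel \<Otimes>\<^sub>M borel)" unfolding g_def by measurable
  have nn: "(\<integral>\<^sup>+ p. ennreal (k (g p)) \<partial>?N) = (\<integral>\<^sup>+ t\<in>{0<..T}. (\<integral>\<^sup>+ y. ennreal (k (f (t, y))) \<partial>L (\<omega> (max 0 t))) \<partial>lborel)"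
    if [measurable]: "k \<in> borel_measurable borel" and "k 0 = 0" for k :: "real \<Rightarrow> real"
    using that by (subst nn_integral_levy[OF w])
      (auto simp: g_def indicator_def intro!: nn_integral_cong)
  define Gp where "Gp t = (\<integral>\<^sup>+ y. ennreal (f (t, y)) \<partial>L (\<omega> (max 0 t)))" for t
  define Gm where "Gm t = (\<integral>\<^sup>+ y. ennreal (- f (t, y)) \<partial>L (\<omega> (max 0 t)))" for t
  define Ga where "Ga t = (\<integral>\<^sup>+ y. ennreal \<bar>f (t, y)\<bar> \<partial>L (\<omega> (max 0 t)))" for t
  have [measurable]: "Gp \<in> borel_measurable borel" "Gm \<in> borel_measurable borel" "Ga \<in> borel_measurable borel"
    unfolding Gp_def Gm_def Ga_def by (rule nn_integral_L_measurable; simp)+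
  have le: "Gp t \<le> Ga t" "Gm t \<le> Ga t" for t
    unfolding Gp_def Gm_def Ga_def by (auto intro!: nn_integral_mono ennreal_leI)
  have int_g: "integrable ?N g"
  proof (rule integrableI_bounded)
    show "g \<in> borel_measurable ?N" by (rule levy_measurable[OF w g])
    show "(\<integral>\<^sup>+ p. ennreal (norm (g p)) \<partial>?N) < \<infinity>"
      using nn[of norm] fin by simp
  qed
  have fa: "(\<integral>\<^sup>+ t. Ga t * indicator {0<..T} t \<partial>lborel) < \<infinity>" using fin unfolding Ga_def .
  have "AE t in lborel. Ga t * indicator {0<..T} t \<noteq> \<infinity>"
    using fa by (intro nn_integral_PInf_AE) auto
  then have ae: "AE t in lborel. t \<in> {0<..T} \<longrightarrow> Gp t < \<infinity> \<and> Gm t < \<infinity> \<and> integrable (L (\<omega> (max 0 t))) (\<lambda>y. f (t, y))"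
  proof eventually_elim
    case (elim t)
    show ?case
    proof
      assume t: "t \<in> {0<..T}"
      with elim have "Ga t < \<infinity>" by (auto simp: less_top)
      moreover have "integrable (L (\<omega> (max 0 t))) (\<lambda>y. f (t, y))"
        using \<open>Ga t < \<infinity>\<close> unfolding Ga_def by (intro integrableI_bounded) auto
      ultimately show "Gp t < \<infinity> \<and> Gm t < \<infinity> \<and> integrable (L (\<omega> (max 0 t))) (\<lambda>y. f (t, y))"
        using le[of t] by (auto intro: le_less_trans)
    qed
  qed
  have half: "integrable lborel (\<lambda>t. indicator {0<..T} t * enn2real (G t))"
    "(\<integral>t. indicator {0<..T} t * enn2real (G t) \<partial>lborel) = enn2real (\<integral>\<^sup>+ t\<in>{0<..T}. G t \<partial>lborel)"
    if G: "G \<in> borel_measurable borel" "AE t in lborel. t \<in> {0<..T} \<longrightarrow> G t < \<infinity>" "\<And>t. G t \<le> Ga t" for G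
  proof -
    note [measurable] = G(1)
    have eq: "(\<integral>\<^sup>+ t. ennreal (indicator {0<..T} t * enn2real (G t)) \<partial>lborel) = (\<integral>\<^sup>+ t\<in>{0<..T}. G t \<partial>lborel)"
      using G(2) by (intro nn_integral_cong_AE) (auto elim!: eventually_mono simp: indicator_def)
    have "(\<integral>\<^sup>+ t\<in>{0<..T}. G t \<partial>lborel) \<le> (\<integral>\<^sup>+ t. Ga t * indicator {0<..T} t \<partial>lborel)"
      using G(3) by (intro nn_integral_mono mult_right_mono) auto
    then have fin': "(\<integral>\<^sup>+ t\<in>{0<..T}. G t \<partial>lborel) < \<infinity>" using fa by (rule le_less_trans)
    show "integrable lborel (\<lambda>t. indicator {0<..T} t * enn2real (G t))"
    proof (rule integrableI_nonneg)
      show "(\<integral>\<^sup>+ t. ennreal (indicator {0<..T} t * enn2real (G t)) \<partial>lborel) < \<infinity>" unfolding eq by (rule fin')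
    qed auto
    show "(\<integral>t. indicator {0<..T} t * enn2real (G t) \<partial>lborel) = enn2real (\<integral>\<^sup>+ t\<in>{0<..T}. G t \<partial>lborel)"
      by (subst integral_eq_nn_integral) (auto simp: eq)
  qed
  have gp: "AE t in lborel. t \<in> {0<..T} \<longrightarrow> Gp t < \<infinity>" and gm: "AE t in lborel. t \<in> {0<..T} \<longrightarrow> Gm t < \<infinity>"
    using ae by (auto elim: eventually_mono)
  have "(LINT t : {0<..T} | lborel. (\<integral>y. f (t, y) \<partial>L (\<omega> (max 0 t)))) =
      (\<integral>t. indicator {0<..T} t * enn2real (Gp t) - indicator {0<..T} t * enn2real (Gm t) \<partial>lborel)"
    unfolding set_lebesgue_integral_def
  proof (rule integral_cong_AE)
    show ae2: "AE t in lborel. indicator {0<..T} t *\<^sub>R (\<integral>y. f (t, y) \<partial>L (\<omega> (max 0 t))) =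
        indicator {0<..T} t * enn2real (Gp t) - indicator {0<..T} t * enn2real (Gm t)"
      using ae by eventually_elim (auto simp: indicator_def Gp_def Gm_def real_lebesgue_integral_def)
    have "(\<lambda>t. indicator {0<..T} t * enn2real (Gp t) - indicator {0<..T} t * enn2real (Gm t)) \<in> borel_measurable lborel"
      by measurable
    \<comment> \<open>Where a slice is not integrable its integral is \<open>0\<close> by
      convention. Setting the integrand to \<open>0\<close> at these times gives the same function
      of time with all slices integrable; the set of such times is measurable because it is where
      \<open>Ga\<close> is infinite.\<close>
    let ?K = "{t. integrable (L (\<omega> (max 0 t))) (\<lambda>y. f (t, y))}"
    have K: "?K = {t. Ga t < \<infinity>}"
      unfolding Ga_def by (auto simp: integrable_iff_bounded)
    have "(\<lambda>t. \<integral>y. (if t \<in> ?K then f (t, y) else 0) \<partial>L (\<omega> (max 0 t))) \<in> borel_measurable borel"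
    proof (rule integral_L_measurable)
      show "(\<lambda>(t, y). if t \<in> ?K then f (t, y) else 0) \<in> borel_measurable (borel \<Otimes>\<^sub>M borel)"
        unfolding K by measurable
      show "integrable (L (\<omega> (max 0 t))) (\<lambda>y. if t \<in> ?K then f (t, y) else 0)" for t
        by (cases "t \<in> ?K") auto
    qed auto
    moreover have "(\<integral>y. (if t \<in> ?K then f (t, y) else 0) \<partial>L (\<omega> (max 0 t))) = (\<integral>y. f (t, y) \<partial>L (\<omega> (max 0 t)))" for t
      by (cases "t \<in> ?K") (auto simp: not_integrable_integral_eq)
    ultimately have "(\<lambda>t. \<integral>y. f (t, y) \<partial>L (\<omega> (max 0 t))) \<in> borel_measurable borel" by simp
    then show "(\<lambda>t. indicator {0<..T} t *\<^sub>R (\<integral>y. f (t, y) \<partial>L (\<omega> (max 0 t)))) \<in> borel_measurable lborel" by measurable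
  qed measurable
  also have "\<dots> = enn2real (\<integral>\<^sup>+ t\<in>{0<..T}. Gp t \<partial>lborel) - enn2real (\<integral>\<^sup>+ t\<in>{0<..T}. Gm t \<partial>lborel)"
    using half[OF _ gp le(1)] half[OF _ gm le(2)] by simp
  also have "\<dots> = (\<integral>p. g p \<partial>?N)"
    unfolding Gp_def Gm_def
    using nn[of "\<lambda>x. x"] nn[of uminus] by (simp add: real_lebesgue_integral_def[OF int_g])
  finally show ?thesis
    unfolding set_lebesgue_integral_def g_def by simp
qed

text \<open>In time the kernel is absolutely continuous with respect to Lebesgue measure, so it does
  not charge the countable set of jump times.\<close>

lemma AE_levy_left_lim:
  assumes w: "\<omega> \<in> cadlag_paths" "pure_jump \<omega>"
  shows "AE p in levy_kernel (\<lambda>_. L) \<omega>. left_lim \<omega> (fst p) = \<omega> (max 0 (fst p))"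
proof (rule AE_I')
  let ?J = "jump_times \<omega>"
  have J: "?J \<in> sets borel" by (rule sets.countable) (use pure_jump_countable[OF w(2)] in auto)
  then have C: "?J \<times> UNIV \<in> sets (borel \<Otimes>\<^sub>M borel :: (real \<times> 'a) measure)" by simp
  have "AE t in lborel. t \<notin> ?J"
    by (rule AE_I'[OF countable_imp_null_set_lborel[OF pure_jump_countable[OF w(2)]]]) auto
  then have "AE t in lborel. (\<integral>\<^sup>+ y. indicator (?J \<times> UNIV) (t, y) \<partial>L (\<omega> (max 0 t))) * indicator {0..} t = 0"
    by eventually_elim (simp add: indicator_def)
  then have "(\<integral>\<^sup>+ t\<in>{0..}. (\<integral>\<^sup>+ y. indicator (?J \<times> UNIV) (t, y) \<partial>L (\<omega> (max 0 t))) \<partial>lborel) = (\<integral>\<^sup>+ (t::real). 0 \<partial>lborel)"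
    by (rule nn_integral_cong_AE)
  then show "?J \<times> UNIV \<in> null_sets (levy_kernel (\<lambda>_. L) \<omega>)"
    using C by (simp add: null_sets_def sets_levy[OF w] emeasure_levy[OF w C])
  show "{p \<in> space (levy_kernel (\<lambda>_. L) \<omega>). left_lim \<omega> (fst p) \<noteq> \<omega> (max 0 (fst p))} \<subseteq> ?J \<times> UNIV"
    using left_lim_eq by force
qed

text \<open>Turns the compensator of the martingale problem into an ordinary time integral at the
  current state. Its integrand no longer mentions left limits, and so progressive measurability
  becomes available.\<close>

lemma levy_compensator:
  fixes \<phi> :: "real \<times> 'a \<times> 'a \<Rightarrow> real"
  assumes w: "\<omega> \<in> cadlag_paths" "pure_jump \<omega>"
    and \<phi>: "\<phi> \<in> borel_measurable (borel \<Otimes>\<^sub>M borel \<Otimes>\<^sub>M borel)" and c: "\<And>p. \<bar>\<phi> p\<bar> \<le> c"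
  shows "(LINT (s, y) : {0<..T} \<times> UNIV | levy_kernel (\<lambda>_. L) \<omega>. \<phi> (s, left_lim \<omega> s, y)) =
     (LINT t : {0<..T} | lborel. (\<integral>y. \<phi> (t, \<omega> (max 0 t), y) \<partial>L (\<omega> (max 0 t))))"
proof -
  let ?f = "\<lambda>(t, y). \<phi> (t, left_lim \<omega> t, y)" and ?g = "\<lambda>(t, y). \<phi> (t, \<omega> (max 0 t), y)"
  note [measurable] = \<phi> left_lim_measurable[OF w] cadlag_measurable[OF w(1)]
  have fg: "?f \<in> borel_measurable (borel \<Otimes>\<^sub>M borel)" "?g \<in> borel_measurable (borel \<Otimes>\<^sub>M borel)"
    by measurable
  have "(LINT p : {0<..T} \<times> UNIV | levy_kernel (\<lambda>_. L) \<omega>. ?f p) = (LINT p : {0<..T} \<times> UNIV | levy_kernel (\<lambda>_. L) \<omega>. ?g p)"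
    unfolding set_lebesgue_integral_def
  proof (rule integral_cong_AE)
    show "AE p in levy_kernel (\<lambda>_. L) \<omega>. indicat_real ({0<..T} \<times> UNIV) p *\<^sub>R ?f p = indicat_real ({0<..T} \<times> UNIV) p *\<^sub>R ?g p"
      using AE_levy_left_lim[OF w] by eventually_elim auto
  qed (intro levy_measurable[OF w] borel_measurable_scaleR borel_measurable_indicator fg; simp)+
  also have "\<dots> = (LINT t : {0<..T} | lborel. (\<integral>y. ?g (t, y) \<partial>L (\<omega> (max 0 t))))"
  proof (rule levy_set_integral[OF w fg(2)])
    have "(\<integral>\<^sup>+ t\<in>{0<..T}. (\<integral>\<^sup>+ y. ennreal \<bar>?g (t, y)\<bar> \<partial>L (\<omega> (max 0 t))) \<partial>lborel) \<le>
       (\<integral>\<^sup>+ t. ennreal (c * rate_sup L) * indicator {0<..T} t \<partial>lborel)"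
    proof (intro nn_integral_mono mult_right_mono)
      fix t
      have "(\<integral>\<^sup>+ y. ennreal \<bar>?g (t, y)\<bar> \<partial>L (\<omega> (max 0 t))) \<le> (\<integral>\<^sup>+ y. ennreal c \<partial>L (\<omega> (max 0 t)))"
        using c by (intro nn_integral_mono ennreal_leI) auto
      also have "\<dots> \<le> ennreal c * ennreal (rate_sup L)"
        using emeasure_L_le by (auto intro: mult_left_mono)
      also have "\<dots> = ennreal (c * rate_sup L)"
        using order_trans[OF abs_ge_zero c[of undefined]] rate_nonneg by (simp add: ennreal_mult)
      finally show "(\<integral>\<^sup>+ y. ennreal \<bar>?g (t, y)\<bar> \<partial>L (\<omega> (max 0 t))) \<le> ennreal (c * rate_sup L)" .
    qed auto
    also have "\<dots> < \<infinity>"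
      by (cases "0 \<le> T") (auto simp: nn_integral_cmult_indicator ennreal_mult_less_top)
    finally show "(\<integral>\<^sup>+ t\<in>{0<..T}. (\<integral>\<^sup>+ y. ennreal \<bar>?g (t, y)\<bar> \<partial>L (\<omega> (max 0 t))) \<partial>lborel) < \<infinity>" .
  qed
  finally show ?thesis by (simp add: case_prod_beta')
qed

section \<open>Integrals against the transformed kernel\<close>

lemma levy_AB_density_measurable:
  assumes w: "\<omega> \<in> cadlag_paths" "pure_jump \<omega>" and h: "h \<in> borel_measurable borel"
  shows "(\<lambda>(t, y). indicator {s. ereal s < c} t * max 0 (h y / h (left_lim \<omega> t)) :: real) \<in> borel_measurable (borel \<Otimes>\<^sub>M borel)"
proof -
  note [measurable] = left_lim_measurable[OF w] h
  show ?thesis by measurable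
qed

text \<open>\<open>ennreal\<close> sends negative numbers to \<open>0\<close>. The sign of
  \<open>h\<close> is not known at every state, so the truncation \<open>max 0\<close> must be made
  explicit before real-valued integrals against the density are computed.\<close>

lemma levy_AB_eq:
  "levy_kernel_AB L A B h \<omega> = density (levy_kernel (\<lambda>_. L) \<omega>)
     (\<lambda>p. ennreal ((\<lambda>(t, y). indicator {s. ereal s < hitting_time (A \<union> B) \<omega>} t * max 0 (h y / h (left_lim \<omega> t))) p))"
  unfolding levy_kernel_AB_def
  by (intro arg_cong[where f = "density _"] ext) (auto simp: indicator_def ennreal_max_0)

lemma emeasure_levy_AB:
  assumes w: "\<omega> \<in> cadlag_paths" "pure_jump \<omega>" and h: "h \<in> borel_measurable borel" and C: "C \<in> sets borel"
  shows "emeasure (levy_kernel_AB L A B h \<omega>) ({0<..s} \<times> C) =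
    (\<integral>\<^sup>+ t\<in>{0<..s}. (\<integral>\<^sup>+ y. indicator {s. ereal s < hitting_time (A \<union> B) \<omega>} t * (indicator C y * ennreal (h y / h (\<omega> (max 0 t))))
       \<partial>L (\<omega> (max 0 t))) \<partial>lborel)" (is "?l = ?r")
proof -
  note [measurable] = C levy_AB_density_measurable[OF w h, of "hitting_time (A \<union> B) \<omega>"]
  let ?d = "\<lambda>(t, y). indicator {s. ereal s < hitting_time (A \<union> B) \<omega>} t * max 0 (h y / h (left_lim \<omega> t))"
  have "?l = (\<integral>\<^sup>+ p. ennreal (?d p) * indicator ({0<..s} \<times> C) p \<partial>levy_kernel (\<lambda>_. L) \<omega>)"
    unfolding levy_AB_eq
    by (rule emeasure_density) (auto intro!: levy_measurable[OF w] simp: sets_levy[OF w])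
  also have "\<dots> = (\<integral>\<^sup>+ t\<in>{0..}. (\<integral>\<^sup>+ y. ennreal (?d (t, y)) * indicator ({0<..s} \<times> C) (t, y) \<partial>L (\<omega> (max 0 t))) \<partial>lborel)"
    by (rule nn_integral_levy[OF w]) measurable
  also have "\<dots> = ?r"
    by (rule nn_integral_cong_AE, use AE_left_lim[OF w(2)] in eventually_elim)
       (auto simp: indicator_def ennreal_max_0 intro!: nn_integral_cong)
  finally show ?thesis .
qed

text \<open>Boundedness of \<open>\<phi>\<close> would not suffice, as nothing here bounds the
  quotient of values of \<open>h\<close>. Finiteness is therefore a hypothesis, to be met almost
  surely under the conditioned law.\<close>

lemma levy_AB_set_integral:
  fixes \<phi> :: "real \<times> 'a \<times> 'a \<Rightarrow> real"
  assumes w: "\<omega> \<in> cadlag_paths" "pure_jump \<omega>" and h: "h \<in> borel_measurable borel"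
    and \<phi>: "\<phi> \<in> borel_measurable (borel \<Otimes>\<^sub>M borel \<Otimes>\<^sub>M borel)"
    and fin: "(\<integral>\<^sup>+ t\<in>{0<..T}. (\<integral>\<^sup>+ y. indicator {s. ereal s < hitting_time (A \<union> B) \<omega>} t *
       ennreal (\<bar>\<phi> (t, \<omega> (max 0 t), y)\<bar> * max 0 (h y / h (\<omega> (max 0 t)))) \<partial>L (\<omega> (max 0 t))) \<partial>lborel) < \<infinity>"
  shows "(LINT (t, y) : {0<..T} \<times> UNIV | levy_kernel_AB L A B h \<omega>. \<phi> (t, left_lim \<omega> t, y)) =
     (LINT t : {0<..T} | lborel. indicator {s. ereal s < hitting_time (A \<union> B) \<omega>} t *
       (\<integral>y. \<phi> (t, \<omega> (max 0 t), y) * max 0 (h y / h (\<omega> (max 0 t))) \<partial>L (\<omega> (max 0 t))))"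
proof -
  let ?i = "\<lambda>t. indicator {s. ereal s < hitting_time (A \<union> B) \<omega>} t :: real"
  let ?d = "\<lambda>(t, y). ?i t * max 0 (h y / h (left_lim \<omega> t))"
  let ?g = "\<lambda>(t, y). ?i t * (\<phi> (t, \<omega> (max 0 t), y) * max 0 (h y / h (\<omega> (max 0 t))))"
  note [measurable] = levy_AB_density_measurable[OF w h, of "hitting_time (A \<union> B) \<omega>"] \<phi> h
    left_lim_measurable[OF w] cadlag_measurable[OF w(1)]
  let ?f = "\<lambda>(t, y). \<phi> (t, left_lim \<omega> t, y)"
  have f[measurable]: "?f \<in> borel_measurable (borel \<Otimes>\<^sub>M borel)" by measurable
  have g: "?g \<in> borel_measurable (borel \<Otimes>\<^sub>M borel)" by measurable
  have "(LINT p : {0<..T} \<times> UNIV | levy_kernel_AB L A B h \<omega>. ?f p) =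
      (\<integral>p. ?d p *\<^sub>R (indicator ({0<..T} \<times> UNIV) p *\<^sub>R ?f p) \<partial>levy_kernel (\<lambda>_. L) \<omega>)"
    unfolding levy_AB_eq set_lebesgue_integral_def
  proof (rule integral_density)
    show "(\<lambda>p. indicator ({0<..T} \<times> UNIV) p *\<^sub>R ?f p) \<in> borel_measurable (levy_kernel (\<lambda>_. L) \<omega>)"
      "?d \<in> borel_measurable (levy_kernel (\<lambda>_. L) \<omega>)"
      by (intro levy_measurable[OF w]; measurable)+
  qed auto
  also have "\<dots> = (LINT p : {0<..T} \<times> UNIV | levy_kernel (\<lambda>_. L) \<omega>. ?g p)"
    unfolding set_lebesgue_integral_def
  proof (rule integral_cong_AE)
    show "AE p in levy_kernel (\<lambda>_. L) \<omega>. ?d p *\<^sub>R (indicator ({0<..T} \<times> UNIV) p *\<^sub>R ?f p) =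
        indicator ({0<..T} \<times> UNIV) p *\<^sub>R ?g p"
      using AE_levy_left_lim[OF w] by eventually_elim auto
    have "(\<lambda>p. ?d p *\<^sub>R (indicator ({0<..T} \<times> UNIV) p *\<^sub>R ?f p)) \<in> borel_measurable (borel \<Otimes>\<^sub>M borel)"
      by (intro borel_measurable_scaleR borel_measurable_indicator) (use f in simp_all)
    then show "(\<lambda>p. ?d p *\<^sub>R (indicator ({0<..T} \<times> UNIV) p *\<^sub>R ?f p)) \<in> borel_measurable (levy_kernel (\<lambda>_. L) \<omega>)"
      by (rule levy_measurable[OF w])
    have "(\<lambda>p. indicator ({0<..T} \<times> UNIV) p *\<^sub>R ?g p) \<in> borel_measurable (borel \<Otimes>\<^sub>M borel)"
      by (intro borel_measurable_scaleR borel_measurable_indicator g) simp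
    then show "(\<lambda>p. indicator ({0<..T} \<times> UNIV) p *\<^sub>R ?g p) \<in> borel_measurable (levy_kernel (\<lambda>_. L) \<omega>)"
      by (rule levy_measurable[OF w])
  qed
  also have "\<dots> = (LINT t : {0<..T} | lborel. (\<integral>y. ?g (t, y) \<partial>L (\<omega> (max 0 t))))"
  proof (rule levy_set_integral[OF w])
    have "(\<integral>\<^sup>+ t\<in>{0<..T}. (\<integral>\<^sup>+ y. ennreal \<bar>?g (t, y)\<bar> \<partial>L (\<omega> (max 0 t))) \<partial>lborel) =
      (\<integral>\<^sup>+ t\<in>{0<..T}. (\<integral>\<^sup>+ y. indicator {s. ereal s < hitting_time (A \<union> B) \<omega>} t *
       ennreal (\<bar>\<phi> (t, \<omega> (max 0 t), y)\<bar> * max 0 (h y / h (\<omega> (max 0 t)))) \<partial>L (\<omega> (max 0 t))) \<partial>lborel)"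
      by (intro nn_integral_cong arg_cong2[where f = "(*)"]) (auto simp: indicator_def abs_mult)
    with fin show "(\<integral>\<^sup>+ t\<in>{0<..T}. (\<integral>\<^sup>+ y. ennreal \<bar>?g (t, y)\<bar> \<partial>L (\<omega> (max 0 t))) \<partial>lborel) < \<infinity>" by simp
  qed (rule g)
  also have "\<dots> = (LINT t : {0<..T} | lborel. ?i t *
       (\<integral>y. \<phi> (t, \<omega> (max 0 t), y) * max 0 (h y / h (\<omega> (max 0 t))) \<partial>L (\<omega> (max 0 t))))"
    by simp
  finally show ?thesis by (simp add: case_prod_beta')
qed

end

section \<open>Partitions of an interval\<close>

definition grid :: "real \<Rightarrow> real \<Rightarrow> nat \<Rightarrow> nat \<Rightarrow> real" where
  "grid s t n i = s + (t - s) * real i / real (Suc n)"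

text \<open>Cells are open on the left and closed on the right, to match \<open>jumps_in\<close>.
  Hence the ceiling minus one: a grid point belongs to the cell that it closes.\<close>

definition grid_index :: "real \<Rightarrow> real \<Rightarrow> nat \<Rightarrow> real \<Rightarrow> nat" where
  "grid_index s t n u = nat (\<lceil>(u - s) * real (Suc n) / (t - s)\<rceil> - 1)"

abbreviation "grid_below s t n u \<equiv> grid s t n (grid_index s t n u)"
abbreviation "grid_above s t n u \<equiv> grid s t n (Suc (grid_index s t n u))"

lemma grid_mono: "s \<le> t \<Longrightarrow> i \<le> j \<Longrightarrow> grid s t n i \<le> grid s t n j"
  unfolding grid_def by (intro add_left_mono divide_right_mono mult_left_mono) auto

lemma grid_0 [simp]: "grid s t n 0 = s"
  by (simp add: grid_def)

lemma grid_last [simp]: "grid s t n (Suc n) = t"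
  by (simp add: grid_def del: of_nat_Suc)

lemma grid_ge: "s \<le> t \<Longrightarrow> s \<le> grid s t n i"
  using grid_mono[of s t 0 i n] by simp

lemma grid_le: "s \<le> t \<Longrightarrow> i \<le> Suc n \<Longrightarrow> grid s t n i \<le> t"
  using grid_mono[of s t i "Suc n" n] by simp

lemma grid_index_eq_iff:
  assumes "s < u" "u \<le> t"
  shows "grid_index s t n u = i \<longleftrightarrow> grid s t n i < u \<and> u \<le> grid s t n (Suc i)"
proof -
  define N where "N = real (Suc n)"
  define z where "z = (u - s) * N / (t - s)"
  have st: "0 < t - s" and N: "0 < N" using assms by (auto simp: N_def)
  have z: "0 < z" using assms N unfolding z_def by simp
  have "grid_index s t n u = nat (\<lceil>z\<rceil> - 1)" unfolding grid_index_def z_def N_def ..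
  also have "\<dots> = i \<longleftrightarrow> \<lceil>z\<rceil> = int i + 1" using z by (auto simp: nat_eq_iff)
  also have "\<dots> \<longleftrightarrow> real i < z \<and> z \<le> real i + 1" by (auto simp: ceiling_eq_iff)
  also have "real i < z \<longleftrightarrow> grid s t n i < u"
    unfolding grid_def z_def N_def[symmetric] using st N by (simp add: field_simps)
  also have "z \<le> real i + 1 \<longleftrightarrow> u \<le> grid s t n (Suc i)"
    unfolding grid_def z_def N_def[symmetric] using st N by (simp add: field_simps)
  finally show ?thesis .
qed

lemma
  assumes "s < u" "u \<le> t"
  shows grid_below: "grid_below s t n u < u" and grid_above: "u \<le> grid_above s t n u"
  using grid_index_eq_iff[OF assms, of n "grid_index s t n u"] by auto

lemma grid_index_less:
  assumes "s < u" "u \<le> t" shows "grid_index s t n u < Suc n"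
proof (rule ccontr)
  assume "\<not> grid_index s t n u < Suc n"
  then have "grid s t n (Suc n) \<le> grid_below s t n u" using assms by (intro grid_mono) auto
  then show False using grid_below[OF assms, of n] assms by simp
qed

lemma grid_step: "grid s t n (Suc i) = grid s t n i + (t - s) * inverse (real (Suc n))"
  unfolding grid_def by (simp add: field_simps del: of_nat_Suc) (simp add: algebra_simps add_divide_distrib)

text \<open>The lower end of the cell of \<open>u\<close> stays strictly below \<open>u\<close>, so
  it detects left limits. The upper end tends to \<open>u\<close> from above, possibly with
  equality, so it detects the value after a jump.\<close>

lemma
  assumes "s < u" "u \<le> t"
  shows grid_below_tendsto: "filterlim (\<lambda>n. grid_below s t n u) (at_left u) sequentially"
    and grid_above_tendsto: "(\<lambda>n. grid_above s t n u) \<longlonglongrightarrow> u"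
proof -
  have z: "(\<lambda>n. (t - s) * inverse (real (Suc n))) \<longlonglongrightarrow> 0"
    using tendsto_mult[OF tendsto_const LIMSEQ_inverse_real_of_nat, of "t - s"] by simp
  note ab = grid_below[OF assms] grid_above[OF assms]
  have "(\<lambda>n. grid_below s t n u) \<longlonglongrightarrow> u"
  proof (rule tendsto_sandwich[where f = "\<lambda>n. u - (t - s) * inverse (real (Suc n))" and h = "\<lambda>_. u"])
    show "(\<lambda>n. u - (t - s) * inverse (real (Suc n))) \<longlonglongrightarrow> u"
      using tendsto_diff[OF tendsto_const z, of u] by simp
    show "\<forall>\<^sub>F n in sequentially. u - (t - s) * inverse (real (Suc n)) \<le> grid_below s t n u"
      using ab(2) unfolding grid_step by (simp add: algebra_simps del: of_nat_Suc)
    show "\<forall>\<^sub>F n in sequentially. grid_below s t n u \<le> u"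
      using ab(1) by (simp add: less_imp_le)
  qed simp
  then show "filterlim (\<lambda>n. grid_below s t n u) (at_left u) sequentially"
    unfolding filterlim_at using ab(1) by (auto intro!: always_eventually simp: less_imp_neq)
  show "(\<lambda>n. grid_above s t n u) \<longlonglongrightarrow> u"
  proof (rule tendsto_sandwich[where h = "\<lambda>n. u + (t - s) * inverse (real (Suc n))" and f = "\<lambda>_. u"])
    show "(\<lambda>n. u + (t - s) * inverse (real (Suc n))) \<longlonglongrightarrow> u"
      using tendsto_add[OF tendsto_const z, of u] by simp
    show "\<forall>\<^sub>F n in sequentially. grid_above s t n u \<le> u + (t - s) * inverse (real (Suc n))"
      using ab(1) unfolding grid_step by (simp add: less_imp_le del: of_nat_Suc)
    show "\<forall>\<^sub>F n in sequentially. u \<le> grid_above s t n u"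
      using ab(2) by simp
  qed simp
qed

text \<open>A coefficient for each cell becomes a coefficient for each jump. As the jumps do not
  depend on the partition, limits over partitions can then be taken one jump at a time.\<close>

lemma sum_grid:
  fixes f :: "real \<Rightarrow> real"
  assumes "finite (J \<inter> {s<..t})" "s \<le> t"
  shows "(\<Sum>i<Suc n. c i * (\<Sum>u\<in>J \<inter> {grid s t n i<..grid s t n (Suc i)}. f u)) =
    (\<Sum>u\<in>J \<inter> {s<..t}. c (grid_index s t n u) * f u)"
proof -
  have cell: "{u \<in> J \<inter> {s<..t}. grid_index s t n u = i} = J \<inter> {grid s t n i<..grid s t n (Suc i)}"
    if "i < Suc n" for i
  proof -
    have "s < u \<and> u \<le> t" if "grid s t n i < u" "u \<le> grid s t n (Suc i)" for u
      using that \<open>i < Suc n\<close> grid_ge[OF assms(2), of n i] grid_le[OF assms(2), of "Suc i" n] by auto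
    then show ?thesis using grid_index_eq_iff[of s _ t n i]
      by (intro set_eqI) (simp only: Int_iff mem_Collect_eq greaterThanAtMost_iff, blast)
  qed
  have "(\<Sum>u\<in>J \<inter> {s<..t}. c (grid_index s t n u) * f u) =
      (\<Sum>i<Suc n. \<Sum>u\<in>{u \<in> J \<inter> {s<..t}. grid_index s t n u = i}. c (grid_index s t n u) * f u)"
    using assms(1) grid_index_less[of s _ t n] by (intro sum.group[symmetric]) auto
  also have "\<dots> = (\<Sum>i<Suc n. \<Sum>u\<in>{u \<in> J \<inter> {s<..t}. grid_index s t n u = i}. c i * f u)"
    by (intro sum.cong) auto
  also have "\<dots> = (\<Sum>i<Suc n. c i * (\<Sum>u\<in>J \<inter> {grid s t n i<..grid s t n (Suc i)}. f u))"
    by (intro sum.cong refl) (simp only: cell lessThan_iff sum_distrib_left)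
  finally show ?thesis ..
qed

text \<open>The counterpart of \<open>sum_grid\<close> for the drift: the partition sum is one time
  integral with a step function as weight, ready for dominated convergence.\<close>

lemma set_integral_grid:
  fixes g :: "real \<Rightarrow> real"
  assumes g: "set_integrable lborel {s<..t} g" and st: "s \<le> t"
  shows "(\<Sum>i<Suc n. c i * (LINT u : {grid s t n i<..grid s t n (Suc i)} | lborel. g u)) =
    (LINT u : {s<..t} | lborel. c (grid_index s t n u) * g u)"
proof -
  let ?I = "\<lambda>i. {grid s t n i<..grid s t n (Suc i)}"
  have sub: "?I i \<subseteq> {s<..t}" if "i < Suc n" for i
    using that grid_ge[OF st, of n i] grid_le[OF st, of "Suc i" n] by auto
  have int: "integrable lborel (\<lambda>u. indicator (?I i) u *\<^sub>R g u)" if "i < Suc n" for i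
    using set_integrable_subset[OF g _ sub[OF that]] by (simp add: set_integrable_def)
  have "(\<Sum>i<Suc n. c i * (LINT u : ?I i | lborel. g u)) = (\<Sum>i<Suc n. (\<integral>u. c i * (indicator (?I i) u *\<^sub>R g u) \<partial>lborel))"
    unfolding set_lebesgue_integral_def by simp
  also have "\<dots> = (\<integral>u. (\<Sum>i<Suc n. c i * (indicator (?I i) u *\<^sub>R g u)) \<partial>lborel)"
    using int by (intro Bochner_Integration.integral_sum[symmetric]) auto
  also have "\<dots> = (LINT u : {s<..t} | lborel. c (grid_index s t n u) * g u)"
    unfolding set_lebesgue_integral_def
  proof (intro Bochner_Integration.integral_cong refl)
    fix u
    show "(\<Sum>i<Suc n. c i * (indicator (?I i) u *\<^sub>R g u)) = indicator {s<..t} u *\<^sub>R (c (grid_index s t n u) * g u)"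
    proof (cases "u \<in> {s<..t}")
      case True
      then have u: "s < u" "u \<le> t" by auto
      have "(\<Sum>i<Suc n. c i * (indicator (?I i) u *\<^sub>R g u)) = (\<Sum>i<Suc n. if grid_index s t n u = i then c i * g u else 0)"
        using grid_index_eq_iff[OF u, of n] by (intro sum.cong) (auto simp: indicator_def)
      also have "\<dots> = c (grid_index s t n u) * g u"
        using grid_index_less[OF u, of n] by (subst sum.delta') (auto simp del: sum.lessThan_Suc)
      finally show ?thesis using True by simp
    next
      case False
      then have "u \<notin> ?I i" if "i < Suc n" for i using sub[OF that] by blast
      then have "(\<Sum>i<Suc n. c i * (indicator (?I i) u *\<^sub>R g u)) = (\<Sum>i<Suc n. 0)"
        by (intro sum.cong) (auto simp: indicator_def)
      then show ?thesis using False by simp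
    qed
  qed
  finally show ?thesis .
qed

section \<open>Measurability in completions\<close>

lemma completion_measurable_AE:
  assumes f: "f \<in> completion M \<rightarrow>\<^sub>M N" and ae: "AE x in completion M. f x = g x"
    and sp: "\<And>x. x \<in> space M \<Longrightarrow> g x \<in> space N"
  shows "g \<in> completion M \<rightarrow>\<^sub>M N"
proof (rule measurableI)
  show "g x \<in> space N" if "x \<in> space (completion M)" for x using sp that by simp
  fix C assume C: "C \<in> sets N"
  show "g -` C \<inter> space (completion M) \<in> sets (completion M)"
  proof (rule completion.in_sets_AE)
    show "AE x in completion M. x \<in> f -` C \<inter> space (completion M) \<longleftrightarrow> x \<in> g -` C \<inter> space (completion M)"
      using ae by eventually_elim auto
  qed (use measurable_sets[OF f C] in auto)
qed

text \<open>Where null sets are missing from \<open>N\<close>, an almost sure limit of measurable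
  functions is measurable only up to a version. \<open>lim\<close> supplies one, being measurable
  even though the sequence may diverge somewhere.\<close>

lemma AE_limit_version:
  fixes f :: "nat \<Rightarrow> 'b \<Rightarrow> real"
  assumes "\<And>i. f i \<in> borel_measurable N" and "AE x in M. (\<lambda>i. f i x) \<longlonglongrightarrow> g x"
  obtains g' where "g' \<in> borel_measurable N" "AE x in M. g' x = g x"
proof
  show "(\<lambda>x. lim (\<lambda>i. f i x)) \<in> borel_measurable N" using assms(1) by measurable
  show "AE x in M. lim (\<lambda>i. f i x) = g x"
    using assms(2) by eventually_elim (rule limI)
qed

section \<open>Jump process laws\<close>

definition bounded_test :: "(real \<times> 'a \<times> 'a::polish_space \<Rightarrow> real) \<Rightarrow> real \<Rightarrow> bool" where
  "bounded_test \<phi> c \<longleftrightarrow> \<phi> \<in> borel_measurable (borel \<Otimes>\<^sub>M borel \<Otimes>\<^sub>M borel) \<and> (\<forall>p. \<bar>\<phi> p\<bar> \<le> c)"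

definition jump_sum :: "(real \<times> 'a \<times> 'a::polish_space \<Rightarrow> real) \<Rightarrow> real \<Rightarrow> real \<Rightarrow> (real \<Rightarrow> 'a) \<Rightarrow> real" where
  "jump_sum \<phi> s t \<omega> = (\<Sum>u\<in>jumps_in \<omega> s t. \<phi> (u, left_lim \<omega> u, \<omega> u))"

text \<open>With the weight \<open>alive_before\<close> the jump that enters \<open>D\<close> counts
  and the later ones do not, in accordance with \<open>ereal s \<le> \<sigma> \<omega>\<close> in
  \<open>compensated_jumps\<close>.\<close>

definition alive_sum ::
    "'a set \<Rightarrow> (real \<times> 'a \<times> 'a::polish_space \<Rightarrow> real) \<Rightarrow> real \<Rightarrow> real \<Rightarrow> (real \<Rightarrow> 'a) \<Rightarrow> real" where
  "alive_sum D \<phi> s t \<omega> = (\<Sum>u\<in>jumps_in \<omega> s t. of_bool (alive_before D u \<omega>) * \<phi> (u, left_lim \<omega> u, \<omega> u))"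

lemma bounded_test_measurable: "bounded_test \<phi> c \<Longrightarrow> \<phi> \<in> borel_measurable (borel \<Otimes>\<^sub>M borel \<Otimes>\<^sub>M borel)"
  by (simp add: bounded_test_def)

lemma bounded_test_le: "bounded_test \<phi> c \<Longrightarrow> \<bar>\<phi> p\<bar> \<le> c"
  unfolding bounded_test_def by blast

lemma bounded_test_nonneg: "bounded_test \<phi> c \<Longrightarrow> 0 \<le> c"
  using bounded_test_le[of \<phi> c undefined] by linarith

locale jump_law = rate_kernel L for L :: "'a::polish_space \<Rightarrow> 'a measure" +
  fixes R :: "(real \<Rightarrow> 'a) measure" and F :: "real \<Rightarrow> (real \<Rightarrow> 'a) measure" and x :: 'a
  assumes R: "R \<in> path_measures" and pure: "AE \<omega> in R. pure_jump \<omega>"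
    and F: "right_continuous_filtration (completion R) F"
    and adapted: "\<And>t. 0 \<le> t \<Longrightarrow> (\<lambda>\<omega>. \<omega> t) \<in> F t \<rightarrow>\<^sub>M borel"
    and mart: "\<And>\<phi>. \<phi> \<in> borel_measurable (borel \<Otimes>\<^sub>M borel \<Otimes>\<^sub>M borel) \<Longrightarrow> bounded (range \<phi>) \<Longrightarrow>
      is_martingale (completion R) F (compensated_jumps (\<lambda>_. \<infinity>) (levy_kernel (\<lambda>_. L)) \<phi>)"
    and start: "distr R borel (\<lambda>\<omega>. \<omega> 0) = return borel x"
begin

abbreviation "M \<equiv> completion R"

lemma prob_R: "prob_space R" and sets_R: "sets R = sets path_space"
  using R by (auto simp: path_measures_def space_prob_algebra)

lemma space_R: "space R = cadlag_paths"
  using sets_eq_imp_space_eq[OF sets_R] by (simp add: space_path_space)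

sublocale prob_space M
  using prob_R by (simp add: prob_space.prob_space_completion)

lemma sub: "subalgebra M (F t)"
  using F by (simp add: right_continuous_filtration_def)

lemma space_F: "space (F t) = cadlag_paths"
  using sub[of t] by (simp add: subalgebra_def space_R)

lemma sets_F_mono: "s \<le> t \<Longrightarrow> sets (F s) \<subseteq> sets (F t)"
  using F by (auto simp: right_continuous_filtration_def filtration_def)

lemma sets_F_M: "C \<in> sets (F t) \<Longrightarrow> C \<in> sets M"
  using sub[of t] by (auto simp: subalgebra_def)

lemma F_M: "f \<in> F t \<rightarrow>\<^sub>M N \<Longrightarrow> f \<in> M \<rightarrow>\<^sub>M N"
  by (rule measurable_from_subalg[OF sub])

lemma F_mono: "f \<in> F s \<rightarrow>\<^sub>M N \<Longrightarrow> s \<le> t \<Longrightarrow> f \<in> F t \<rightarrow>\<^sub>M N"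
  by (rule measurable_from_subalg[of "F t" "F s"]) (auto simp: subalgebra_def space_F sets_F_mono subsetD)

lemma coord_F: "0 \<le> u \<Longrightarrow> u \<le> t \<Longrightarrow> (\<lambda>\<omega>. \<omega> u) \<in> F t \<rightarrow>\<^sub>M borel"
  by (rule F_mono[OF adapted])

lemma coord_M: "0 \<le> u \<Longrightarrow> (\<lambda>\<omega>. \<omega> u) \<in> M \<rightarrow>\<^sub>M borel"
  by (rule F_M[OF adapted])

lemma AE_start: "AE \<omega> in R. \<omega> 0 = x"
proof -
  have [measurable]: "(\<lambda>\<omega>. \<omega> 0) \<in> R \<rightarrow>\<^sub>M borel"
    using coordinate_measurable[of 0] measurable_cong_sets[OF sets_R refl] by auto
  have "AE z in distr R borel (\<lambda>\<omega>. \<omega> 0). z = x"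
    unfolding start by (subst AE_return) auto
  then show ?thesis by (subst (asm) AE_distr_iff) auto
qed

lemma AE_good: "AE \<omega> in M. \<omega> \<in> cadlag_paths \<and> pure_jump \<omega> \<and> \<omega> 0 = x"
  using AE_completion[OF pure] AE_completion[OF AE_start] AE_space by eventually_elim (auto simp: space_R)

lemma cadlag_M: "\<omega> \<in> space M \<Longrightarrow> \<omega> \<in> cadlag_paths"
  by (simp add: space_R)

definition rate :: "(real \<times> 'a \<times> 'a \<Rightarrow> real) \<Rightarrow> real \<Rightarrow> 'a \<Rightarrow> real" where
  "rate \<phi> u z = (\<integral>y. \<phi> (u, z, y) \<partial>L z)"

text \<open>The clamping is invisible on the interval of integration. It makes the integrand a
  function of all real times that reads coordinates up to \<open>t\<close> only, so that the drift
  is measurable for \<open>F t\<close>.\<close>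

definition drift :: "(real \<times> 'a \<times> 'a \<Rightarrow> real) \<Rightarrow> real \<Rightarrow> real \<Rightarrow> (real \<Rightarrow> 'a) \<Rightarrow> real" where
  "drift \<phi> s t \<omega> = (LINT u : {s<..t} | lborel. rate \<phi> u (\<omega> (max 0 (min t u))))"

definition alive_drift :: "'a set \<Rightarrow> (real \<times> 'a \<times> 'a \<Rightarrow> real) \<Rightarrow> real \<Rightarrow> real \<Rightarrow> (real \<Rightarrow> 'a) \<Rightarrow> real" where
  "alive_drift D \<phi> s t \<omega> = (LINT u : {s<..t} | lborel.
     of_bool (alive D (max 0 (min t u)) \<omega>) * rate \<phi> u (\<omega> (max 0 (min t u))))"

lemma slice_measurable: "bounded_test \<phi> c \<Longrightarrow> (\<lambda>y. \<phi> (u, z, y)) \<in> borel_measurable borel"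
  using measurable_compose[OF _ bounded_test_measurable, of "\<lambda>y. (u, z, y)" borel \<phi> c] by simp

lemma rate_bound: "bounded_test \<phi> c \<Longrightarrow> \<bar>rate \<phi> u z\<bar> \<le> c * rate_sup L"
  unfolding rate_def by (intro integral_L_bound slice_measurable) (auto simp: bounded_test_le)

lemma rate_measurable:
  assumes "bounded_test \<phi> c" shows "(\<lambda>p. rate \<phi> (fst p) (snd p)) \<in> borel_measurable (borel \<Otimes>\<^sub>M borel)"
  unfolding rate_def
proof (rule integral_L_measurable)
  note [measurable] = bounded_test_measurable[OF assms]
  show "(\<lambda>(p, y). \<phi> (fst p, snd p, y)) \<in> borel_measurable ((borel \<Otimes>\<^sub>M borel) \<Otimes>\<^sub>M borel)" by measurable
  show "integrable (L (snd p)) (\<lambda>y. \<phi> (fst p, snd p, y))" for p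
    by (rule integrable_L[OF slice_measurable[OF assms], of _ _ c]) (simp add: bounded_test_le[OF assms])
qed measurable

lemma coord_progressive:
  "0 \<le> t \<Longrightarrow> (\<lambda>p. snd p (max 0 (min t (fst p)))) \<in> borel \<Otimes>\<^sub>M F t \<rightarrow>\<^sub>M borel"
  using progressive_measurable[of "F t" t] coord_F[of _ t] by (simp add: space_F case_prod_beta')

lemma alive_progressive:
  "0 \<le> t \<Longrightarrow> D \<in> sets borel \<Longrightarrow> Measurable.pred (borel \<Otimes>\<^sub>M F t) (\<lambda>p. alive D (max 0 (min t (fst p))) (snd p))"
  using progressive_measurable_alive[of "F t" t D] coord_F[of _ t] by (simp add: space_F case_prod_beta')

lemma rate_progressive:
  assumes "bounded_test \<phi> c" "0 \<le> t"
  shows "(\<lambda>p. rate \<phi> (fst p) (snd p (max 0 (min t (fst p))))) \<in> borel_measurable (borel \<Otimes>\<^sub>M F t)"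
  using measurable_compose[OF measurable_Pair[OF measurable_fst coord_progressive[OF assms(2)]] rate_measurable[OF assms(1)]]
  by simp

lemma swap_measurable:
  assumes "f \<in> borel \<Otimes>\<^sub>M N \<rightarrow>\<^sub>M K" shows "(\<lambda>(\<omega>, u). f (u, \<omega>)) \<in> N \<Otimes>\<^sub>M lborel \<rightarrow>\<^sub>M K"
proof -
  have "(\<lambda>p. f (snd p, fst p)) \<in> N \<Otimes>\<^sub>M lborel \<rightarrow>\<^sub>M K"
    by (rule measurable_compose[OF _ assms]) (intro measurable_Pair measurable_fst'' measurable_snd''; simp)
  then show ?thesis by (simp add: case_prod_beta')
qed

lemma time_integral_measurable:
  fixes f :: "real \<times> (real \<Rightarrow> 'a) \<Rightarrow> real"
  assumes "f \<in> borel_measurable (borel \<Otimes>\<^sub>M N)"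
  shows "(\<lambda>\<omega>. LINT u : {s<..t} | lborel. f (u, \<omega>)) \<in> borel_measurable N"
  unfolding set_lebesgue_integral_def
proof (rule lborel.borel_measurable_lebesgue_integral)
  have "(\<lambda>p. indicator {s<..t} (fst p) *\<^sub>R f p) \<in> borel_measurable (borel \<Otimes>\<^sub>M N)"
    using assms by measurable
  from swap_measurable[OF this]
  show "(\<lambda>(\<omega>, u). indicator {s<..t} u *\<^sub>R f (u, \<omega>)) \<in> borel_measurable (N \<Otimes>\<^sub>M lborel)" by simp
qed

lemma drift_measurable: "bounded_test \<phi> c \<Longrightarrow> 0 \<le> t \<Longrightarrow> drift \<phi> s t \<in> borel_measurable (F t)"
  unfolding drift_def using time_integral_measurable[OF rate_progressive] by simp

lemma alive_rate_progressive:
  assumes "bounded_test \<phi> c" "0 \<le> t" "D \<in> sets borel"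
  shows "(\<lambda>p. of_bool (alive D (max 0 (min t (fst p))) (snd p)) * rate \<phi> (fst p) (snd p (max 0 (min t (fst p)))))
    \<in> borel_measurable (borel \<Otimes>\<^sub>M F t)"
  by (intro borel_measurable_times rate_progressive[OF assms(1,2)] measurable_compose[OF alive_progressive[OF assms(2,3)]]) simp

lemma alive_drift_measurable:
  "bounded_test \<phi> c \<Longrightarrow> 0 \<le> t \<Longrightarrow> D \<in> sets borel \<Longrightarrow> alive_drift D \<phi> s t \<in> borel_measurable (F t)"
  unfolding alive_drift_def using time_integral_measurable[OF alive_rate_progressive] by simp

lemma set_integral_time_bound:
  fixes f :: "real \<Rightarrow> real"
  assumes "f \<in> borel_measurable borel" "\<And>u. \<bar>f u\<bar> \<le> c" "s \<le> t"
  shows "set_integrable lborel {s<..t} f" "\<bar>LINT u : {s<..t} | lborel. f u\<bar> \<le> c * (t - s)"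
proof -
  have i: "integrable lborel (\<lambda>u. c * indicator {s<..t} u)" using assms(3) by simp
  show f: "set_integrable lborel {s<..t} f" unfolding set_integrable_def
    by (rule Bochner_Integration.integrable_bound[OF i]) (use assms order_trans[OF abs_ge_zero assms(2)] in \<open>auto simp: indicator_def\<close>)
  have "\<bar>LINT u : {s<..t} | lborel. f u\<bar> \<le> (\<integral>u. \<bar>indicator {s<..t} u *\<^sub>R f u\<bar> \<partial>lborel)"
    unfolding set_lebesgue_integral_def by (rule integral_abs_bound)
  also have "\<dots> \<le> (\<integral>u. c * indicator {s<..t} u \<partial>lborel)"
    using f assms unfolding set_integrable_def by (intro integral_mono integrable_abs i) (auto simp: indicator_def)
  also have "\<dots> = c * (t - s)" using assms(3) by simp
  finally show "\<bar>LINT u : {s<..t} | lborel. f u\<bar> \<le> c * (t - s)" .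
qed

lemma rate_path_measurable:
  assumes "bounded_test \<phi> c" "0 \<le> t" "\<omega> \<in> cadlag_paths"
  shows "(\<lambda>u. rate \<phi> u (\<omega> (max 0 (min t u)))) \<in> borel_measurable borel"
  using measurable_compose[OF measurable_Pair2'[of \<omega> "F t" borel] rate_progressive[OF assms(1,2)]] assms(3)
  by (simp add: space_F)

lemma alive_rate_path_measurable:
  assumes "bounded_test \<phi> c" "0 \<le> t" "D \<in> sets borel" "\<omega> \<in> cadlag_paths"
  shows "(\<lambda>u. of_bool (alive D (max 0 (min t u)) \<omega>) * rate \<phi> u (\<omega> (max 0 (min t u)))) \<in> borel_measurable borel"
  using measurable_compose[OF measurable_Pair2'[of \<omega> "F t" borel] alive_rate_progressive[OF assms(1,2,3)]] assms(4)
  by (simp add: space_F)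

lemma drift_bound:
  assumes "bounded_test \<phi> c" "0 \<le> s" "s \<le> t" "\<omega> \<in> cadlag_paths"
  shows "\<bar>drift \<phi> s t \<omega>\<bar> \<le> c * rate_sup L * (t - s)"
  unfolding drift_def
  by (rule set_integral_time_bound) (use assms rate_bound[OF assms(1)] in \<open>auto intro!: rate_path_measurable\<close>)

lemma alive_drift_bound:
  assumes "bounded_test \<phi> c" "0 \<le> s" "s \<le> t" "D \<in> sets borel" "\<omega> \<in> cadlag_paths"
  shows "\<bar>alive_drift D \<phi> s t \<omega>\<bar> \<le> c * rate_sup L * (t - s)"
  unfolding alive_drift_def
  by (rule set_integral_time_bound)
     (use assms rate_bound[OF assms(1)] bounded_test_nonneg[OF assms(1)] rate_nonneg in
       \<open>auto intro!: alive_rate_path_measurable\<close>)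

lemma drift_integrable: "bounded_test \<phi> c \<Longrightarrow> 0 \<le> s \<Longrightarrow> s \<le> t \<Longrightarrow> integrable M (drift \<phi> s t)"
  by (rule integrable_const_bound[of _ "c * rate_sup L * (t - s)"])
     (auto intro!: AE_I2 drift_bound cadlag_M F_M[OF drift_measurable])

lemma alive_drift_integrable:
  "bounded_test \<phi> c \<Longrightarrow> 0 \<le> s \<Longrightarrow> s \<le> t \<Longrightarrow> D \<in> sets borel \<Longrightarrow> integrable M (alive_drift D \<phi> s t)"
  by (rule integrable_const_bound[of _ "c * rate_sup L * (t - s)"])
     (auto intro!: AE_I2 alive_drift_bound cadlag_M F_M[OF alive_drift_measurable])

lemma jump_sum_diff:
  assumes "pure_jump \<omega>" "0 \<le> s" "s \<le> t"
  shows "jump_sum \<phi> s t \<omega> = jump_sum \<phi> 0 t \<omega> - jump_sum \<phi> 0 s \<omega>"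
proof -
  have "jumps_in \<omega> 0 t = jumps_in \<omega> 0 s \<union> jumps_in \<omega> s t" using assms by auto
  moreover have "jumps_in \<omega> 0 s \<inter> jumps_in \<omega> s t = {}" by auto
  ultimately show ?thesis unfolding jump_sum_def
    using pure_jump_finite[OF assms(1)] by (simp add: sum.union_disjoint)
qed

lemma drift_diff:
  assumes "bounded_test \<phi> c" "0 \<le> s" "s \<le> t" "\<omega> \<in> cadlag_paths"
  shows "drift \<phi> s t \<omega> = drift \<phi> 0 t \<omega> - drift \<phi> 0 s \<omega>"
proof -
  let ?f = "\<lambda>u. rate \<phi> u (\<omega> (max 0 (min t u)))"
  have i: "set_integrable lborel {v<..w} ?f" if "v \<le> w" for v w
    using that assms by (intro set_integral_time_bound(1)[of _ "c * rate_sup L"] rate_path_measurable rate_bound) auto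
  have "{0<..t} = {0<..s} \<union> {s<..t}" using assms by auto
  then have "drift \<phi> 0 t \<omega> = (LINT u : {0<..s} | lborel. ?f u) + (LINT u : {s<..t} | lborel. ?f u)"
    unfolding drift_def using assms by (simp add: set_integral_Un[OF _ i i])
  also have "(LINT u : {0<..s} | lborel. ?f u) = drift \<phi> 0 s \<omega>"
    unfolding drift_def using assms by (intro set_lebesgue_integral_cong) auto
  finally show ?thesis by (simp add: drift_def)
qed

lemma AE_compensated:
  assumes "bounded_test \<phi> c" "0 \<le> t"
  shows "AE \<omega> in M. compensated_jumps (\<lambda>_. \<infinity>) (levy_kernel (\<lambda>_. L)) \<phi> t \<omega> = jump_sum \<phi> 0 t \<omega> - drift \<phi> 0 t \<omega>"
  using AE_good
proof eventually_elim
  case (elim \<omega>)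
  have "{s \<in> jump_times \<omega>. s \<le> t \<and> ereal s \<le> \<infinity>} = jumps_in \<omega> 0 t"
    using jump_times_pos by auto
  moreover have "(LINT (s, y) : {0<..t} \<times> UNIV | levy_kernel (\<lambda>_. L) \<omega>. \<phi> (s, left_lim \<omega> s, y)) =
     (LINT u : {0<..t} | lborel. (\<integral>y. \<phi> (u, \<omega> (max 0 u), y) \<partial>L (\<omega> (max 0 u))))"
    by (rule levy_compensator[of _ _ c]) (use elim assms(1) in \<open>auto simp: bounded_test_def\<close>)
  moreover have "\<dots> = drift \<phi> 0 t \<omega>"
    unfolding drift_def rate_def by (intro set_lebesgue_integral_cong) auto
  ultimately show ?case unfolding compensated_jumps_def jump_sum_def by simp
qed

lemma test_bounded: "bounded_test \<phi> c \<Longrightarrow> bounded (range \<phi>)"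
  unfolding bounded_iff bounded_test_def by auto

text \<open>Adaptedness and integrability are read off the martingale: almost surely the jump sum is
  the compensated process plus a bounded drift. Since \<open>F t\<close> need not contain null sets,
  only a version is adapted. For \<open>\<phi> = 1\<close> this makes the number of jumps
  integrable.\<close>

lemma jump_sum_0:
  assumes \<phi>: "bounded_test \<phi> c" and t: "0 \<le> t"
  obtains g where "g \<in> borel_measurable (F t)" "AE \<omega> in M. g \<omega> = jump_sum \<phi> 0 t \<omega>" "integrable M (jump_sum \<phi> 0 t)"
proof -
  let ?Z = "compensated_jumps (\<lambda>_. \<infinity>) (levy_kernel (\<lambda>_. L)) \<phi> t"
  define g where "g \<omega> = ?Z \<omega> + drift \<phi> 0 t \<omega>" for \<omega>
  have Z: "?Z \<in> borel_measurable (F t)" "integrable M ?Z"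
    using mart[OF bounded_test_measurable[OF \<phi>] test_bounded[OF \<phi>]] t by (auto simp: is_martingale_def)
  have g: "g \<in> borel_measurable (F t)"
    unfolding g_def using Z drift_measurable[OF \<phi> t] by measurable
  have ae: "AE \<omega> in M. g \<omega> = jump_sum \<phi> 0 t \<omega>"
    using AE_compensated[OF \<phi> t] by eventually_elim (simp add: g_def)
  have gi: "integrable M g" unfolding g_def using Z drift_integrable[OF \<phi> _ t] by auto
  have "jump_sum \<phi> 0 t \<in> borel_measurable M"
    by (rule completion_measurable_AE[OF F_M[OF g] ae]) simp
  with gi ae have "integrable M (jump_sum \<phi> 0 t)"
    using integrable_cong_AE[of g M "jump_sum \<phi> 0 t"] by auto
  with g ae show ?thesis by (rule that)
qed

lemma jump_sum_version:
  assumes \<phi>: "bounded_test \<phi> c" and s: "0 \<le> s" "s \<le> t"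
  obtains g where "g \<in> borel_measurable (F t)" "AE \<omega> in M. g \<omega> = jump_sum \<phi> s t \<omega>"
proof -
  from s have t: "0 \<le> t" by simp
  obtain g where g: "g \<in> borel_measurable (F t)" "AE \<omega> in M. g \<omega> = jump_sum \<phi> 0 t \<omega>"
    using jump_sum_0[OF \<phi> t] by blast
  obtain k where k: "k \<in> borel_measurable (F s)" "AE \<omega> in M. k \<omega> = jump_sum \<phi> 0 s \<omega>"
    using jump_sum_0[OF \<phi> s(1)] by blast
  show ?thesis
  proof (rule that[of "\<lambda>\<omega>. g \<omega> - k \<omega>"])
    show "(\<lambda>\<omega>. g \<omega> - k \<omega>) \<in> borel_measurable (F t)"
      using g(1) F_mono[OF k(1) s(2)] by measurable
    show "AE \<omega> in M. g \<omega> - k \<omega> = jump_sum \<phi> s t \<omega>"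
      using g(2) k(2) AE_good by eventually_elim (simp add: jump_sum_diff[OF _ s])
  qed
qed

lemma jump_sum_integrable:
  assumes \<phi>: "bounded_test \<phi> c" and s: "0 \<le> s" "s \<le> t"
  shows "integrable M (jump_sum \<phi> s t)"
proof -
  from s have t: "0 \<le> t" by simp
  obtain g where g: "g \<in> borel_measurable (F t)" "AE \<omega> in M. g \<omega> = jump_sum \<phi> s t \<omega>"
    using jump_sum_version[OF \<phi> s] by blast
  have m: "jump_sum \<phi> s t \<in> borel_measurable M"
    by (rule completion_measurable_AE[OF F_M[OF g(1)] g(2)]) simp
  have i: "integrable M (\<lambda>\<omega>. jump_sum \<phi> 0 t \<omega> - jump_sum \<phi> 0 s \<omega>)"
    using jump_sum_0[OF \<phi> t] jump_sum_0[OF \<phi> s(1)] by (metis Bochner_Integration.integrable_diff)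
  have ae: "AE \<omega> in M. jump_sum \<phi> s t \<omega> = jump_sum \<phi> 0 t \<omega> - jump_sum \<phi> 0 s \<omega>"
    using AE_good by eventually_elim (simp add: jump_sum_diff[OF _ s])
  show ?thesis
    by (rule integrable_cong_AE_imp[OF i m]) (use ae in \<open>auto elim: eventually_mono\<close>)
qed

text \<open>The martingale property tested against events of the past. For partition arguments this
  form is handier than conditional expectations, since a zero-one weight known at time
  \<open>s\<close> can be absorbed into \<open>C\<close>.\<close>

lemma jump_sum_expectation:
  assumes \<phi>: "bounded_test \<phi> c" and s: "0 \<le> s" "s \<le> t" and C: "C \<in> sets (F s)"
  shows "(\<integral>\<omega>. indicator C \<omega> * jump_sum \<phi> s t \<omega> \<partial>M) = (\<integral>\<omega>. indicator C \<omega> * drift \<phi> s t \<omega> \<partial>M)"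
proof -
  from s have t: "0 \<le> t" by simp
  let ?Z = "compensated_jumps (\<lambda>_. \<infinity>) (levy_kernel (\<lambda>_. L)) \<phi>"
  have Z: "is_martingale M F ?Z"
    using mart[OF bounded_test_measurable[OF \<phi>] test_bounded[OF \<phi>]] .
  then have Zi: "integrable M (?Z t)" "integrable M (?Z s)" and Zm: "?Z s \<in> borel_measurable (F s)"
    and Zc: "AE \<omega> in M. real_cond_exp M (F s) (?Z t) \<omega> = ?Z s \<omega>"
    using s t by (auto simp: is_martingale_def)
  interpret fs: finite_measure_subalgebra M "F s" by unfold_locales (rule sub)
  have CM: "C \<in> sets M" using C by (rule sets_F_M)
  have "(\<integral>\<omega>\<in>C. ?Z t \<omega> \<partial>M) = (\<integral>\<omega>\<in>C. real_cond_exp M (F s) (?Z t) \<omega> \<partial>M)"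
    by (rule fs.real_cond_exp_intA[OF Zi(1) C])
  also have "\<dots> = (\<integral>\<omega>\<in>C. ?Z s \<omega> \<partial>M)"
    unfolding set_lebesgue_integral_def
    by (rule integral_cong_AE) (use Zc CM Zi in \<open>auto elim: eventually_mono\<close>)
  finally have eq: "(\<integral>\<omega>. indicator C \<omega> * ?Z t \<omega> \<partial>M) = (\<integral>\<omega>. indicator C \<omega> * ?Z s \<omega> \<partial>M)"
    by (simp add: set_lebesgue_integral_def)
  have i: "integrable M (\<lambda>\<omega>. indicator C \<omega> * f \<omega>)" if "integrable M f" for f :: "_ \<Rightarrow> real"
    using integrable_mult_indicator[OF CM that] by simp
  note ji = i[OF jump_sum_integrable[OF \<phi> s]] and di = i[OF drift_integrable[OF \<phi> s]]
  have "(\<integral>\<omega>. indicator C \<omega> * jump_sum \<phi> s t \<omega> \<partial>M) - (\<integral>\<omega>. indicator C \<omega> * drift \<phi> s t \<omega> \<partial>M)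
     = (\<integral>\<omega>. indicator C \<omega> * jump_sum \<phi> s t \<omega> - indicator C \<omega> * drift \<phi> s t \<omega> \<partial>M)"
    by (rule Bochner_Integration.integral_diff[OF ji di, symmetric])
  also have "\<dots> = (\<integral>\<omega>. indicator C \<omega> * ?Z t \<omega> - indicator C \<omega> * ?Z s \<omega> \<partial>M)"
  proof (rule integral_cong_AE)
    show "AE \<omega> in M. indicator C \<omega> * jump_sum \<phi> s t \<omega> - indicator C \<omega> * drift \<phi> s t \<omega> =
       indicator C \<omega> * ?Z t \<omega> - indicator C \<omega> * ?Z s \<omega>"
      using AE_compensated[OF \<phi> t] AE_compensated[OF \<phi> s(1)] AE_good
      by eventually_elim (auto simp: indicator_def jump_sum_diff[OF _ s] drift_diff[OF \<phi> s])
  qed (use ji di i[OF Zi(1)] i[OF Zi(2)] in auto)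
  also have "\<dots> = 0" using eq by (subst Bochner_Integration.integral_diff[OF i[OF Zi(1)] i[OF Zi(2)]]) simp
  finally show ?thesis by simp
qed

section \<open>The compensator formula up to a hitting time\<close>

text \<open>The weight of a cell is taken at its left end, before the increment begins, so that the
  compensator formula holds term by term.\<close>

definition alive_sum_approx ::
    "'a set \<Rightarrow> (real \<times> 'a \<times> 'a \<Rightarrow> real) \<Rightarrow> real \<Rightarrow> real \<Rightarrow> nat \<Rightarrow> (real \<Rightarrow> 'a) \<Rightarrow> real" where
  "alive_sum_approx D \<phi> s t n \<omega> =
     (\<Sum>i<Suc n. of_bool (alive D (grid s t n i) \<omega>) * jump_sum \<phi> (grid s t n i) (grid s t n (Suc i)) \<omega>)"

definition alive_drift_approx ::
    "'a set \<Rightarrow> (real \<times> 'a \<times> 'a \<Rightarrow> real) \<Rightarrow> real \<Rightarrow> real \<Rightarrow> nat \<Rightarrow> (real \<Rightarrow> 'a) \<Rightarrow> real" where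
  "alive_drift_approx D \<phi> s t n \<omega> =
     (\<Sum>i<Suc n. of_bool (alive D (grid s t n i) \<omega>) * drift \<phi> (grid s t n i) (grid s t n (Suc i)) \<omega>)"

abbreviation "jump_count \<equiv> jump_sum (\<lambda>_. 1)"

lemma bounded_test_1: "bounded_test (\<lambda>_. 1) 1"
  by (simp add: bounded_test_def)

lemma jump_count_eq: "jump_count s t \<omega> = real (card (jumps_in \<omega> s t))"
  by (simp add: jump_sum_def)

lemma alive_sum_bound:
  assumes "bounded_test \<phi> c"
  shows "\<bar>alive_sum D \<phi> s t \<omega>\<bar> \<le> c * jump_count s t \<omega>"
proof -
  have "\<bar>alive_sum D \<phi> s t \<omega>\<bar> \<le> (\<Sum>u\<in>jumps_in \<omega> s t. c)"
    unfolding alive_sum_def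
    by (rule order_trans[OF sum_abs sum_mono]) (use bounded_test_le[OF assms] bounded_test_nonneg[OF assms] in auto)
  then show ?thesis by (simp add: jump_count_eq mult.commute)
qed

lemma alive_sum_approx_eq:
  assumes "pure_jump \<omega>" "s \<le> t"
  shows "alive_sum_approx D \<phi> s t n \<omega> =
    (\<Sum>u\<in>jumps_in \<omega> s t. of_bool (alive D (grid_below s t n u) \<omega>) * \<phi> (u, left_lim \<omega> u, \<omega> u))"
  unfolding alive_sum_approx_def jump_sum_def by (rule sum_grid[OF pure_jump_finite[OF assms(1)] assms(2)])

lemma alive_sum_approx_bound:
  assumes "bounded_test \<phi> c" "pure_jump \<omega>" "s \<le> t"
  shows "\<bar>alive_sum_approx D \<phi> s t n \<omega>\<bar> \<le> c * jump_count s t \<omega>"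
proof -
  have "\<bar>alive_sum_approx D \<phi> s t n \<omega>\<bar> \<le> (\<Sum>u\<in>jumps_in \<omega> s t. c)"
    unfolding alive_sum_approx_eq[OF assms(2,3)]
    by (rule order_trans[OF sum_abs sum_mono]) (use bounded_test_le[OF assms(1)] bounded_test_nonneg[OF assms(1)] in auto)
  then show ?thesis by (simp add: jump_count_eq mult.commute)
qed

lemma alive_grid_tendsto:
  assumes "pure_jump \<omega>" "0 \<le> s" "s < u" "u \<le> t"
  shows "\<forall>\<^sub>F n in sequentially. alive D (grid_below s t n u) \<omega> = alive_before D u \<omega>"
  by (rule eventually_compose_filterlim[OF alive_left_limit[OF assms(1)] grid_below_tendsto]) (use assms in auto)

lemma alive_sum_approx_tendsto:
  assumes "pure_jump \<omega>" "0 \<le> s" "s \<le> t"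
  shows "(\<lambda>n. alive_sum_approx D \<phi> s t n \<omega>) \<longlonglongrightarrow> alive_sum D \<phi> s t \<omega>"
  unfolding alive_sum_approx_eq[OF assms(1,3)] alive_sum_def
proof (intro tendsto_sum tendsto_mult tendsto_const tendsto_eventually)
  fix u assume "u \<in> jumps_in \<omega> s t"
  then have "s < u" "u \<le> t" by auto
  from alive_grid_tendsto[OF assms(1,2) this, of D]
  show "\<forall>\<^sub>F n in sequentially. of_bool (alive D (grid_below s t n u) \<omega>) = (of_bool (alive_before D u \<omega>) :: real)"
    by eventually_elim simp
qed

lemma grid_index_measurable: "grid_index s t n \<in> borel \<rightarrow>\<^sub>M count_space UNIV"
proof -
  have "(\<lambda>u. \<lceil>(u - s) * real (Suc n) / (t - s)\<rceil>) \<in> borel \<rightarrow>\<^sub>M count_space UNIV" by measurable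
  from measurable_compose[OF this, of "\<lambda>k. nat (k - 1)"] show ?thesis
    unfolding grid_index_def by simp
qed

lemma alive_drift_approx_eq:
  assumes \<phi>: "bounded_test \<phi> c" and \<omega>: "\<omega> \<in> cadlag_paths" and s: "0 \<le> s" "s \<le> t"
  shows "alive_drift_approx D \<phi> s t n \<omega> =
    (LINT u : {s<..t} | lborel. of_bool (alive D (grid_below s t n u) \<omega>) * rate \<phi> u (\<omega> (max 0 (min t u))))"
proof -
  let ?g = "\<lambda>u. rate \<phi> u (\<omega> (max 0 (min t u)))"
  have eq: "drift \<phi> (grid s t n i) (grid s t n (Suc i)) \<omega> = (LINT u : {grid s t n i<..grid s t n (Suc i)} | lborel. ?g u)"
    if "i < Suc n" for i
    unfolding drift_def using grid_le[OF s(2), of "Suc i" n] that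
    by (intro set_lebesgue_integral_cong) auto
  have "alive_drift_approx D \<phi> s t n \<omega> =
      (\<Sum>i<Suc n. of_bool (alive D (grid s t n i) \<omega>) * (LINT u : {grid s t n i<..grid s t n (Suc i)} | lborel. ?g u))"
    unfolding alive_drift_approx_def using eq by (intro sum.cong refl) (simp only: lessThan_iff)
  also have "\<dots> = (LINT u : {s<..t} | lborel. of_bool (alive D (grid_below s t n u) \<omega>) * ?g u)"
  proof (rule set_integral_grid[OF _ s(2)])
    show "set_integrable lborel {s<..t} ?g"
      using \<phi> \<omega> s by (intro set_integral_time_bound(1)[of _ "c * rate_sup L"] rate_path_measurable rate_bound) auto
  qed
  finally show ?thesis .
qed

lemma alive_drift_approx_tendsto:
  assumes \<phi>: "bounded_test \<phi> c" and \<omega>: "\<omega> \<in> cadlag_paths" "pure_jump \<omega>" and s: "0 \<le> s" "s \<le> t"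
    and D: "D \<in> sets borel"
  shows "(\<lambda>n. alive_drift_approx D \<phi> s t n \<omega>) \<longlonglongrightarrow> alive_drift D \<phi> s t \<omega>"
    and "\<bar>alive_drift_approx D \<phi> s t n \<omega>\<bar> \<le> c * rate_sup L * (t - s)"
proof -
  let ?g = "\<lambda>u. rate \<phi> u (\<omega> (max 0 (min t u)))"
  have g: "?g \<in> borel_measurable borel" using \<phi> \<omega> s by (intro rate_path_measurable) auto
  have fm: "(\<lambda>u. of_bool (alive D (grid_below s t n u) \<omega>) * ?g u) \<in> borel_measurable borel" for n
    by (intro borel_measurable_times g measurable_compose[OF grid_index_measurable]) simp
  have am: "(\<lambda>u. of_bool (alive D (max 0 (min t u)) \<omega>) * ?g u) \<in> borel_measurable borel"
    using \<phi> \<omega> s D by (intro alive_rate_path_measurable) auto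
  have fb: "\<bar>of_bool P * ?g u\<bar> \<le> c * rate_sup L" for u P
    using rate_bound[OF \<phi>, of u "\<omega> (max 0 (min t u))"] bounded_test_nonneg[OF \<phi>] rate_nonneg by (cases P) auto
  show "\<bar>alive_drift_approx D \<phi> s t n \<omega>\<bar> \<le> c * rate_sup L * (t - s)"
    unfolding alive_drift_approx_eq[OF \<phi> \<omega>(1) s]
    by (rule set_integral_time_bound(2)[OF fm fb s(2)])
  have i: "integrable lborel (\<lambda>u. c * rate_sup L * indicator {s<..t} u)" using s by simp
  show "(\<lambda>n. alive_drift_approx D \<phi> s t n \<omega>) \<longlonglongrightarrow> alive_drift D \<phi> s t \<omega>"
    unfolding alive_drift_approx_eq[OF \<phi> \<omega>(1) s] alive_drift_def set_lebesgue_integral_def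
  proof (rule integral_dominated_convergence[OF _ _ i])
    show "(\<lambda>u. indicat_real {s<..t} u *\<^sub>R (of_bool (alive D (max 0 (min t u)) \<omega>) * ?g u)) \<in> borel_measurable lborel"
      "(\<lambda>u. indicat_real {s<..t} u *\<^sub>R (of_bool (alive D (grid_below s t n u) \<omega>) * ?g u)) \<in> borel_measurable lborel" for n
      using am fm[of n] by simp_all
    show "AE u in lborel. norm (indicat_real {s<..t} u *\<^sub>R (of_bool (alive D (grid_below s t n u) \<omega>) * ?g u))
        \<le> c * rate_sup L * indicat_real {s<..t} u" for n
    proof (rule AE_I2)
      fix u
      show "norm (indicat_real {s<..t} u *\<^sub>R (of_bool (alive D (grid_below s t n u) \<omega>) * ?g u))
        \<le> c * rate_sup L * indicat_real {s<..t} u"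
        by (cases "u \<in> {s<..t}") (use fb[of "alive D (grid_below s t n u) \<omega>" u] in simp_all)
    qed
    show "AE u in lborel. (\<lambda>n. indicat_real {s<..t} u *\<^sub>R (of_bool (alive D (grid_below s t n u) \<omega>) * ?g u)) \<longlonglongrightarrow>
        indicat_real {s<..t} u *\<^sub>R (of_bool (alive D (max 0 (min t u)) \<omega>) * ?g u)"
      \<comment> \<open>Pointwise the weights converge to \<open>alive_before\<close>; discarding
        the single time at which \<open>D\<close> is hit allows the limit to be written with
        \<open>alive\<close>.\<close>
      using AE_neq_ereal[of "hitting_time D \<omega>"]
    proof eventually_elim
      case (elim u)
      show ?case
      proof (cases "u \<in> {s<..t}")
        case True
        then have u: "s < u" "u \<le> t" "max 0 (min t u) = u" using s by auto
        have "alive D u \<omega> = alive_before D u \<omega>" using alive_eq_before[OF \<omega>(2) _ elim] u s by simp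
        then have "\<forall>\<^sub>F n in sequentially. of_bool (alive D (grid_below s t n u) \<omega>) = (of_bool (alive D u \<omega>) :: real)"
          using alive_grid_tendsto[OF \<omega>(2) s(1) u(1,2), of D] by (auto elim: eventually_mono)
        then show ?thesis unfolding u(3)
          by (intro tendsto_intros tendsto_eventually)
      qed simp
    qed
  qed
qed

lemma alive_event:
  assumes "0 \<le> u" "D \<in> sets borel" shows "{\<omega> \<in> cadlag_paths. alive D u \<omega>} \<in> sets (F u)"
  using alive_measurable[OF assms(1) coord_F assms(2), of u] assms(1) by (simp add: pred_def space_F)

lemma alive_sum_approx_version:
  assumes \<phi>: "bounded_test \<phi> c" and s: "0 \<le> s" "s \<le> t" and D: "D \<in> sets borel"
  shows "\<exists>g\<in>borel_measurable (F t). AE \<omega> in M. g \<omega> = alive_sum_approx D \<phi> s t n \<omega>"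
proof -
  let ?g = "grid s t n"
  have "\<exists>k\<in>borel_measurable (F t). AE \<omega> in M. k \<omega> = jump_sum \<phi> (?g i) (?g (Suc i)) \<omega>" if "i < Suc n" for i
  proof -
    have le: "0 \<le> ?g i" "?g i \<le> ?g (Suc i)" "?g (Suc i) \<le> t"
      using s grid_ge[OF s(2), of n i] grid_mono[OF s(2), of i "Suc i" n] grid_le[OF s(2), of "Suc i" n] that by auto
    obtain k where "k \<in> borel_measurable (F (?g (Suc i)))" "AE \<omega> in M. k \<omega> = jump_sum \<phi> (?g i) (?g (Suc i)) \<omega>"
      using jump_sum_version[OF \<phi> le(1,2)] by blast
    then show ?thesis using F_mono[OF _ le(3)] by blast
  qed
  then obtain k where k: "\<And>i. i < Suc n \<Longrightarrow> k i \<in> borel_measurable (F t)"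
    "\<And>i. i < Suc n \<Longrightarrow> AE \<omega> in M. k i \<omega> = jump_sum \<phi> (?g i) (?g (Suc i)) \<omega>"
    by metis
  have al: "(\<lambda>\<omega>. of_bool (alive D (?g i) \<omega>) :: real) \<in> borel_measurable (F t)" if "i < Suc n" for i
    using alive_measurable[of "?g i" "F t" D, OF _ coord_F D] grid_ge[OF s(2), of n i] grid_le[OF s(2), of i n] that s
    by simp
  show ?thesis
  proof (rule bexI[of _ "\<lambda>\<omega>. \<Sum>i<Suc n. of_bool (alive D (?g i) \<omega>) * k i \<omega>"])
    have "AE \<omega> in M. \<forall>i\<in>{..<Suc n}. k i \<omega> = jump_sum \<phi> (?g i) (?g (Suc i)) \<omega>"
      using k(2) by (intro AE_finite_allI) auto
    then show "AE \<omega> in M. (\<Sum>i<Suc n. of_bool (alive D (?g i) \<omega>) * k i \<omega>) = alive_sum_approx D \<phi> s t n \<omega>"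
      unfolding alive_sum_approx_def by eventually_elim (intro sum.cong refl, simp)
    show "(\<lambda>\<omega>. \<Sum>i<Suc n. of_bool (alive D (?g i) \<omega>) * k i \<omega>) \<in> borel_measurable (F t)"
      using k(1) al by (intro borel_measurable_sum borel_measurable_times) auto
  qed
qed

text \<open>A limit of adapted versions, taken off the union of their countably many exceptional
  null sets.\<close>

lemma alive_sum_version:
  assumes \<phi>: "bounded_test \<phi> c" and s: "0 \<le> s" "s \<le> t" and D: "D \<in> sets borel"
  obtains g where "g \<in> borel_measurable (F t)" "AE \<omega> in M. g \<omega> = alive_sum D \<phi> s t \<omega>"
proof -
  have "\<forall>n. \<exists>g. g \<in> borel_measurable (F t) \<and> (AE \<omega> in M. g \<omega> = alive_sum_approx D \<phi> s t n \<omega>)"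
    using alive_sum_approx_version[OF assms] by blast
  then obtain k where k: "\<And>n. k n \<in> borel_measurable (F t)" "\<And>n. AE \<omega> in M. k n \<omega> = alive_sum_approx D \<phi> s t n \<omega>"
    by metis
  have "AE \<omega> in M. \<forall>n. k n \<omega> = alive_sum_approx D \<phi> s t n \<omega>" using k(2) by (simp add: AE_all_countable)
  then have "AE \<omega> in M. (\<lambda>n. k n \<omega>) \<longlonglongrightarrow> alive_sum D \<phi> s t \<omega>"
    using AE_good by eventually_elim (simp add: alive_sum_approx_tendsto[OF _ s])
  from AE_limit_version[OF k(1) this] show ?thesis using that by blast
qed

lemma integrable_by_jump_count:
  assumes "f \<in> borel_measurable M" "AE \<omega> in M. \<bar>f \<omega>\<bar> \<le> c * jump_count s t \<omega>" "0 \<le> s" "s \<le> t"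
  shows "integrable M (f :: _ \<Rightarrow> real)"
proof (rule Bochner_Integration.integrable_bound)
  show "integrable M (\<lambda>\<omega>. c * jump_count s t \<omega>)"
    using jump_sum_integrable[OF bounded_test_1 assms(3,4)] by simp
  show "AE \<omega> in M. norm (f \<omega>) \<le> norm (c * jump_count s t \<omega>)"
    using assms(2) by eventually_elim auto
qed (rule assms(1))

lemma alive_sum_approx_measurable:
  assumes \<phi>: "bounded_test \<phi> c" and s: "0 \<le> s" "s \<le> t" and D: "D \<in> sets borel"
  shows "alive_sum_approx D \<phi> s t n \<in> borel_measurable M"
proof -
  obtain g where "g \<in> borel_measurable (F t)" "AE \<omega> in M. g \<omega> = alive_sum_approx D \<phi> s t n \<omega>"
    using alive_sum_approx_version[OF assms] by blast
  then show ?thesis by (intro completion_measurable_AE[OF F_M]) auto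
qed

lemma alive_sum_measurable:
  assumes \<phi>: "bounded_test \<phi> c" and s: "0 \<le> s" "s \<le> t" and D: "D \<in> sets borel"
  shows "alive_sum D \<phi> s t \<in> borel_measurable M"
proof -
  obtain g where "g \<in> borel_measurable (F t)" "AE \<omega> in M. g \<omega> = alive_sum D \<phi> s t \<omega>"
    using alive_sum_version[OF assms] by blast
  then show ?thesis by (intro completion_measurable_AE[OF F_M]) auto
qed

lemma alive_sum_integrable:
  assumes \<phi>: "bounded_test \<phi> c" and s: "0 \<le> s" "s \<le> t" and D: "D \<in> sets borel"
  shows "integrable M (alive_sum D \<phi> s t)"
  by (rule integrable_by_jump_count[where c = c, OF alive_sum_measurable[OF assms] _ s]) (simp add: alive_sum_bound[OF \<phi>])

text \<open>For each partition the identity is exact, because survival at the left end of a cell is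
  an event known there and merges with \<open>C\<close>. In the limit the jump side keeps the
  predictable weight, while on the drift side it may be replaced by survival at the current
  time.\<close>

lemma alive_sum_expectation:
  assumes \<phi>: "bounded_test \<phi> c" and s: "0 \<le> s" "s \<le> t" and D: "D \<in> sets borel" and C: "C \<in> sets (F s)"
  shows "(\<integral>\<omega>. indicator C \<omega> * alive_sum D \<phi> s t \<omega> \<partial>M) = (\<integral>\<omega>. indicator C \<omega> * alive_drift D \<phi> s t \<omega> \<partial>M)"
proof -
  have CM: "C \<in> sets M" by (rule sets_F_M[OF C])
  have indM: "(\<lambda>\<omega>. indicator C \<omega> * f \<omega>) \<in> borel_measurable M" if "f \<in> borel_measurable M" for f :: "_ \<Rightarrow> real"
    using CM that by measurable
  have eq: "(\<integral>\<omega>. indicator C \<omega> * alive_sum_approx D \<phi> s t n \<omega> \<partial>M) = (\<integral>\<omega>. indicator C \<omega> * alive_drift_approx D \<phi> s t n \<omega> \<partial>M)" for n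
  proof -
    let ?g = "grid s t n"
    let ?C = "\<lambda>i. C \<inter> {\<omega> \<in> cadlag_paths. alive D (?g i) \<omega>}"
    have g: "0 \<le> ?g i" "s \<le> ?g i" "?g i \<le> ?g (Suc i)" for i
      using s grid_ge[OF s(2), of n i] grid_mono[OF s(2), of i "Suc i" n] by auto
    have Ci: "?C i \<in> sets (F (?g i))" for i
      using alive_event[OF g(1) D, of i] C sets_F_mono[OF g(2), of i] by auto
    have "C \<subseteq> cadlag_paths" using sets.sets_into_space[OF C] by (simp add: space_F)
    then have ind: "indicator C \<omega> * (of_bool (alive D (?g i) \<omega>) * a) = indicator (?C i) \<omega> * a" for \<omega> i and a :: real
      by (auto simp: indicator_def)
    have i: "integrable M (\<lambda>\<omega>. indicator (?C i) \<omega> * f \<omega>)" if "integrable M f" for f :: "_ \<Rightarrow> real" and i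
      using integrable_mult_indicator[OF sets_F_M[OF Ci] that] by simp
    have "(\<integral>\<omega>. indicator C \<omega> * alive_sum_approx D \<phi> s t n \<omega> \<partial>M) =
        (\<integral>\<omega>. (\<Sum>i<Suc n. indicator (?C i) \<omega> * jump_sum \<phi> (?g i) (?g (Suc i)) \<omega>) \<partial>M)"
      unfolding alive_sum_approx_def sum_distrib_left ind ..
    also have "\<dots> = (\<Sum>i<Suc n. (\<integral>\<omega>. indicator (?C i) \<omega> * jump_sum \<phi> (?g i) (?g (Suc i)) \<omega> \<partial>M))"
      by (rule Bochner_Integration.integral_sum) (rule i[OF jump_sum_integrable[OF \<phi> g(1,3)]])
    also have "\<dots> = (\<Sum>i<Suc n. (\<integral>\<omega>. indicator (?C i) \<omega> * drift \<phi> (?g i) (?g (Suc i)) \<omega> \<partial>M))"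
      by (intro sum.cong refl jump_sum_expectation[OF \<phi> g(1,3) Ci])
    also have "\<dots> = (\<integral>\<omega>. (\<Sum>i<Suc n. indicator (?C i) \<omega> * drift \<phi> (?g i) (?g (Suc i)) \<omega>) \<partial>M)"
      by (rule Bochner_Integration.integral_sum[symmetric]) (rule i[OF drift_integrable[OF \<phi> g(1,3)]])
    also have "\<dots> = (\<integral>\<omega>. indicator C \<omega> * alive_drift_approx D \<phi> s t n \<omega> \<partial>M)"
      unfolding alive_drift_approx_def sum_distrib_left ind ..
    finally show ?thesis .
  qed
  have "(\<lambda>n. \<integral>\<omega>. indicator C \<omega> * alive_sum_approx D \<phi> s t n \<omega> \<partial>M) \<longlonglongrightarrow> (\<integral>\<omega>. indicator C \<omega> * alive_sum D \<phi> s t \<omega> \<partial>M)"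
  proof (rule integral_dominated_convergence)
    show "integrable M (\<lambda>\<omega>. c * jump_count s t \<omega>)"
      using jump_sum_integrable[OF bounded_test_1 s] by simp
    show "AE \<omega> in M. (\<lambda>n. indicator C \<omega> * alive_sum_approx D \<phi> s t n \<omega>) \<longlonglongrightarrow> indicator C \<omega> * alive_sum D \<phi> s t \<omega>"
      using AE_good by eventually_elim (auto intro!: tendsto_intros alive_sum_approx_tendsto s)
    show "AE \<omega> in M. norm (indicator C \<omega> * alive_sum_approx D \<phi> s t n \<omega>) \<le> c * jump_count s t \<omega>" for n
      using AE_good
      by eventually_elim
         (use alive_sum_approx_bound[OF \<phi> _ s(2)] bounded_test_nonneg[OF \<phi>] in \<open>auto simp: indicator_def jump_count_eq\<close>)
  qed (intro indM alive_sum_measurable[OF \<phi> s D] alive_sum_approx_measurable[OF \<phi> s D])+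
  moreover have "(\<lambda>n. \<integral>\<omega>. indicator C \<omega> * alive_drift_approx D \<phi> s t n \<omega> \<partial>M) \<longlonglongrightarrow> (\<integral>\<omega>. indicator C \<omega> * alive_drift D \<phi> s t \<omega> \<partial>M)"
  proof (rule integral_dominated_convergence)
    show "integrable M (\<lambda>\<omega>. c * rate_sup L * (t - s))" by simp
    show "AE \<omega> in M. (\<lambda>n. indicator C \<omega> * alive_drift_approx D \<phi> s t n \<omega>) \<longlonglongrightarrow> indicator C \<omega> * alive_drift D \<phi> s t \<omega>"
      using AE_good by eventually_elim (auto intro!: tendsto_intros alive_drift_approx_tendsto[OF \<phi> _ _ s D])
    show "AE \<omega> in M. norm (indicator C \<omega> * alive_drift_approx D \<phi> s t n \<omega>) \<le> c * rate_sup L * (t - s)" for n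
      using AE_good
      by eventually_elim
         (use alive_drift_approx_tendsto(2)[OF \<phi> _ _ s D] bounded_test_nonneg[OF \<phi>] rate_nonneg s in
           \<open>auto simp: indicator_def\<close>)
    show "(\<lambda>\<omega>. indicator C \<omega> * alive_drift_approx D \<phi> s t n \<omega>) \<in> borel_measurable M" for n
    proof (rule indM)
      have "drift \<phi> (grid s t n i) (grid s t n (Suc i)) \<in> borel_measurable M" for i
        by (rule F_M[OF drift_measurable[OF \<phi>]]) (use grid_ge[OF s(2)] s in \<open>auto intro: order_trans\<close>)
      moreover have "(\<lambda>\<omega>. of_bool (alive D (grid s t n i) \<omega>) :: real) \<in> borel_measurable M" for i
        using alive_measurable[of "grid s t n i" M D, OF _ coord_M D] grid_ge[OF s(2), of n i] s by auto
      ultimately show "alive_drift_approx D \<phi> s t n \<in> borel_measurable M"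
        unfolding alive_drift_approx_def by measurable
    qed
  qed (intro indM F_M[OF alive_drift_measurable[OF \<phi> _ D]], use s in auto)
  ultimately show ?thesis unfolding eq by (rule LIMSEQ_unique)
qed

end

section \<open>A harmonic function with boundary values on two disjoint sets\<close>

locale hitting_problem = jump_law L R F x
  for L :: "'a::polish_space \<Rightarrow> 'a measure" and R F x +
  fixes A B :: "'a set" and h :: "'a \<Rightarrow> real"
  assumes A: "A \<in> sets borel" and B: "B \<in> sets borel" and AB: "A \<inter> B = {}"
    and bvp: "bvp_solution L A B h" and x: "x \<notin> A \<union> B"
    and finite_hit: "AE \<omega> in R. hitting_time (A \<union> B) \<omega> < \<infinity>"
begin

abbreviation "D \<equiv> A \<union> B"

lemma D: "D \<in> sets borel" using A B by simp

lemma h_measurable [measurable]: "h \<in> borel_measurable borel"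
  using bvp by (simp add: bvp_solution_def)

definition h_sup :: real where "h_sup = (SUP y. \<bar>h y\<bar>)"

lemma h_le: "\<bar>h y\<bar> \<le> h_sup"
proof -
  obtain b where "\<And>y. \<bar>h y\<bar> \<le> b" using bvp by (auto simp: bvp_solution_def bounded_iff)
  then show ?thesis unfolding h_sup_def by (intro cSUP_upper bdd_aboveI2[of _ _ b]) auto
qed

lemma h_sup_nonneg: "0 \<le> h_sup"
  using order_trans[OF abs_ge_zero h_le] .

lemma h_harmonic: "z \<notin> D \<Longrightarrow> (\<integral>y. h y - h z \<partial>L z) = 0"
  using bvp by (auto simp: bvp_solution_def)

lemma h_boundary: "z \<in> D \<Longrightarrow> h z = of_bool (z \<in> B)"
  using bvp by (auto simp: bvp_solution_def indicator_def)

abbreviation hit :: "(real \<Rightarrow> 'a) \<Rightarrow> bool" where "hit \<equiv> hits_in D B"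

lemma hit_measurable: "Measurable.pred M hit"
  by (rule hits_in_measurable[OF coord_M D B])

lemma hit_borel [measurable]: "(\<lambda>\<omega>. of_bool (hit \<omega>) :: real) \<in> borel_measurable M"
  using hit_measurable by measurable

lemma hit_event: "{\<omega> \<in> space M. hit \<omega>} \<in> sets M"
  using hit_measurable by measurable

lemma AE_hit: "AE \<omega> in M. (\<omega> \<in> cadlag_paths \<and> pure_jump \<omega> \<and> \<omega> 0 = x) \<and> hitting_time D \<omega> < \<infinity>"
  using AE_good AE_completion[OF finite_hit] by eventually_elim auto

lemma hitting_fin:
  assumes "pure_jump \<omega>" "hitting_time D \<omega> < \<infinity>"
  obtains T where "0 \<le> T" "hitting_time D \<omega> = ereal T" "\<omega> T \<in> D" "hit \<omega> \<longleftrightarrow> \<omega> T \<in> B"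
  using assms(1)
proof (cases rule: hitting_time_cases[where D = D])
  case inf
  then show ?thesis using assms(2) by simp
next
  case (fin T)
  then show ?thesis using that[of T] hits_in_iff[OF assms(1), of D B] by (simp add: stopped_value_def)
qed

lemma h_at_hitting:
  assumes "pure_jump \<omega>" "hitting_time D \<omega> = ereal T" "hitting_time D \<omega> < \<infinity>"
  shows "h (\<omega> T) = of_bool (hit \<omega>)"
proof -
  obtain T' where "hitting_time D \<omega> = ereal T'" "\<omega> T' \<in> D" "hit \<omega> \<longleftrightarrow> \<omega> T' \<in> B"
    using hitting_fin[OF assms(1,3)] by blast
  then show ?thesis using assms(2) h_boundary[of "\<omega> T"] by simp
qed

section \<open>The harmonic function along the process\<close>

text \<open>The weights keep exactly the jumps up to and including the hitting time
  \<open>T\<close>, so the sum telescopes to the value at \<open>min t T\<close>. If the path has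
  already hit by time \<open>s\<close>, all weights vanish.\<close>

lemma alive_sum_telescope:
  assumes w: "pure_jump \<omega>" and T: "hitting_time D \<omega> = ereal T" and s: "0 \<le> s" "s \<le> t"
  shows "alive_sum D (\<lambda>(u, z, y). h y - h z) s t \<omega> = of_bool (alive D s \<omega>) * (h (\<omega> (min t T)) - h (\<omega> s))"
proof (cases "s < T")
  case False
  then have "\<not> alive_before D u \<omega>" if "s < u" for u using that T by (simp add: alive_before_hitting[OF w])
  then have "alive_sum D (\<lambda>(u, z, y). h y - h z) s t \<omega> = 0"
    unfolding alive_sum_def by (intro sum.neutral) auto
  then show ?thesis using False T s by (simp add: alive_hitting[OF w])
next
  case True
  have sub: "jumps_in \<omega> s (min t T) \<subseteq> jumps_in \<omega> s t" by auto
  have "alive_sum D (\<lambda>(u, z, y). h y - h z) s t \<omega> =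
      (\<Sum>u\<in>jumps_in \<omega> s (min t T). of_bool (alive_before D u \<omega>) * (h (\<omega> u) - h (left_lim \<omega> u)))"
    unfolding alive_sum_def prod.case
    by (rule sum.mono_neutral_right[OF pure_jump_finite[OF w] sub]) (auto simp: alive_before_hitting[OF w] T)
  also have "\<dots> = (\<Sum>u\<in>jumps_in \<omega> s (min t T). h (\<omega> u) - h (left_lim \<omega> u))"
    by (intro sum.cong) (auto simp: alive_before_hitting[OF w] T)
  also have "\<dots> = h (\<omega> (min t T)) - h (\<omega> s)"
    using True s by (intro pure_jump_telescope[OF w]) auto
  finally show ?thesis using True T s by (simp add: alive_hitting[OF w])
qed

lemma difference_test: "bounded_test (\<lambda>(u, z, y). h y - h z) (2 * h_sup)"
  unfolding bounded_test_def
proof (intro conjI allI)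
  show "(\<lambda>(u, z, y). h y - h z) \<in> borel_measurable (borel \<Otimes>\<^sub>M borel \<Otimes>\<^sub>M borel)" by measurable
  fix p :: "real \<times> 'a \<times> 'a"
  show "\<bar>case p of (u, z, y) \<Rightarrow> h y - h z\<bar> \<le> 2 * h_sup"
    using h_le[of "snd (snd p)"] h_le[of "fst (snd p)"] by (auto simp: case_prod_beta' abs_le_iff)
qed

text \<open>Harmonicity annihilates the rate outside \<open>D\<close>, and inside \<open>D\<close>
  the survival weight is \<open>0\<close>.\<close>

lemma alive_drift_difference:
  assumes "0 \<le> s" shows "alive_drift D (\<lambda>(u, z, y). h y - h z) s t \<omega> = 0"
proof -
  have "of_bool (alive D v \<omega>) * rate (\<lambda>(u, z, y). h y - h z) u (\<omega> v) = 0" for u v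
    using h_harmonic[of "\<omega> v"] by (auto simp: rate_def alive_def)
  then show ?thesis unfolding alive_drift_def by (simp only:) simp
qed

text \<open>Optional stopping for \<open>h\<close>. For each finite horizon the stopped sum of
  increments of \<open>h\<close> has mean \<open>0\<close> on \<open>C\<close>; once the horizon has
  passed the hitting time, on paths alive at \<open>s\<close> the sum has become the boundary value
  minus \<open>h (\<omega> s)\<close>.\<close>

lemma hit_expectation:
  assumes s: "0 \<le> s" and C: "C \<in> sets (F s)"
  shows "(\<integral>\<omega>. indicator C \<omega> * (of_bool (alive D s \<omega>) * of_bool (hit \<omega>)) \<partial>M) =
    (\<integral>\<omega>. indicator C \<omega> * (of_bool (alive D s \<omega>) * h (\<omega> s)) \<partial>M)"
proof -
  let ?\<phi> = "\<lambda>(u::real, z, y). h y - h z"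
  have CM: "C \<in> sets M" by (rule sets_F_M[OF C])
  have al: "(\<lambda>\<omega>. of_bool (alive D s \<omega>) :: real) \<in> borel_measurable M"
    using alive_measurable[OF s coord_M D] by measurable
  have hs: "(\<lambda>\<omega>. h (\<omega> s)) \<in> borel_measurable M"
    by (rule measurable_compose[OF coord_M[OF s] h_measurable])
  have m1: "(\<lambda>\<omega>. indicator C \<omega> * (of_bool (alive D s \<omega>) * of_bool (hit \<omega>)) :: real) \<in> borel_measurable M"
    and m2: "(\<lambda>\<omega>. indicator C \<omega> * (of_bool (alive D s \<omega>) * h (\<omega> s))) \<in> borel_measurable M"
    using CM al hs by measurable
  have zero: "(\<integral>\<omega>. indicator C \<omega> * alive_sum D ?\<phi> s (s + real n) \<omega> \<partial>M) = 0" for n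
    using alive_sum_expectation[OF difference_test s _ D C, of "s + real n"] alive_drift_difference[OF s] by simp
  have "(\<lambda>n. \<integral>\<omega>. indicator C \<omega> * alive_sum D ?\<phi> s (s + real n) \<omega> \<partial>M) \<longlonglongrightarrow>
      (\<integral>\<omega>. indicator C \<omega> * (of_bool (alive D s \<omega>) * of_bool (hit \<omega>)) - indicator C \<omega> * (of_bool (alive D s \<omega>) * h (\<omega> s)) \<partial>M)"
  proof (rule integral_dominated_convergence)
    \<comment> \<open>The number of jumps would not do as a bound, since it grows with the horizon.
      The telescoped form is bounded by \<open>2 * h_sup\<close> whatever the horizon.\<close>
    show "integrable M (\<lambda>\<omega>. 2 * h_sup)" by simp
    show "(\<lambda>\<omega>. indicator C \<omega> * alive_sum D ?\<phi> s (s + real n) \<omega>) \<in> borel_measurable M" for n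
      using alive_sum_measurable[OF difference_test s _ D, of "s + real n"] CM by measurable
    show "AE \<omega> in M. (\<lambda>n. indicator C \<omega> * alive_sum D ?\<phi> s (s + real n) \<omega>) \<longlonglongrightarrow>
        indicator C \<omega> * (of_bool (alive D s \<omega>) * of_bool (hit \<omega>)) - indicator C \<omega> * (of_bool (alive D s \<omega>) * h (\<omega> s))"
      using AE_hit
    proof eventually_elim
      case (elim \<omega>)
      obtain T where T: "0 \<le> T" "hitting_time D \<omega> = ereal T"
        using hitting_fin[of \<omega>] elim by blast
      have hT: "h (\<omega> T) = of_bool (hit \<omega>)" using h_at_hitting[OF _ T(2)] elim by simp
      obtain n0 :: nat where "T \<le> s + real n0" using real_arch_simple[of "T - s"] by (auto simp: algebra_simps)
      then have "\<forall>\<^sub>F n in sequentially. indicator C \<omega> * alive_sum D ?\<phi> s (s + real n) \<omega> =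
         indicator C \<omega> * (of_bool (alive D s \<omega>) * of_bool (hit \<omega>)) - indicator C \<omega> * (of_bool (alive D s \<omega>) * h (\<omega> s))"
      proof (intro eventually_sequentiallyI[of n0])
        fix n assume "n0 \<le> n"
        then have "min (s + real n) T = T" using \<open>T \<le> s + real n0\<close> by simp
        then have "alive_sum D ?\<phi> s (s + real n) \<omega> = of_bool (alive D s \<omega>) * (of_bool (hit \<omega>) - h (\<omega> s))"
          using alive_sum_telescope[OF _ T(2) s, of "s + real n"] elim hT by simp
        then show "indicator C \<omega> * alive_sum D ?\<phi> s (s + real n) \<omega> =
         indicator C \<omega> * (of_bool (alive D s \<omega>) * of_bool (hit \<omega>)) - indicator C \<omega> * (of_bool (alive D s \<omega>) * h (\<omega> s))"
          by (simp only: right_diff_distrib)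
      qed
      then show ?case by (rule tendsto_eventually)
    qed
    show "AE \<omega> in M. norm (indicator C \<omega> * alive_sum D ?\<phi> s (s + real n) \<omega>) \<le> 2 * h_sup" for n
      using AE_hit
    proof eventually_elim
      case (elim \<omega>)
      obtain T where T: "0 \<le> T" "hitting_time D \<omega> = ereal T"
        using hitting_fin[of \<omega>] elim by blast
      show ?case
        using alive_sum_telescope[OF _ T(2) s, of "s + real n"] elim h_sup_nonneg
          h_le[of "\<omega> (min (s + real n) T)"] h_le[of "\<omega> s"] by (auto simp: indicator_def abs_le_iff)
    qed
  qed (intro borel_measurable_diff m1 m2)
  then have "(\<integral>\<omega>. indicator C \<omega> * (of_bool (alive D s \<omega>) * of_bool (hit \<omega>)) - indicator C \<omega> * (of_bool (alive D s \<omega>) * h (\<omega> s)) \<partial>M) = 0"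
    unfolding zero by (simp add: LIMSEQ_const_iff)
  moreover have "integrable M (\<lambda>\<omega>. indicator C \<omega> * (of_bool (alive D s \<omega>) * of_bool (hit \<omega>)) :: real)"
    by (rule integrable_const_bound[OF _ m1, of 1]) auto
  moreover have "integrable M (\<lambda>\<omega>. indicator C \<omega> * (of_bool (alive D s \<omega>) * h (\<omega> s)))"
    by (rule integrable_const_bound[OF _ m2, of h_sup]) (auto simp: indicator_def h_le h_sup_nonneg)
  ultimately show ?thesis by simp
qed

lemma alive_borel: "0 \<le> s \<Longrightarrow> (\<lambda>\<omega>. of_bool (alive D s \<omega>) :: real) \<in> borel_measurable (F s)"
  using alive_measurable[OF _ coord_F D] by simp

lemma h_borel: "0 \<le> s \<Longrightarrow> (\<lambda>\<omega>. h (\<omega> s)) \<in> borel_measurable (F s)"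
  by (rule measurable_compose[OF adapted h_measurable])

lemma alive_hit_integrable: "0 \<le> s \<Longrightarrow> integrable M (\<lambda>\<omega>. of_bool (alive D s \<omega>) * of_bool (hit \<omega>) :: real)"
  by (rule integrable_const_bound[of _ 1]) (use F_M[OF alive_borel] hit_borel in \<open>auto intro!: borel_measurable_times\<close>)

lemma alive_h_measurable: "0 \<le> s \<Longrightarrow> (\<lambda>\<omega>. of_bool (alive D s \<omega>) * h (\<omega> s)) \<in> borel_measurable (F s)"
  by (intro borel_measurable_times alive_borel h_borel)

lemma alive_h_integrable: "0 \<le> s \<Longrightarrow> integrable M (\<lambda>\<omega>. of_bool (alive D s \<omega>) * h (\<omega> s))"
  by (rule integrable_const_bound[of _ h_sup]) (auto intro!: F_M[OF alive_h_measurable] simp: h_le h_sup_nonneg)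

lemma hit_cond_exp:
  assumes s: "0 \<le> s"
  shows "AE \<omega> in M. real_cond_exp M (F s) (\<lambda>\<omega>. of_bool (alive D s \<omega>) * of_bool (hit \<omega>)) \<omega> = of_bool (alive D s \<omega>) * h (\<omega> s)"
proof -
  interpret fs: finite_measure_subalgebra M "F s" by unfold_locales (rule sub)
  show ?thesis
    by (rule fs.real_cond_exp_charact)
       (use hit_expectation[OF s] alive_hit_integrable[OF s] alive_h_integrable[OF s] alive_h_measurable[OF s] in
        \<open>auto simp: set_lebesgue_integral_def\<close>)
qed

text \<open>\<open>Y\<close> may be unbounded as long as the product is integrable: later it
  contains a jump sum over a cell, or a transformed rate.\<close>

lemma hit_expectation_mult:
  assumes s: "0 \<le> s" and Y: "Y \<in> borel_measurable (F s)"
    and i: "integrable M (\<lambda>\<omega>. Y \<omega> * (of_bool (alive D s \<omega>) * of_bool (hit \<omega>)))"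
  shows "integrable M (\<lambda>\<omega>. Y \<omega> * (of_bool (alive D s \<omega>) * h (\<omega> s)))"
    and "(\<integral>\<omega>. Y \<omega> * (of_bool (alive D s \<omega>) * of_bool (hit \<omega>)) \<partial>M) = (\<integral>\<omega>. Y \<omega> * (of_bool (alive D s \<omega>) * h (\<omega> s)) \<partial>M)"
proof -
  interpret fs: finite_measure_subalgebra M "F s" by unfold_locales (rule sub)
  note ah = F_M[OF alive_h_measurable[OF s]] and YM = F_M[OF Y]
  have hm: "(\<lambda>\<omega>. of_bool (alive D s \<omega>) * of_bool (hit \<omega>) :: real) \<in> borel_measurable M"
    using alive_hit_integrable[OF s] by simp
  note c = fs.real_cond_exp_intg[OF i Y hm]
  have ae: "AE \<omega> in M. Y \<omega> * real_cond_exp M (F s) (\<lambda>\<omega>. of_bool (alive D s \<omega>) * of_bool (hit \<omega>)) \<omega>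
      = Y \<omega> * (of_bool (alive D s \<omega>) * h (\<omega> s))"
    using hit_cond_exp[OF s] by eventually_elim simp
  have m: "(\<lambda>\<omega>. Y \<omega> * (of_bool (alive D s \<omega>) * h (\<omega> s))) \<in> borel_measurable M"
    using YM ah by (rule borel_measurable_times)
  show "integrable M (\<lambda>\<omega>. Y \<omega> * (of_bool (alive D s \<omega>) * h (\<omega> s)))"
    by (rule integrable_cong_AE_imp[OF c(1) m]) (use ae in \<open>auto elim: eventually_mono\<close>)
  show "(\<integral>\<omega>. Y \<omega> * (of_bool (alive D s \<omega>) * of_bool (hit \<omega>)) \<partial>M) = (\<integral>\<omega>. Y \<omega> * (of_bool (alive D s \<omega>) * h (\<omega> s)) \<partial>M)"
    unfolding c(2)[symmetric] by (rule integral_cong_AE[OF _ m ae]) (use c(1) in auto)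
qed

text \<open>For a path alive at a given time, \<open>h\<close> at its current state is the
  conditional probability of hitting \<open>B\<close> first. This gives the sign at all rational
  times simultaneously, and local constancy transfers it to every time.\<close>

lemma AE_h_nonneg: "AE \<omega> in M. \<forall>u\<ge>0. alive D u \<omega> \<longrightarrow> 0 \<le> h (\<omega> u)"
proof -
  have "AE \<omega> in M. alive D q \<omega> \<longrightarrow> 0 \<le> h (\<omega> q)" if q: "0 \<le> q" for q
  proof -
    interpret fs: finite_measure_subalgebra M "F q" by unfold_locales (rule sub)
    have "AE \<omega> in M. 0 \<le> real_cond_exp M (F q) (\<lambda>\<omega>. of_bool (alive D q \<omega>) * of_bool (hit \<omega>)) \<omega>"
      by (rule fs.real_cond_exp_pos) (use alive_hit_integrable[OF q] in auto)
    then show ?thesis using hit_cond_exp[OF q] by eventually_elim auto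
  qed
  then have "AE \<omega> in M. \<forall>q\<in>{q \<in> \<rat>. 0 \<le> q}. alive D q \<omega> \<longrightarrow> 0 \<le> h (\<omega> q)"
    by (intro AE_ball_countable[THEN iffD2]) (auto intro: countable_subset[OF _ countable_rat])
  then show ?thesis using AE_good
  proof eventually_elim
    case (elim \<omega>)
    then have w: "pure_jump \<omega>" by simp
    show ?case
    proof (intro allI impI)
      fix u assume u: "0 \<le> u" "alive D u \<omega>"
      \<comment> \<open>There is room between \<open>u\<close> and the hitting time, so a rational
        time that repeats the value \<open>\<omega> u\<close> can be found while the path is still
        alive.\<close>
      obtain v where v: "u < v" "ereal v \<le> hitting_time D \<omega>"
        using u alive_hitting[OF w u(1), of D] ereal_dense2[of "ereal u" "hitting_time D \<omega>"] by auto
      obtain q where "q \<in> \<rat>" "u < q" "q < v" "\<omega> q = \<omega> u" using rational_after[OF w u(1) v(1)] by blast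
      moreover from this have "alive D q \<omega>"
        using u(1) alive_hitting[OF w, of q D] less_le_trans[OF _ v(2), of "ereal q"] by simp
      ultimately show "0 \<le> h (\<omega> u)" using elim u(1) by (metis (no_types, lifting) less_imp_le mem_Collect_eq order_trans)
    qed
  qed
qed

text \<open>The case of time \<open>0\<close> and of the whole space in
  \<open>hit_expectation\<close>: the path starts at \<open>x\<close>, outside \<open>D\<close>, and
  is therefore alive.\<close>

lemma hit_probability: "measure M {\<omega> \<in> space M. hit \<omega>} = h x"
proof -
  have a0: "AE \<omega> in M. alive D 0 \<omega> \<and> \<omega> 0 = x"
    using AE_good by eventually_elim (use x in \<open>auto simp: alive_def alive_before_def\<close>)
  have sp: "cadlag_paths \<in> sets (F 0)" using sets.top[of "F 0"] by (simp add: space_F)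
  have "measure M {\<omega> \<in> space M. hit \<omega>} = (\<integral>\<omega>. indicator {\<omega> \<in> space M. hit \<omega>} \<omega> \<partial>M)"
    using hit_event sets.sets_into_space[OF hit_event] by (simp add: Int_absorb2)
  also have "\<dots> = (\<integral>\<omega>. indicator cadlag_paths \<omega> * (of_bool (alive D 0 \<omega>) * of_bool (hit \<omega>)) \<partial>M)"
  proof (rule integral_cong_AE)
    show "AE \<omega> in M. indicator {\<omega> \<in> space M. hit \<omega>} \<omega> = indicator cadlag_paths \<omega> * (of_bool (alive D 0 \<omega>) * of_bool (hit \<omega>) :: real)"
      using a0 AE_space by eventually_elim (auto simp: space_R indicator_def)
    show "(\<lambda>\<omega>. indicator cadlag_paths \<omega> * (of_bool (alive D 0 \<omega>) * of_bool (hit \<omega>) :: real)) \<in> borel_measurable M"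
      by (intro borel_measurable_times F_M[OF alive_borel] hit_borel) (use sets_F_M[OF sp] in auto)
  qed (use hit_event in simp)
  also have "\<dots> = (\<integral>\<omega>. indicator cadlag_paths \<omega> * (of_bool (alive D 0 \<omega>) * h (\<omega> 0)) \<partial>M)"
    by (rule hit_expectation[OF _ sp]) simp
  also have "\<dots> = (\<integral>\<omega>. h x \<partial>M)"
  proof (rule integral_cong_AE)
    show "AE \<omega> in M. indicator cadlag_paths \<omega> * (of_bool (alive D 0 \<omega>) * h (\<omega> 0)) = h x"
      using a0 AE_space by eventually_elim (auto simp: space_R indicator_def)
    show "(\<lambda>\<omega>. indicator cadlag_paths \<omega> * (of_bool (alive D 0 \<omega>) * h (\<omega> 0))) \<in> borel_measurable M"
      by (intro borel_measurable_times F_M[OF alive_borel] F_M[OF h_borel]) (use sets_F_M[OF sp] in auto)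
  qed simp
  also have "\<dots> = h x" using prob_space by simp
  finally show ?thesis .
qed

lemma hit_R: "Measurable.pred R hit"
proof (rule hits_in_measurable[OF _ D B])
  show "(\<lambda>\<omega>. \<omega> u) \<in> R \<rightarrow>\<^sub>M borel" if "0 \<le> u" for u
    using coordinate_measurable[OF that] measurable_cong_sets[OF sets_R refl] by blast
qed

lemma hit_event_R: "{\<omega> \<in> space R. hit \<omega>} \<in> sets R"
  using hit_R by (simp add: pred_def)

lemma hit_probability_R: "measure R {\<omega> \<in> space R. hit \<omega>} = h x"
  using hit_probability hit_event_R by simp

lemma h_start_nonneg: "0 \<le> h x"
  using hit_probability_R measure_nonneg by metis

text \<open>The extra factor is \<open>h\<close> at the target of the jump, which is the density
  process just after the jump up to the constant \<open>h x\<close>.\<close>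

definition h_test :: "(real \<times> 'a \<times> 'a \<Rightarrow> real) \<Rightarrow> real \<times> 'a \<times> 'a \<Rightarrow> real" where
  "h_test \<phi> = (\<lambda>(u, z, y). h y * \<phi> (u, z, y))"

lemma bounded_h_test:
  assumes "bounded_test \<phi> c" shows "bounded_test (h_test \<phi>) (h_sup * c)"
  unfolding bounded_test_def h_test_def
proof (intro conjI allI)
  note [measurable] = bounded_test_measurable[OF assms]
  show "(\<lambda>(u, z, y). h y * \<phi> (u, z, y)) \<in> borel_measurable (borel \<Otimes>\<^sub>M borel \<Otimes>\<^sub>M borel)" by measurable
  fix p :: "real \<times> 'a \<times> 'a"
  show "\<bar>case p of (u, z, y) \<Rightarrow> h y * \<phi> (u, z, y)\<bar> \<le> h_sup * c"
    using bounded_test_le[OF assms] h_le h_sup_nonneg by (cases p) (auto simp: abs_mult intro!: mult_mono)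
qed

subsection \<open>Jumps\<close>

text \<open>The integral of the density martingale against the jump sum: on each cell of the partition
  the density at the terminal time may be replaced by its value at the right end of the cell, and in the
  limit this is its value immediately after the jump.\<close>

lemma cell_limit:
  assumes w: "pure_jump \<omega>" "hitting_time D \<omega> < \<infinity>" and u: "0 \<le> s" "s < u" "u \<le> t"
  shows "\<forall>\<^sub>F n in sequentially. of_bool (alive D (grid_below s t n u) \<omega>) * (of_bool (alive D (grid_above s t n u) \<omega>) *
      (of_bool (hit \<omega>) - h (\<omega> (grid_above s t n u)))) = of_bool (alive_before D u \<omega>) * (of_bool (hit \<omega>) - h (\<omega> u))"
proof -
  have u0: "0 \<le> u" using u by simp
  obtain T where T: "0 \<le> T" "hitting_time D \<omega> = ereal T" using hitting_fin[OF w] by blast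
  have hT: "h (\<omega> T) = of_bool (hit \<omega>)" by (rule h_at_hitting[OF w(1) T(2) w(2)])
  obtain e where e: "0 < e" "\<And>v. u \<le> v \<Longrightarrow> v < u + e \<Longrightarrow> \<omega> v = \<omega> u"
    using pure_jump_const_right[OF w(1) u0] by blast
  have ev1: "\<forall>\<^sub>F n in sequentially. alive D (grid_below s t n u) \<omega> = alive_before D u \<omega>"
    by (rule alive_grid_tendsto[OF w(1) u])
  have ev2: "\<forall>\<^sub>F n in sequentially. grid_above s t n u < u + e"
    using order_tendstoD(2)[OF grid_above_tendsto[OF u(2,3)]] e(1) by simp
  have ev3: "\<forall>\<^sub>F n in sequentially. alive D (grid_above s t n u) \<omega> = alive D u \<omega>"
  proof (cases "u < T")
    case True
    have "\<forall>\<^sub>F n in sequentially. grid_above s t n u < T"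
      using order_tendstoD(2)[OF grid_above_tendsto[OF u(2,3)] True] .
    then show ?thesis
    proof eventually_elim
      case (elim n)
      then show ?case using grid_above[OF u(2,3), of n] u0 True by (simp add: alive_hitting[OF w(1)] T(2))
    qed
  next
    case False
    then have "\<not> alive D (grid_above s t n u) \<omega>" for n
      using grid_above[OF u(2,3), of n] u0 by (simp add: alive_hitting[OF w(1)] T(2))
    then show ?thesis using False u0 by (simp add: alive_hitting[OF w(1)] T(2))
  qed
  from ev1 ev2 ev3 show ?thesis
  proof eventually_elim
    case (elim n)
    have "\<omega> (grid_above s t n u) = \<omega> u" using e(2)[OF grid_above[OF u(2,3)] elim(2)] .
    moreover have "of_bool (alive_before D u \<omega>) * (of_bool (alive D u \<omega>) * (of_bool (hit \<omega>) - h (\<omega> u))) =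
        of_bool (alive_before D u \<omega>) * (of_bool (hit \<omega>) - h (\<omega> u))"
      using hT u0 by (cases "u = T") (auto simp: alive_before_hitting[OF w(1)] alive_hitting[OF w(1)] T(2))
    ultimately show ?case by (simp only: elim)
  qed
qed

lemma hit_alive_sum:
  assumes \<phi>: "bounded_test \<phi> c" and s: "0 \<le> s" "s \<le> t" and C: "C \<in> sets (F s)"
  shows "(\<integral>\<omega>. indicator C \<omega> * (of_bool (hit \<omega>) * alive_sum D \<phi> s t \<omega>) \<partial>M) =
    (\<integral>\<omega>. indicator C \<omega> * alive_sum D (h_test \<phi>) s t \<omega> \<partial>M)"
proof -
  let ?g = "grid s t"
  \<comment> \<open>Terminal density minus its value at the right end of the cell, up to a constant.
    Only paths alive at that end are kept, since for them \<open>h\<close> is the conditional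
    probability of \<open>hit\<close>; what this loses disappears in the limit by
    \<open>cell_limit\<close>.\<close>
  let ?d = "\<lambda>n i \<omega>. of_bool (alive D (?g n (Suc i)) \<omega>) * (of_bool (hit \<omega>) - h (\<omega> (?g n (Suc i))))"
  let ?J = "\<lambda>n i. jump_sum \<phi> (?g n i) (?g n (Suc i))"
  let ?S = "\<lambda>n \<omega>. \<Sum>i<Suc n. (of_bool (alive D (?g n i) \<omega>) * ?d n i \<omega>) * ?J n i \<omega>"
  have c0: "0 \<le> c" by (rule bounded_test_nonneg[OF \<phi>])
  have CM: "C \<in> sets M" by (rule sets_F_M[OF C])
  have g0: "0 \<le> ?g n i" "s \<le> ?g n i" "?g n i \<le> ?g n (Suc i)" for n i
    using s grid_ge[OF s(2), of n i] grid_mono[OF s(2), of i "Suc i" n] by auto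
  have dle: "\<bar>?d n i \<omega>\<bar> \<le> 1 + h_sup" for n i \<omega>
    using h_le[of "\<omega> (?g n (Suc i))"] h_sup_nonneg by (auto simp: abs_le_iff)
  have dm: "?d n i \<in> borel_measurable M" for n i
    by (intro borel_measurable_times borel_measurable_diff hit_borel F_M[OF alive_borel] F_M[OF h_borel] g0)
  have am: "(\<lambda>\<omega>. of_bool (alive D (?g n i) \<omega>) :: real) \<in> borel_measurable M" for n i
    by (rule F_M[OF alive_borel[OF g0(1)]])
  have Ji: "integrable M (?J n i)" for n i by (rule jump_sum_integrable[OF \<phi> g0(1,3)])
  have bm: "integrable M (\<lambda>\<omega>. b \<omega> * f \<omega>)"
    if "integrable M f" "b \<in> borel_measurable M" "\<And>\<omega>. \<bar>b \<omega>\<bar> \<le> k" for f b :: "_ \<Rightarrow> real" and k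
  proof (rule Bochner_Integration.integrable_bound)
    show "integrable M (\<lambda>\<omega>. k * f \<omega>)" using that by simp
    show "(\<lambda>\<omega>. b \<omega> * f \<omega>) \<in> borel_measurable M" using that by auto
    have "\<bar>b \<omega>\<bar> \<le> \<bar>k\<bar>" for \<omega> using that(3)[of \<omega>] by simp
    then show "AE \<omega> in M. norm (b \<omega> * f \<omega>) \<le> norm (k * f \<omega>)" by (auto simp: abs_mult intro!: mult_right_mono)
  qed
  have cell: "(\<integral>\<omega>. indicator C \<omega> * ((of_bool (alive D (?g n i) \<omega>) * ?d n i \<omega>) * ?J n i \<omega>) \<partial>M) = 0"
    and cell_int: "integrable M (\<lambda>\<omega>. indicator C \<omega> * ((of_bool (alive D (?g n i) \<omega>) * ?d n i \<omega>) * ?J n i \<omega>))" for n i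
  proof -
    let ?v = "?g n (Suc i)"
    \<comment> \<open>Conditioning at the right end asks for a factor measurable for
      \<open>F\<close> there, and the jump sum over the cell is guaranteed to have a version with
      this property.\<close>
    obtain k where k: "k \<in> borel_measurable (F ?v)" "AE \<omega> in M. k \<omega> = ?J n i \<omega>"
      using jump_sum_version[OF \<phi> g0(1,3)] by blast
    define Y where "Y \<omega> = indicator C \<omega> * (of_bool (alive D (?g n i) \<omega>) * k \<omega>)" for \<omega>
    have Y: "Y \<in> borel_measurable (F ?v)"
      unfolding Y_def using C sets_F_mono[OF g0(2), of n "Suc i"]
      by (intro borel_measurable_times k(1) F_mono[OF alive_borel[OF g0(1)] g0(3)] borel_measurable_indicator) auto
    have b: "integrable M (\<lambda>\<omega>. (indicator C \<omega> * of_bool (alive D (?g n i) \<omega>) * a \<omega>) * ?J n i \<omega>)"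
      if "a \<in> borel_measurable M" "\<And>\<omega>. \<bar>a \<omega>\<bar> \<le> l" for a :: "_ \<Rightarrow> real" and l
    proof (rule bm[OF Ji, of _ l])
      show "(\<lambda>\<omega>. indicator C \<omega> * of_bool (alive D (?g n i) \<omega>) * a \<omega>) \<in> borel_measurable M"
        by (intro borel_measurable_times borel_measurable_indicator am that CM)
      show "\<bar>indicator C \<omega> * of_bool (alive D (?g n i) \<omega>) * a \<omega>\<bar> \<le> l" for \<omega>
        using that(2)[of \<omega>] order_trans[OF abs_ge_zero that(2)[of \<omega>]] by (auto simp: indicator_def)
    qed
    let ?al = "\<lambda>\<omega>. of_bool (alive D ?v \<omega>) :: real"
    have alm: "?al \<in> borel_measurable M" by (rule am)
    have i0: "integrable M (\<lambda>\<omega>. (indicator C \<omega> * of_bool (alive D (?g n i) \<omega>) * (?al \<omega> * of_bool (hit \<omega>))) * ?J n i \<omega>)"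
      by (rule b[of _ 1]) (use alm hit_borel in auto)
    have i1: "integrable M (\<lambda>\<omega>. Y \<omega> * (?al \<omega> * of_bool (hit \<omega>)))"
    proof (rule integrable_cong_AE_imp[OF i0])
      show "(\<lambda>\<omega>. Y \<omega> * (?al \<omega> * of_bool (hit \<omega>))) \<in> borel_measurable M"
        by (intro borel_measurable_times F_M[OF Y] alm hit_borel)
      show "AE \<omega> in M. indicator C \<omega> * of_bool (alive D (?g n i) \<omega>) * (?al \<omega> * of_bool (hit \<omega>)) * ?J n i \<omega> =
          Y \<omega> * (?al \<omega> * of_bool (hit \<omega>))"
        using k(2) by eventually_elim (simp add: Y_def mult_ac)
    qed
    note e = hit_expectation_mult[OF g0(1) Y i1]
    have "(\<integral>\<omega>. Y \<omega> * (?al \<omega> * of_bool (hit \<omega>)) - Y \<omega> * (?al \<omega> * h (\<omega> ?v)) \<partial>M) = 0"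
      using e(2) by (subst Bochner_Integration.integral_diff[OF i1 e(1)]) simp
    moreover have ae: "AE \<omega> in M. Y \<omega> * (?al \<omega> * of_bool (hit \<omega>)) - Y \<omega> * (?al \<omega> * h (\<omega> ?v)) =
        indicator C \<omega> * ((of_bool (alive D (?g n i) \<omega>) * ?d n i \<omega>) * ?J n i \<omega>)"
      using k(2) by eventually_elim (simp add: Y_def algebra_simps)
    moreover have m: "(\<lambda>\<omega>. indicator C \<omega> * ((of_bool (alive D (?g n i) \<omega>) * ?d n i \<omega>) * ?J n i \<omega>)) \<in> borel_measurable M"
      by (intro borel_measurable_times borel_measurable_indicator am dm CM) (use Ji in auto)
    ultimately show "(\<integral>\<omega>. indicator C \<omega> * ((of_bool (alive D (?g n i) \<omega>) * ?d n i \<omega>) * ?J n i \<omega>) \<partial>M) = 0"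
      using integral_cong_AE[OF _ m ae] i1 e(1) by auto
    show "integrable M (\<lambda>\<omega>. indicator C \<omega> * ((of_bool (alive D (?g n i) \<omega>) * ?d n i \<omega>) * ?J n i \<omega>))"
      by (rule integrable_cong_AE_imp[OF Bochner_Integration.integrable_diff[OF i1 e(1)] m])
         (use ae in \<open>auto elim: eventually_mono\<close>)
  qed
  have zero: "(\<integral>\<omega>. indicator C \<omega> * ?S n \<omega> \<partial>M) = 0" for n
    unfolding sum_distrib_left
    by (subst Bochner_Integration.integral_sum) (simp_all only: cell cell_int sum.neutral_const)
  have S_eq: "?S n \<omega> = (\<Sum>u\<in>jumps_in \<omega> s t. (of_bool (alive D (grid_below s t n u) \<omega>) *
      (of_bool (alive D (grid_above s t n u) \<omega>) * (of_bool (hit \<omega>) - h (\<omega> (grid_above s t n u))))) * \<phi> (u, left_lim \<omega> u, \<omega> u))"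
    if "pure_jump \<omega>" for n \<omega>
    unfolding jump_sum_def by (rule sum_grid[OF pure_jump_finite[OF that] s(2)])
  have am': "alive_sum D \<phi> s t \<in> borel_measurable M" "alive_sum D (h_test \<phi>) s t \<in> borel_measurable M"
    using alive_sum_measurable[OF \<phi> s D] alive_sum_measurable[OF bounded_h_test[OF \<phi>] s D] .
  have "(\<lambda>n. \<integral>\<omega>. indicator C \<omega> * ?S n \<omega> \<partial>M) \<longlonglongrightarrow>
      (\<integral>\<omega>. indicator C \<omega> * (of_bool (hit \<omega>) * alive_sum D \<phi> s t \<omega>) - indicator C \<omega> * alive_sum D (h_test \<phi>) s t \<omega> \<partial>M)"
  proof (rule integral_dominated_convergence)
    show "integrable M (\<lambda>\<omega>. ((1 + h_sup) * c) * jump_count s t \<omega>)"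
      using jump_sum_integrable[OF bounded_test_1 s] by simp
    show "(\<lambda>\<omega>. indicator C \<omega> * ?S n \<omega>) \<in> borel_measurable M" for n
      unfolding sum_distrib_left using cell_int by (intro borel_measurable_sum) (simp only: borel_measurable_integrable)
    show "(\<lambda>\<omega>. indicator C \<omega> * (of_bool (hit \<omega>) * alive_sum D \<phi> s t \<omega>) - indicator C \<omega> * alive_sum D (h_test \<phi>) s t \<omega>) \<in> borel_measurable M"
      by (intro borel_measurable_diff borel_measurable_times borel_measurable_indicator CM hit_borel am')
    show "AE \<omega> in M. (\<lambda>n. indicator C \<omega> * ?S n \<omega>) \<longlonglongrightarrow>
        indicator C \<omega> * (of_bool (hit \<omega>) * alive_sum D \<phi> s t \<omega>) - indicator C \<omega> * alive_sum D (h_test \<phi>) s t \<omega>"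
      using AE_hit
    proof eventually_elim
      case (elim \<omega>)
      then have w: "pure_jump \<omega>" "hitting_time D \<omega> < \<infinity>" by auto
      have "(\<lambda>n. ?S n \<omega>) \<longlonglongrightarrow> (\<Sum>u\<in>jumps_in \<omega> s t. (of_bool (alive_before D u \<omega>) * (of_bool (hit \<omega>) - h (\<omega> u))) * \<phi> (u, left_lim \<omega> u, \<omega> u))"
        unfolding S_eq[OF w(1)]
      proof (intro tendsto_sum tendsto_mult[OF _ tendsto_const] tendsto_eventually)
        fix u assume "u \<in> jumps_in \<omega> s t"
        then have "s < u" "u \<le> t" by auto
        from cell_limit[OF w s(1) this]
        show "\<forall>\<^sub>F n in sequentially. of_bool (alive D (grid_below s t n u) \<omega>) * (of_bool (alive D (grid_above s t n u) \<omega>) *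
          (of_bool (hit \<omega>) - h (\<omega> (grid_above s t n u)))) = of_bool (alive_before D u \<omega>) * (of_bool (hit \<omega>) - h (\<omega> u))" .
      qed
      also have "(\<Sum>u\<in>jumps_in \<omega> s t. (of_bool (alive_before D u \<omega>) * (of_bool (hit \<omega>) - h (\<omega> u))) * \<phi> (u, left_lim \<omega> u, \<omega> u))
         = of_bool (hit \<omega>) * alive_sum D \<phi> s t \<omega> - alive_sum D (h_test \<phi>) s t \<omega>"
        unfolding alive_sum_def sum_distrib_left sum_subtractf[symmetric]
        by (intro sum.cong refl) (simp add: h_test_def algebra_simps)
      finally have "(\<lambda>n. indicator C \<omega> * ?S n \<omega>) \<longlonglongrightarrow>
         indicator C \<omega> * (of_bool (hit \<omega>) * alive_sum D \<phi> s t \<omega> - alive_sum D (h_test \<phi>) s t \<omega>)"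
        by (rule tendsto_mult[OF tendsto_const])
      then show ?case by (simp only: right_diff_distrib)
    qed
    show "AE \<omega> in M. norm (indicator C \<omega> * ?S n \<omega>) \<le> ((1 + h_sup) * c) * jump_count s t \<omega>" for n
      using AE_good
    proof eventually_elim
      case (elim \<omega>)
      have "\<bar>?S n \<omega>\<bar> \<le> (\<Sum>u\<in>jumps_in \<omega> s t. (1 + h_sup) * c)"
        unfolding S_eq[OF conjunct1[OF conjunct2[OF elim]]]
      proof (rule order_trans[OF sum_abs sum_mono])
        fix u
        have "\<bar>of_bool (alive D (grid_below s t n u) \<omega>) * ?d n (grid_index s t n u) \<omega>\<bar> \<le> 1 + h_sup"
          using dle[of n "grid_index s t n u" \<omega>] h_sup_nonneg by (cases "alive D (grid_below s t n u) \<omega>") auto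
        then show "\<bar>of_bool (alive D (grid_below s t n u) \<omega>) * ?d n (grid_index s t n u) \<omega> * \<phi> (u, left_lim \<omega> u, \<omega> u)\<bar> \<le> (1 + h_sup) * c"
          unfolding abs_mult[of _ "\<phi> _"] using bounded_test_le[OF \<phi>] h_sup_nonneg by (intro mult_mono) auto
      qed
      then show ?case using h_sup_nonneg c0
        by (cases "\<omega> \<in> C") (auto simp: jump_count_eq mult.commute)
    qed
  qed
  then have "(\<integral>\<omega>. indicator C \<omega> * (of_bool (hit \<omega>) * alive_sum D \<phi> s t \<omega>) - indicator C \<omega> * alive_sum D (h_test \<phi>) s t \<omega> \<partial>M) = 0"
    unfolding zero by (simp add: LIMSEQ_const_iff)
  moreover have "integrable M (\<lambda>\<omega>. indicator C \<omega> * alive_sum D (h_test \<phi>) s t \<omega>)"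
    by (rule bm[OF alive_sum_integrable[OF bounded_h_test[OF \<phi>] s D], of _ 1]) (use CM in auto)
  moreover have "integrable M (\<lambda>\<omega>. (indicator C \<omega> * of_bool (hit \<omega>)) * alive_sum D \<phi> s t \<omega>)"
    by (rule bm[OF alive_sum_integrable[OF \<phi> s D], of _ 1])
       (use CM hit_borel in \<open>auto intro!: borel_measurable_times simp: indicator_def\<close>)
  ultimately show ?thesis by (simp add: mult.assoc)
qed

subsection \<open>The transformed rate\<close>

text \<open>Truncated at \<open>0\<close> in agreement with the \<open>ennreal\<close> density of
  \<open>levy_kernel_AB\<close>. When \<open>h z = 0\<close> it is \<open>0\<close> throughout, by
  the convention for division.\<close>

definition h_ratio :: "'a \<Rightarrow> 'a \<Rightarrow> real" where
  "h_ratio z y = max 0 (h y / h z)"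

definition h_rate :: "(real \<times> 'a \<times> 'a \<Rightarrow> real) \<Rightarrow> real \<Rightarrow> 'a \<Rightarrow> real" where
  "h_rate \<phi> u z = (\<integral>y. \<phi> (u, z, y) * h_ratio z y \<partial>L z)"

text \<open>The total jump rate of the transformed kernel at \<open>z\<close>. Without information
  on the sign of \<open>h\<close> it has no uniform bound, but its product with
  \<open>\<bar>h z\<bar>\<close> has one.\<close>

definition h_mass :: "'a \<Rightarrow> real" where
  "h_mass z = (\<integral>y. h_ratio z y \<partial>L z)"

definition h_drift :: "(real \<times> 'a \<times> 'a \<Rightarrow> real) \<Rightarrow> real \<Rightarrow> real \<Rightarrow> (real \<Rightarrow> 'a) \<Rightarrow> real" where
  "h_drift \<phi> s t \<omega> = (LINT u : {s<..t} | lborel.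
     of_bool (alive D (max 0 (min t u)) \<omega>) * h_rate \<phi> u (\<omega> (max 0 (min t u))))"

lemma h_ratio_measurable [measurable]: "(\<lambda>p. h_ratio (fst p) (snd p)) \<in> borel_measurable (borel \<Otimes>\<^sub>M borel)"
  unfolding h_ratio_def by measurable

lemma h_ratio_slice: "h_ratio z \<in> borel_measurable borel"
  unfolding h_ratio_def by measurable

lemma h_ratio_nonneg: "0 \<le> h_ratio z y"
  by (simp add: h_ratio_def)

lemma h_ratio_le: "\<bar>h_ratio z y\<bar> \<le> h_sup / \<bar>h z\<bar>"
proof -
  have "h y / h z \<le> \<bar>h y\<bar> / \<bar>h z\<bar>" using abs_ge_self[of "h y / h z"] by simp
  also have "\<dots> \<le> h_sup / \<bar>h z\<bar>" by (intro divide_right_mono h_le) simp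
  finally show ?thesis using h_sup_nonneg by (simp add: h_ratio_def)
qed

lemma h_times_ratio_le: "\<bar>h z\<bar> * h_ratio z y \<le> h_sup"
proof (cases "h z = 0")
  case False
  have "\<bar>h z\<bar> * h_ratio z y \<le> \<bar>h z\<bar> * (h_sup / \<bar>h z\<bar>)"
    using h_ratio_le[of z y] by (intro mult_left_mono) auto
  then show ?thesis using False by simp
qed (simp add: h_sup_nonneg)

lemma h_mass_bound: "\<bar>h z\<bar> * h_mass z \<le> h_sup * rate_sup L"
proof -
  have "\<bar>h z\<bar> * h_mass z = (\<integral>y. \<bar>h z\<bar> * h_ratio z y \<partial>L z)" unfolding h_mass_def by simp
  also have "\<dots> \<le> \<bar>\<integral>y. \<bar>h z\<bar> * h_ratio z y \<partial>L z\<bar>" by simp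
  also have "\<dots> \<le> h_sup * rate_sup L"
    by (rule integral_L_bound) (use h_times_ratio_le h_ratio_nonneg h_ratio_slice in \<open>auto simp: abs_mult\<close>)
  finally show ?thesis .
qed

lemma h_mass_nonneg: "0 \<le> h_mass z"
  unfolding h_mass_def by (intro integral_nonneg_AE) (simp add: h_ratio_nonneg)

lemma h_mass_measurable [measurable]: "h_mass \<in> borel_measurable borel"
proof -
  have "(\<lambda>z. \<integral>y. h_ratio z y \<partial>L z) \<in> borel_measurable borel"
    by (rule integral_L_measurable)
       (use h_ratio_measurable in \<open>auto simp: case_prod_beta' intro!: integrable_L[OF h_ratio_slice h_ratio_le]\<close>)
  then show ?thesis unfolding h_mass_def .
qed

lemma h_ratio_test:
  assumes \<phi>: "bounded_test \<phi> c"
  shows "integrable (L z) (\<lambda>y. \<phi> (u, z, y) * h_ratio z y)"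
proof (rule integrable_L)
  show "(\<lambda>y. \<phi> (u, z, y) * h_ratio z y) \<in> borel_measurable borel"
    by (intro borel_measurable_times slice_measurable[OF \<phi>] h_ratio_slice)
  show "\<bar>\<phi> (u, z, y) * h_ratio z y\<bar> \<le> c * (h_sup / \<bar>h z\<bar>)" for y
    unfolding abs_mult using bounded_test_le[OF \<phi>] h_ratio_le bounded_test_nonneg[OF \<phi>] by (intro mult_mono) auto
qed

lemma h_rate_measurable:
  assumes \<phi>: "bounded_test \<phi> c"
  shows "(\<lambda>p. h_rate \<phi> (fst p) (snd p)) \<in> borel_measurable (borel \<Otimes>\<^sub>M borel)"
  unfolding h_rate_def
proof (rule integral_L_measurable)
  note [measurable] = bounded_test_measurable[OF assms]
  have "(\<lambda>p. h_ratio (snd (fst p)) (snd p)) \<in> borel_measurable ((borel \<Otimes>\<^sub>M borel) \<Otimes>\<^sub>M borel)"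
    unfolding h_ratio_def by measurable
  then show "(\<lambda>(p, y). \<phi> (fst p, snd p, y) * h_ratio (snd p) y) \<in> borel_measurable ((borel \<Otimes>\<^sub>M borel) \<Otimes>\<^sub>M borel)"
    unfolding case_prod_beta' by measurable
qed (simp_all add: h_ratio_test[OF \<phi>])

lemma h_rate_le:
  assumes \<phi>: "bounded_test \<phi> c" shows "\<bar>h_rate \<phi> u z\<bar> \<le> c * h_mass z"
proof -
  have "\<bar>h_rate \<phi> u z\<bar> \<le> (\<integral>y. \<bar>\<phi> (u, z, y) * h_ratio z y\<bar> \<partial>L z)"
    unfolding h_rate_def by (rule integral_abs_bound)
  also have "\<dots> \<le> (\<integral>y. c * h_ratio z y \<partial>L z)"
  proof (rule integral_mono)
    show "integrable (L z) (\<lambda>y. c * h_ratio z y)"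
      using integrable_L[OF h_ratio_slice h_ratio_le] by simp
    show "\<bar>\<phi> (u, z, y) * h_ratio z y\<bar> \<le> c * h_ratio z y" for y
      unfolding abs_mult using bounded_test_le[OF \<phi>] bounded_test_nonneg[OF \<phi>] h_ratio_nonneg
      by (intro mult_mono) auto
  qed (rule integrable_abs[OF h_ratio_test[OF \<phi>]])
  finally show ?thesis by (simp add: h_mass_def)
qed

text \<open>Off the zeros of \<open>h\<close> the denominator cancels, and nonnegativity at almost
  all targets makes the truncation inactive. At a zero of \<open>h\<close>, harmonicity says that
  \<open>h\<close>, nonnegative almost everywhere, has integral \<open>0\<close> against
  \<open>L z\<close>; so it vanishes almost everywhere and both sides are \<open>0\<close>.\<close>

lemma h_times_h_rate:
  assumes \<phi>: "bounded_test \<phi> c" and z: "z \<notin> D" "0 \<le> h z" and pos: "AE y in L z. 0 \<le> h y"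
  shows "h z * h_rate \<phi> u z = rate (h_test \<phi>) u z"
proof (cases "h z = 0")
  case False
  have "h z * h_rate \<phi> u z = (\<integral>y. h z * (\<phi> (u, z, y) * h_ratio z y) \<partial>L z)"
    unfolding h_rate_def by simp
  also have "\<dots> = rate (h_test \<phi>) u z"
    unfolding rate_def
  proof (rule integral_cong_AE)
    show "(\<lambda>y. h z * (\<phi> (u, z, y) * h_ratio z y)) \<in> borel_measurable (L z)"
      using h_ratio_test[OF \<phi>, of z u] by auto
    show "(\<lambda>y. h_test \<phi> (u, z, y)) \<in> borel_measurable (L z)"
      using slice_measurable[OF bounded_h_test[OF \<phi>], of u z] by simp
    show "AE y in L z. h z * (\<phi> (u, z, y) * h_ratio z y) = h_test \<phi> (u, z, y)"
      using pos
    proof eventually_elim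
      case (elim y)
      then have "h z * h_ratio z y = h y" using False z by (simp add: h_ratio_def)
      then show ?case by (simp add: h_test_def mult.left_commute mult.commute)
    qed
  qed
  finally show ?thesis .
next
  case True
  have i: "integrable (L z) h" by (rule integrable_L[OF h_measurable h_le])
  have "(\<integral>y. h y \<partial>L z) = 0" using h_harmonic[OF z(1)] True by simp
  then have "AE y in L z. h y = 0" using integral_nonneg_eq_0_iff_AE[OF i pos] by simp
  then have "rate (h_test \<phi>) u z = (\<integral>y. 0 \<partial>L z)"
    unfolding rate_def using slice_measurable[OF bounded_h_test[OF \<phi>], of u z]
    by (intro integral_cong_AE) (auto simp: h_test_def elim!: eventually_mono)
  then show ?thesis using True by simp
qed

text \<open>Test the compensator formula with the indicator of \<open>h y < 0\<close>. Almost surely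
  no jump up to the hitting time lands where \<open>h\<close> is negative, so the jump sum vanishes;
  its compensator is nonnegative with mean \<open>0\<close>, hence its rate is zero for almost every
  path and time.\<close>

lemma AE_h_nonneg_after_jump:
  assumes t: "0 \<le> t"
  shows "AE \<omega> in M. AE u in lborel. 0 < u \<and> u \<le> t \<and> alive D u \<omega> \<longrightarrow> (AE y in L (\<omega> u). 0 \<le> h y)"
proof -
  let ?\<phi> = "\<lambda>(u::real, z::'a, y). of_bool (h y < 0) :: real"
  have \<phi>: "bounded_test ?\<phi> 1" unfolding bounded_test_def by (auto simp: case_prod_beta') measurable
  have sp: "cadlag_paths \<in> sets (F 0)" using sets.top[of "F 0"] by (simp add: space_F)
  have "AE \<omega> in M. alive_sum D ?\<phi> 0 t \<omega> = 0"
    using AE_hit AE_h_nonneg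
  proof eventually_elim
    case (elim \<omega>)
    then have w: "pure_jump \<omega>" "hitting_time D \<omega> < \<infinity>" by auto
    obtain T where T: "0 \<le> T" "hitting_time D \<omega> = ereal T" using hitting_fin[OF w] by blast
    have hT: "h (\<omega> T) = of_bool (hit \<omega>)" by (rule h_at_hitting[OF w(1) T(2) w(2)])
    \<comment> \<open>Before the hitting time the sign comes from \<open>AE_h_nonneg\<close>; at the
      hitting time itself it comes from the boundary values.\<close>
    have "0 \<le> h (\<omega> u)" if "0 < u" "alive_before D u \<omega>" for u
    proof (cases "u = T")
      case False
      then have "alive D u \<omega>" using that T by (simp add: alive_before_hitting[OF w(1)] alive_hitting[OF w(1)])
      then show ?thesis using elim(2) that by simp
    qed (simp add: hT)
    then show ?case unfolding alive_sum_def by (intro sum.neutral) (auto simp: not_less)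
  qed
  then have "(\<integral>\<omega>. indicator cadlag_paths \<omega> * alive_sum D ?\<phi> 0 t \<omega> \<partial>M) = (\<integral>\<omega>. 0 \<partial>M)"
    using sets_F_M[OF sp] alive_sum_measurable[OF \<phi> _ t D]
    by (intro integral_cong_AE borel_measurable_times borel_measurable_indicator) (auto elim!: eventually_mono)
  then have z: "(\<integral>\<omega>. indicator cadlag_paths \<omega> * alive_drift D ?\<phi> 0 t \<omega> \<partial>M) = 0"
    using alive_sum_expectation[OF \<phi> _ t D sp] by simp
  have rate0: "0 \<le> rate ?\<phi> u z" for u z unfolding rate_def by (intro integral_nonneg_AE) simp
  have "AE \<omega> in M. alive_drift D ?\<phi> 0 t \<omega> = 0"
  proof -
    have i: "integrable M (\<lambda>\<omega>. indicator cadlag_paths \<omega> * alive_drift D ?\<phi> 0 t \<omega>)"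
      using integrable_mult_indicator[OF sets_F_M[OF sp] alive_drift_integrable[OF \<phi> _ t D]] by simp
    have "0 \<le> alive_drift D ?\<phi> 0 t \<omega>" for \<omega>
      unfolding alive_drift_def set_lebesgue_integral_def
      unfolding real_scaleR_def by (intro integral_nonneg_AE AE_I2 mult_nonneg_nonneg rate0) auto
    then have "AE \<omega> in M. indicator cadlag_paths \<omega> * alive_drift D ?\<phi> 0 t \<omega> = 0"
      using integral_nonneg_eq_0_iff_AE[OF i] z by simp
    then show ?thesis using AE_space by eventually_elim (auto simp: space_R)
  qed
  then show ?thesis using AE_good
  proof eventually_elim
    case (elim \<omega>)
    let ?f = "\<lambda>u. of_bool (alive D (max 0 (min t u)) \<omega>) * rate ?\<phi> u (\<omega> (max 0 (min t u)))"
    have "set_integrable lborel {0<..t} ?f"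
      using rate_bound[OF \<phi>] rate_nonneg elim t
      by (intro set_integral_time_bound(1)[of _ "1 * rate_sup L"] alive_rate_path_measurable[OF \<phi> t D]) auto
    then have "AE u in lborel. indicator {0<..t} u *\<^sub>R ?f u = 0"
      using elim(1) integral_nonneg_eq_0_iff_AE[of lborel "\<lambda>u. indicator {0<..t} u *\<^sub>R ?f u"] rate0
      unfolding alive_drift_def set_lebesgue_integral_def set_integrable_def by (auto simp del: mult_eq_0_iff)
    then show ?case
    proof eventually_elim
      case (elim u)
      show ?case
      proof
        assume u: "0 < u \<and> u \<le> t \<and> alive D u \<omega>"
        with elim have "(\<integral>y. of_bool (h y < 0) \<partial>L (\<omega> u)) = (0::real)" by (simp add: rate_def)
        moreover have "integrable (L (\<omega> u)) (\<lambda>y. of_bool (h y < 0) :: real)"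
          by (rule integrable_L[of _ 1]) auto
        ultimately have "AE y in L (\<omega> u). of_bool (h y < 0) = (0::real)"
          using integral_nonneg_eq_0_iff_AE[of "L (\<omega> u)" "\<lambda>y. of_bool (h y < 0) :: real"] by simp
        then show "AE y in L (\<omega> u). 0 \<le> h y" by eventually_elim (auto simp: not_less)
      qed
    qed
  qed
qed

lemma AE_transformed_rate:
  assumes \<phi>: "bounded_test \<phi> c" and t: "0 \<le> t"
  shows "AE \<omega> in M. AE u in lborel. 0 < u \<and> u \<le> t \<and> alive D u \<omega> \<longrightarrow> h (\<omega> u) * h_rate \<phi> u (\<omega> u) = rate (h_test \<phi>) u (\<omega> u)"
  using AE_h_nonneg_after_jump[OF t] AE_h_nonneg
proof eventually_elim
  case (elim \<omega>)
  from elim(1) show ?case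
  proof eventually_elim
    case (elim u)
    show ?case
    proof
      assume u: "0 < u \<and> u \<le> t \<and> alive D u \<omega>"
      then have "\<omega> u \<notin> D" by (simp add: alive_def)
      then show "h (\<omega> u) * h_rate \<phi> u (\<omega> u) = rate (h_test \<phi>) u (\<omega> u)"
        using h_times_h_rate[OF \<phi>] elim u \<open>\<forall>u\<ge>0. alive D u \<omega> \<longrightarrow> 0 \<le> h (\<omega> u)\<close> by simp
    qed
  qed
qed

section \<open>The drift of the conditioned process\<close>

lemma h_rate_progressive:
  assumes "bounded_test \<phi> c" "0 \<le> t"
  shows "(\<lambda>p. of_bool (alive D (max 0 (min t (fst p))) (snd p)) * h_rate \<phi> (fst p) (snd p (max 0 (min t (fst p)))))
    \<in> borel_measurable (borel \<Otimes>\<^sub>M F t)"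
proof (rule borel_measurable_times)
  show "(\<lambda>p. of_bool (alive D (max 0 (min t (fst p))) (snd p)) :: real) \<in> borel_measurable (borel \<Otimes>\<^sub>M F t)"
    using alive_progressive[OF assms(2) D] by simp
  show "(\<lambda>p. h_rate \<phi> (fst p) (snd p (max 0 (min t (fst p))))) \<in> borel_measurable (borel \<Otimes>\<^sub>M F t)"
    using measurable_compose[OF measurable_Pair[OF measurable_fst coord_progressive[OF assms(2)]] h_rate_measurable[OF assms(1)]]
    by simp
qed

lemma h_mass_progressive:
  assumes "0 \<le> t"
  shows "(\<lambda>p. of_bool (alive D (max 0 (min t (fst p))) (snd p)) * h_mass (snd p (max 0 (min t (fst p)))))
    \<in> borel_measurable (borel \<Otimes>\<^sub>M F t)"
proof (rule borel_measurable_times)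
  show "(\<lambda>p. of_bool (alive D (max 0 (min t (fst p))) (snd p)) :: real) \<in> borel_measurable (borel \<Otimes>\<^sub>M F t)"
    using alive_progressive[OF assms D] by simp
  show "(\<lambda>p. h_mass (snd p (max 0 (min t (fst p))))) \<in> borel_measurable (borel \<Otimes>\<^sub>M F t)"
    by (rule measurable_compose[OF coord_progressive[OF assms] h_mass_measurable])
qed

lemma h_drift_measurable: "bounded_test \<phi> c \<Longrightarrow> 0 \<le> t \<Longrightarrow> h_drift \<phi> s t \<in> borel_measurable (F t)"
  unfolding h_drift_def using time_integral_measurable[OF h_rate_progressive] by simp

text \<open>Passes from progressive measurability to measurability on the product with the completed
  path space, which is where Fubini is applied.\<close>

lemma progressive_M: "f \<in> borel_measurable (borel \<Otimes>\<^sub>M F t) \<Longrightarrow> f \<in> borel_measurable (lborel \<Otimes>\<^sub>M M)"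
proof (rule measurable_from_subalg[of "lborel \<Otimes>\<^sub>M M" "borel \<Otimes>\<^sub>M F t"])
  have "sets (borel \<Otimes>\<^sub>M F t) \<subseteq> sets (lborel \<Otimes>\<^sub>M M)"
    unfolding sets_pair_measure space_F space_completion space_R space_borel space_lborel
    by (intro sigma_sets_mono') (auto intro: sets_F_M)
  then show "subalgebra (lborel \<Otimes>\<^sub>M M) (borel \<Otimes>\<^sub>M F t)"
    by (simp add: subalgebra_def space_pair_measure space_F space_R)
qed

text \<open>Before the hitting time the density at time \<open>u\<close> is \<open>h (X\<^sub>u)\<close>, which cancels the
  possibly small denominator of the transformed rate.\<close>

lemma mass_expectation:
  assumes u: "0 \<le> u"
  shows "(\<integral>\<^sup>+ \<omega>. ennreal (of_bool (hit \<omega>) * (of_bool (alive D u \<omega>) * h_mass (\<omega> u))) \<partial>M) \<le> ennreal (h_sup * rate_sup L)"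
proof -
  interpret fs: finite_measure_subalgebra M "F u" by unfold_locales (rule sub)
  have hm: "(\<lambda>\<omega>. h_mass (\<omega> u)) \<in> borel_measurable (F u)"
    by (rule measurable_compose[OF adapted[OF u] h_mass_measurable])
  \<comment> \<open>\<open>hit_expectation_mult\<close> asks for an integrable product, and
    integrability of the rate is what is being proved. So the rate is cut off at \<open>n\<close>,
    and monotone convergence removes the cut.\<close>
  have trunc: "(\<integral>\<^sup>+ \<omega>. ennreal (min (real n) (h_mass (\<omega> u)) * (of_bool (alive D u \<omega>) * of_bool (hit \<omega>))) \<partial>M) \<le> ennreal (h_sup * rate_sup L)"
    for n :: nat
  proof -
    let ?Y = "\<lambda>\<omega>. min (real n) (h_mass (\<omega> u))"
    have Y: "?Y \<in> borel_measurable (F u)" using hm by measurable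
    have Yb: "0 \<le> ?Y \<omega>" "?Y \<omega> \<le> real n" for \<omega> using h_mass_nonneg by auto
    have i: "integrable M (\<lambda>\<omega>. ?Y \<omega> * (of_bool (alive D u \<omega>) * of_bool (hit \<omega>)))"
    proof (rule integrable_const_bound[of _ "real n"])
      show "(\<lambda>\<omega>. ?Y \<omega> * (of_bool (alive D u \<omega>) * of_bool (hit \<omega>))) \<in> borel_measurable M"
        by (intro borel_measurable_times F_M[OF Y] F_M[OF alive_borel[OF u]] hit_borel)
    qed (use Yb in auto)
    note e = hit_expectation_mult[OF u Y i]
    have "(\<integral>\<^sup>+ \<omega>. ennreal (?Y \<omega> * (of_bool (alive D u \<omega>) * of_bool (hit \<omega>))) \<partial>M)
        = ennreal (\<integral>\<omega>. ?Y \<omega> * (of_bool (alive D u \<omega>) * of_bool (hit \<omega>)) \<partial>M)"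
      using Yb by (intro nn_integral_eq_integral[OF i]) auto
    also have "\<dots> = ennreal (\<integral>\<omega>. ?Y \<omega> * (of_bool (alive D u \<omega>) * h (\<omega> u)) \<partial>M)" by (simp only: e(2))
    also have "\<dots> \<le> ennreal (\<integral>\<omega>. h_sup * rate_sup L \<partial>M)"
    proof (intro ennreal_leI integral_mono[OF e(1)])
      fix \<omega>
      have "?Y \<omega> * h (\<omega> u) \<le> h_mass (\<omega> u) * \<bar>h (\<omega> u)\<bar>"
        using Yb[of \<omega>] h_mass_nonneg by (intro order_trans[OF mult_left_mono[OF abs_ge_self] mult_right_mono]) auto
      also have "\<dots> \<le> h_sup * rate_sup L" using h_mass_bound[of "\<omega> u"] by (simp add: mult.commute)
      finally show "?Y \<omega> * (of_bool (alive D u \<omega>) * h (\<omega> u)) \<le> h_sup * rate_sup L"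
        using h_sup_nonneg rate_nonneg by auto
    qed simp
    also have "\<dots> = ennreal (h_sup * rate_sup L)" using prob_space by simp
    finally show ?thesis .
  qed
  let ?f = "\<lambda>n \<omega>. ennreal (min (real n) (h_mass (\<omega> u)) * (of_bool (alive D u \<omega>) * of_bool (hit \<omega>)))"
  have "(\<integral>\<^sup>+ \<omega>. ennreal (of_bool (hit \<omega>) * (of_bool (alive D u \<omega>) * h_mass (\<omega> u))) \<partial>M) = (\<integral>\<^sup>+ \<omega>. (SUP n. ?f n \<omega>) \<partial>M)"
  proof (rule nn_integral_cong)
    fix \<omega>
    obtain n0 :: nat where n0: "h_mass (\<omega> u) \<le> real n0" using real_arch_simple by blast
    show "ennreal (of_bool (hit \<omega>) * (of_bool (alive D u \<omega>) * h_mass (\<omega> u))) = (SUP n. ?f n \<omega>)"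
    proof (rule antisym)
      have "ennreal (of_bool (hit \<omega>) * (of_bool (alive D u \<omega>) * h_mass (\<omega> u))) = ?f n0 \<omega>"
        using n0 by (simp add: min_absorb2)
      then show "ennreal (of_bool (hit \<omega>) * (of_bool (alive D u \<omega>) * h_mass (\<omega> u))) \<le> (SUP n. ?f n \<omega>)"
        by (simp only:) (rule SUP_upper, simp)
      show "(SUP n. ?f n \<omega>) \<le> ennreal (of_bool (hit \<omega>) * (of_bool (alive D u \<omega>) * h_mass (\<omega> u)))"
        by (intro SUP_least ennreal_leI) auto
    qed
  qed
  also have "\<dots> = (SUP n. \<integral>\<^sup>+ \<omega>. ?f n \<omega> \<partial>M)"
  proof (rule nn_integral_monotone_convergence_SUP)
    show "incseq ?f"
      by (auto simp: incseq_def le_fun_def intro!: ennreal_leI mult_right_mono)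
    show "?f n \<in> borel_measurable M" for n
      using F_M[OF hm] F_M[OF alive_borel[OF u]] hit_borel by measurable
  qed
  also have "\<dots> \<le> ennreal (h_sup * rate_sup L)" by (intro SUP_least trunc)
  finally show ?thesis .
qed

text \<open>Both orders of integration are wanted: with time inside, finiteness yields a finite
  compensator on almost every path that hits \<open>B\<close> first; with paths inside, it yields
  integrability on the product space.\<close>

lemma mass_product:
  assumes t: "0 \<le> t"
  shows "(\<integral>\<^sup>+ \<omega>. (\<integral>\<^sup>+ u. ennreal (indicator {0<..t} u * (of_bool (hit \<omega>) *
      (of_bool (alive D (max 0 (min t u)) \<omega>) * h_mass (\<omega> (max 0 (min t u)))))) \<partial>lborel) \<partial>M) < \<infinity>"
    and "(\<integral>\<^sup>+ u. (\<integral>\<^sup>+ \<omega>. ennreal (indicator {0<..t} u * (of_bool (hit \<omega>) *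
      (of_bool (alive D (max 0 (min t u)) \<omega>) * h_mass (\<omega> (max 0 (min t u)))))) \<partial>M) \<partial>lborel) < \<infinity>"
proof -
  interpret pair_sigma_finite lborel M ..
  let ?f = "\<lambda>u \<omega>. ennreal (indicator {0<..t} u * (of_bool (hit \<omega>) *
      (of_bool (alive D (max 0 (min t u)) \<omega>) * h_mass (\<omega> (max 0 (min t u))))))"
  have m: "(\<lambda>(u, \<omega>). ?f u \<omega>) \<in> borel_measurable (lborel \<Otimes>\<^sub>M M)"
    using progressive_M[OF h_mass_progressive[OF t]] by measurable
  have "(\<integral>\<^sup>+ u. (\<integral>\<^sup>+ \<omega>. ?f u \<omega> \<partial>M) \<partial>lborel) \<le> (\<integral>\<^sup>+ u. ennreal (h_sup * rate_sup L) * indicator {0<..t} u \<partial>lborel)"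
  proof (rule nn_integral_mono)
    fix u
    show "(\<integral>\<^sup>+ \<omega>. ?f u \<omega> \<partial>M) \<le> ennreal (h_sup * rate_sup L) * indicator {0<..t} u"
      using mass_expectation[of u] by (cases "u \<in> {0<..t}") auto
  qed
  also have "\<dots> < \<infinity>" using t by (simp add: nn_integral_cmult_indicator ennreal_mult_less_top)
  finally show *: "(\<integral>\<^sup>+ u. (\<integral>\<^sup>+ \<omega>. ?f u \<omega> \<partial>M) \<partial>lborel) < \<infinity>" .
  have "(\<integral>\<^sup>+ \<omega>. (\<integral>\<^sup>+ u. ?f u \<omega> \<partial>lborel) \<partial>M) = (\<integral>\<^sup>+ u. (\<integral>\<^sup>+ \<omega>. ?f u \<omega> \<partial>M) \<partial>lborel)"
    using Fubini'[OF m] by simp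
  with * show "(\<integral>\<^sup>+ \<omega>. (\<integral>\<^sup>+ u. ?f u \<omega> \<partial>lborel) \<partial>M) < \<infinity>" by simp
qed

text \<open>Fubini isolates a fixed time \<open>u\<close>. Given the past at \<open>u\<close>, the
  factor \<open>hit\<close> becomes \<open>h (\<omega> u)\<close> on survival, and this turns the
  transformed rate into the rate of \<open>h_test \<phi>\<close>. The jump sum leads to the same
  expression, which is why the difference will be a martingale.\<close>

lemma hit_h_drift:
  assumes \<phi>: "bounded_test \<phi> c" and s: "0 \<le> s" "s \<le> t" and C: "C \<in> sets (F s)"
  shows "(\<integral>\<omega>. indicator C \<omega> * (of_bool (hit \<omega>) * h_drift \<phi> s t \<omega>) \<partial>M) =
      (\<integral>\<omega>. indicator C \<omega> * alive_drift D (h_test \<phi>) s t \<omega> \<partial>M)"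
    and "integrable M (\<lambda>\<omega>. indicator C \<omega> * (of_bool (hit \<omega>) * h_drift \<phi> s t \<omega>))"
proof -
  interpret P: pair_sigma_finite lborel M ..
  have t: "0 \<le> t" using s by simp
  have CM: "C \<in> sets M" by (rule sets_F_M[OF C])
  let ?X = "\<lambda>u \<omega>. (\<omega> (max 0 (min t u)) :: 'a)"
  let ?k = "\<lambda>u \<omega>. of_bool (alive D (max 0 (min t u)) \<omega>) * h_rate \<phi> u (?X u \<omega>)"
  let ?f = "\<lambda>u \<omega>. indicator {s<..t} u * (indicator C \<omega> * (of_bool (hit \<omega>) * ?k u \<omega>)) :: real"
  let ?f2 = "\<lambda>u \<omega>. indicator {s<..t} u * (indicator C \<omega> * (h (?X u \<omega>) * ?k u \<omega>)) :: real"
  have km: "(\<lambda>p. ?k (fst p) (snd p)) \<in> borel_measurable (lborel \<Otimes>\<^sub>M M)"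
    by (rule progressive_M[OF h_rate_progressive[OF \<phi> t]])
  have Xm: "(\<lambda>p. h (?X (fst p) (snd p))) \<in> borel_measurable (lborel \<Otimes>\<^sub>M M)"
    by (rule progressive_M[OF measurable_compose[OF coord_progressive[OF t] h_measurable]])
  have fm: "(\<lambda>(u, \<omega>). ?f u \<omega>) \<in> borel_measurable (lborel \<Otimes>\<^sub>M M)"
    using km CM unfolding case_prod_beta' by measurable
  have f2m: "(\<lambda>(u, \<omega>). ?f2 u \<omega>) \<in> borel_measurable (lborel \<Otimes>\<^sub>M M)"
    using km Xm CM unfolding case_prod_beta' by measurable
  have c0: "0 \<le> c" by (rule bounded_test_nonneg[OF \<phi>])
  have fi: "integrable (lborel \<Otimes>\<^sub>M M) (\<lambda>(u, \<omega>). ?f u \<omega>)"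
  proof (rule integrableI_bounded[OF fm])
    let ?g = "\<lambda>u \<omega>. indicator {0<..t} u * (of_bool (hit \<omega>) * (of_bool (alive D (max 0 (min t u)) \<omega>) * h_mass (?X u \<omega>))) :: real"
    have gm: "(\<lambda>(u, \<omega>). ennreal (?g u \<omega>)) \<in> borel_measurable (lborel \<Otimes>\<^sub>M M)"
      using progressive_M[OF h_mass_progressive[OF t]] by measurable
    have le: "\<bar>?f u \<omega>\<bar> \<le> c * ?g u \<omega>" for u \<omega>
    proof -
      have "\<bar>h_rate \<phi> u (?X u \<omega>)\<bar> \<le> c * h_mass (?X u \<omega>)" by (rule h_rate_le[OF \<phi>])
      moreover have "0 \<le> c * h_mass (?X u \<omega>)" using c0 h_mass_nonneg by simp
      ultimately show ?thesis using s by (auto simp: indicator_def abs_mult)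
    qed
    have "(\<integral>\<^sup>+ p. ennreal (norm ((\<lambda>(u, \<omega>). ?f u \<omega>) p)) \<partial>(lborel \<Otimes>\<^sub>M M)) \<le> (\<integral>\<^sup>+ p. ennreal c * (\<lambda>(u, \<omega>). ennreal (?g u \<omega>)) p \<partial>(lborel \<Otimes>\<^sub>M M))"
      using le c0 h_mass_nonneg by (intro nn_integral_mono) (auto simp: ennreal_mult[symmetric] case_prod_beta' intro!: ennreal_leI)
    also have "\<dots> = ennreal c * (\<integral>\<^sup>+ u. (\<integral>\<^sup>+ \<omega>. ennreal (?g u \<omega>) \<partial>M) \<partial>lborel)"
      by (subst nn_integral_cmult[OF gm]) (simp add: nn_integral_fst[OF gm, symmetric])
    also have "\<dots> < \<infinity>" using mass_product(2)[OF t] by (simp add: ennreal_mult_less_top)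
    finally show "(\<integral>\<^sup>+ p. ennreal (norm ((\<lambda>(u, \<omega>). ?f u \<omega>) p)) \<partial>(lborel \<Otimes>\<^sub>M M)) < \<infinity>" .
  qed
  \<comment> \<open>After conditioning, the factor \<open>h\<close> is explicit and
    \<open>h_mass_bound\<close> gives a pointwise bound; before it, the bound was one on an
    integral.\<close>
  have f2i: "integrable (lborel \<Otimes>\<^sub>M M) (\<lambda>(u, \<omega>). ?f2 u \<omega>)"
  proof (rule integrableI_bounded[OF f2m])
    have le: "\<bar>?f2 u \<omega>\<bar> \<le> (h_sup * rate_sup L * c) * indicator {s<..t} u" for u \<omega>
    proof -
      have "\<bar>h z * h_rate \<phi> u z\<bar> \<le> h_sup * rate_sup L * c" for z
      proof -
        have "\<bar>h z * h_rate \<phi> u z\<bar> \<le> \<bar>h z\<bar> * (c * h_mass z)"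
          unfolding abs_mult by (intro mult_left_mono h_rate_le[OF \<phi>]) simp
        also have "\<dots> = (\<bar>h z\<bar> * h_mass z) * c" by simp
        also have "\<dots> \<le> h_sup * rate_sup L * c" by (rule mult_right_mono[OF h_mass_bound c0])
        finally show ?thesis .
      qed
      moreover have "0 \<le> h_sup * rate_sup L * c" using h_sup_nonneg rate_nonneg c0 by simp
      ultimately show ?thesis by (auto simp: indicator_def)
    qed
    have "(\<integral>\<^sup>+ p. ennreal (norm ((\<lambda>(u, \<omega>). ?f2 u \<omega>) p)) \<partial>(lborel \<Otimes>\<^sub>M M)) \<le>
      (\<integral>\<^sup>+ p. ennreal (h_sup * rate_sup L * c) * indicator ({s<..t} \<times> space M) p \<partial>(lborel \<Otimes>\<^sub>M M))"
    proof (rule nn_integral_mono)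
      fix p :: "real \<times> (real \<Rightarrow> 'a)" assume "p \<in> space (lborel \<Otimes>\<^sub>M M)"
      then obtain u \<omega> where p: "p = (u, \<omega>)" "\<omega> \<in> space M" by (auto simp: space_pair_measure)
      have "ennreal \<bar>?f2 u \<omega>\<bar> \<le> ennreal ((h_sup * rate_sup L * c) * indicator {s<..t} u)"
        by (rule ennreal_leI[OF le])
      also have "\<dots> = ennreal (h_sup * rate_sup L * c) * indicator ({s<..t} \<times> space M) p"
        using p by (cases "u \<in> {s<..t}") simp_all
      finally show "ennreal (norm ((\<lambda>(u, \<omega>). ?f2 u \<omega>) p)) \<le> ennreal (h_sup * rate_sup L * c) * indicator ({s<..t} \<times> space M) p"
        unfolding p(1) by (simp only: prod.case real_norm_def)
    qed
    also have "\<dots> = ennreal (h_sup * rate_sup L * c) * emeasure (lborel \<Otimes>\<^sub>M M) ({s<..t} \<times> space M)"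
      by (intro nn_integral_cmult_indicator) simp
    also have "\<dots> < \<infinity>"
      using s emeasure_space_1 by (subst emeasure_pair_measure_Times) (auto simp: ennreal_mult_less_top)
    finally show "(\<integral>\<^sup>+ p. ennreal (norm ((\<lambda>(u, \<omega>). ?f2 u \<omega>) p)) \<partial>(lborel \<Otimes>\<^sub>M M)) < \<infinity>" .
  qed
  have inner: "(\<integral>u. ?f u \<omega> \<partial>lborel) = indicator C \<omega> * (of_bool (hit \<omega>) * h_drift \<phi> s t \<omega>)" for \<omega>
  proof -
    have "(\<integral>u. ?f u \<omega> \<partial>lborel) = (\<integral>u. (indicator C \<omega> * of_bool (hit \<omega>)) * (indicator {s<..t} u * ?k u \<omega>) \<partial>lborel)"
      by (intro Bochner_Integration.integral_cong refl) (simp add: mult_ac)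
    then show ?thesis unfolding h_drift_def set_lebesgue_integral_def by (simp add: mult.assoc)
  qed
  show "integrable M (\<lambda>\<omega>. indicator C \<omega> * (of_bool (hit \<omega>) * h_drift \<phi> s t \<omega>))"
    using P.integrable_snd[OF fi] by (simp add: inner)
  have "(\<integral>\<omega>. indicator C \<omega> * (of_bool (hit \<omega>) * h_drift \<phi> s t \<omega>) \<partial>M) = (\<integral>\<omega>. (\<integral>u. ?f u \<omega> \<partial>lborel) \<partial>M)"
    by (simp add: inner)
  also have "\<dots> = (\<integral>u. (\<integral>\<omega>. ?f u \<omega> \<partial>M) \<partial>lborel)"
    by (rule P.Fubini_integral[OF fi])
  also have "\<dots> = (\<integral>u. (\<integral>\<omega>. ?f2 u \<omega> \<partial>M) \<partial>lborel)"
  proof (rule integral_cong_AE)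
    show "AE u in lborel. (\<integral>\<omega>. ?f u \<omega> \<partial>M) = (\<integral>\<omega>. ?f2 u \<omega> \<partial>M)"
      using P.AE_integrable_fst[OF fi]
    proof eventually_elim
      case (elim u)
      show ?case
      proof (cases "u \<in> {s<..t}")
        case True
        then have u: "0 \<le> u" "s \<le> u" "max 0 (min t u) = u" using s by auto
        let ?Y = "\<lambda>\<omega>. indicator C \<omega> * h_rate \<phi> u (\<omega> u)"
        have Y: "?Y \<in> borel_measurable (F u)"
        proof (intro borel_measurable_times borel_measurable_indicator)
          show "C \<in> sets (F u)" using C sets_F_mono[OF u(2)] by auto
          show "(\<lambda>\<omega>. h_rate \<phi> u (\<omega> u)) \<in> borel_measurable (F u)"
            using measurable_compose[OF measurable_Pair[OF measurable_const adapted[OF u(1)]] h_rate_measurable[OF \<phi>], of u] by simp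
        qed
        have eq: "?f u \<omega> = ?Y \<omega> * (of_bool (alive D u \<omega>) * of_bool (hit \<omega>))"
          "?f2 u \<omega> = ?Y \<omega> * (of_bool (alive D u \<omega>) * h (\<omega> u))" for \<omega>
          using True unfolding u(3) by (simp_all add: mult_ac)
        show ?thesis unfolding eq using elim unfolding eq by (intro hit_expectation_mult(2)[OF u(1) Y])
      qed simp
    qed
  qed (use P.integrable_fst[OF fi] P.integrable_fst[OF f2i] in \<open>auto dest: borel_measurable_integrable\<close>)
  also have "\<dots> = (\<integral>\<omega>. (\<integral>u. ?f2 u \<omega> \<partial>lborel) \<partial>M)"
    by (rule P.Fubini_integral[OF f2i, symmetric])
  also have "\<dots> = (\<integral>\<omega>. indicator C \<omega> * alive_drift D (h_test \<phi>) s t \<omega> \<partial>M)"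
  proof (rule integral_cong_AE)
    show "AE \<omega> in M. (\<integral>u. ?f2 u \<omega> \<partial>lborel) = indicator C \<omega> * alive_drift D (h_test \<phi>) s t \<omega>"
      using AE_transformed_rate[OF \<phi> t] AE_space
    proof eventually_elim
      case (elim \<omega>)
      then have w: "\<omega> \<in> cadlag_paths" by (simp add: space_R)
      have "(\<integral>u. ?f2 u \<omega> \<partial>lborel) = (\<integral>u. indicator C \<omega> * (indicator {s<..t} u * (of_bool (alive D (max 0 (min t u)) \<omega>) * rate (h_test \<phi>) u (?X u \<omega>))) \<partial>lborel)"
      proof (rule integral_cong_AE)
        show "AE u in lborel. ?f2 u \<omega> = indicator C \<omega> * (indicator {s<..t} u * (of_bool (alive D (max 0 (min t u)) \<omega>) * rate (h_test \<phi>) u (?X u \<omega>)))"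
          using elim(1)
        proof eventually_elim
          case (elim u)
          show ?case
          proof (cases "u \<in> {s<..t} \<and> alive D u \<omega>")
            case True
            then have "0 < u" "u \<le> t" "max 0 (min t u) = u" using s by auto
            then show ?thesis using elim True by simp
          next
            case False
            then show ?thesis using s by (auto simp: indicator_def min_absorb2 max_absorb2)
          qed
        qed
        show "(\<lambda>u. ?f2 u \<omega>) \<in> borel_measurable lborel"
          using measurable_compose[OF measurable_Pair2'[of \<omega> M lborel] f2m] w by (simp add: space_R)
        show "(\<lambda>u. indicator C \<omega> * (indicator {s<..t} u * (of_bool (alive D (max 0 (min t u)) \<omega>) * rate (h_test \<phi>) u (?X u \<omega>)))) \<in> borel_measurable lborel"
          using alive_rate_path_measurable[OF bounded_h_test[OF \<phi>] t D w] by simp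
      qed
      then show ?case unfolding alive_drift_def set_lebesgue_integral_def by simp
    qed
    show "(\<lambda>\<omega>. \<integral>u. ?f2 u \<omega> \<partial>lborel) \<in> borel_measurable M"
      using P.integrable_snd[OF f2i] by auto
    show "(\<lambda>\<omega>. indicator C \<omega> * alive_drift D (h_test \<phi>) s t \<omega>) \<in> borel_measurable M"
      using CM by (intro borel_measurable_times borel_measurable_indicator F_M[OF alive_drift_measurable[OF bounded_h_test[OF \<phi>] t D]])
  qed
  finally show "(\<integral>\<omega>. indicator C \<omega> * (of_bool (hit \<omega>) * h_drift \<phi> s t \<omega>) \<partial>M) =
      (\<integral>\<omega>. indicator C \<omega> * alive_drift D (h_test \<phi>) s t \<omega> \<partial>M)" .
qed

end

section \<open>Relative entropy and conditioning on an event\<close>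

lemma log_exp_1: "log (exp 1) (u::real) = ln u"
  by (simp add: log_def)

text \<open>An abstract hard constraint. The penalty \<open>f\<close> is prescribed only almost
  surely, because the hitting value on which it will depend is in general measurable only for the
  completion.\<close>

locale conditioning = prob_space R for R :: "'w measure" +
  fixes E :: "'w set" and f :: "'w \<Rightarrow> ennreal"
  assumes E [measurable]: "E \<in> sets R" and f: "AE \<omega> in R. f \<omega> = (if \<omega> \<in> E then 0 else \<infinity>)"
begin

definition cost :: "'w measure \<Rightarrow> ereal" where
  "cost Q = enn2ereal (\<integral>\<^sup>+ \<omega>. f \<omega> \<partial>completion Q) + relative_entropy Q R"

definition given_E :: "'w measure" where
  "given_E = density R (\<lambda>\<omega>. ennreal (indicator E \<omega> / prob E))"

lemma sets_given_E: "sets given_E = sets R"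
  by (simp add: given_E_def)

text \<open>The Radon-Nikodym derivative agrees with \<open>g\<close> almost everywhere, and where
  \<open>g\<close> vanishes the product with the logarithm is \<open>0\<close>. So both the
  integrability test and the value in \<open>relative_entropy\<close> can be read off
  \<open>g\<close>.\<close>

lemma relative_entropy_density:
  fixes g :: "'w \<Rightarrow> real"
  assumes [measurable]: "g \<in> borel_measurable R" and g: "\<And>\<omega>. 0 \<le> g \<omega>"
  shows "relative_entropy (density R g) R =
    (if integrable R (\<lambda>\<omega>. g \<omega> * ln (g \<omega>)) then ereal (\<integral>\<omega>. g \<omega> * ln (g \<omega>) \<partial>R) else \<infinity>)"
proof -
  let ?Q = "density R (\<lambda>\<omega>. ennreal (g \<omega>))"
  have ac: "absolutely_continuous R ?Q"
    by (rule absolutely_continuousI_density) simp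
  have "AE \<omega> in R. ennreal (g \<omega>) = RN_deriv R ?Q \<omega>" by (rule RN_deriv_unique) auto
  then have ae: "AE \<omega> in R. g \<omega> * entropy_density (exp 1) R ?Q \<omega> = g \<omega> * ln (g \<omega>)"
  proof eventually_elim
    case (elim \<omega>)
    then show ?case using g by (simp add: entropy_density_def log_exp_1 elim[symmetric])
  qed
  have "integrable ?Q (entropy_density (exp 1) R ?Q) \<longleftrightarrow> integrable R (\<lambda>\<omega>. g \<omega> * entropy_density (exp 1) R ?Q \<omega>)"
    using g by (subst integrable_density) auto
  also have "\<dots> \<longleftrightarrow> integrable R (\<lambda>\<omega>. g \<omega> * ln (g \<omega>))"
    using ae by (intro integrable_cong_AE) auto
  finally have i: "integrable ?Q (entropy_density (exp 1) R ?Q) \<longleftrightarrow> integrable R (\<lambda>\<omega>. g \<omega> * ln (g \<omega>))" .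
  have "KL_divergence (exp 1) R ?Q = (\<integral>\<omega>. g \<omega> * ln (g \<omega>) \<partial>R)"
    using KL_density[of "exp 1" g] g by (simp add: log_exp_1)
  then show ?thesis unfolding relative_entropy_def using ac i by simp
qed

lemma real_density_exists:
  assumes Q: "prob_space Q" "sets Q = sets R" and ac: "absolutely_continuous R Q"
  obtains g :: "'w \<Rightarrow> real" where "g \<in> borel_measurable R" "\<And>\<omega>. 0 \<le> g \<omega>" "Q = density R g"
proof -
  interpret Q: prob_space Q by (rule Q(1))
  have "finite_measure Q" by unfold_locales
  from real_RN_deriv[OF this ac Q(2)] obtain g where g: "g \<in> borel_measurable R"
    "AE \<omega> in R. RN_deriv R Q \<omega> = ennreal (g \<omega>)" "\<And>\<omega>. 0 \<le> g \<omega>"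
    by metis
  have "Q = density R (RN_deriv R Q)" by (rule density_RN_deriv[OF ac Q(2), symmetric])
  also have "\<dots> = density R g" using g by (intro density_cong) auto
  finally show ?thesis using that g by blast
qed

lemma nn_integral_f:
  assumes Q: "sets Q = sets R" and ac: "absolutely_continuous R Q"
  shows "(\<integral>\<^sup>+ \<omega>. f \<omega> \<partial>completion Q) = \<infinity> * emeasure Q (space Q - E)"
proof -
  have ae: "AE \<omega> in completion Q. f \<omega> = \<infinity> * indicator (space Q - E) \<omega>"
    using AE_completion[OF absolutely_continuous_AE[OF Q ac f]] AE_space
    by eventually_elim (auto simp: indicator_def)
  have "E \<in> sets Q" using Q E by simp
  then show ?thesis
    by (subst nn_integral_cong_AE[OF ae]) (simp add: nn_integral_completion nn_integral_cmult_indicator)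
qed

text \<open>Finite entropy provides a density, and a finite penalty confines it to \<open>E\<close>.
  The minimisation is thereby reduced to densities that live on \<open>E\<close>.\<close>

lemma cost_cases:
  assumes Q: "prob_space Q" "sets Q = sets R"
  obtains (inf) "cost Q = \<infinity>"
  | (fin) g :: "'w \<Rightarrow> real" where "g \<in> borel_measurable R" "\<And>\<omega>. 0 \<le> g \<omega>" "Q = density R g"
     "AE \<omega> in R. \<omega> \<notin> E \<longrightarrow> g \<omega> = 0" "integrable R (\<lambda>\<omega>. g \<omega> * ln (g \<omega>))"
     "cost Q = ereal (\<integral>\<omega>. g \<omega> * ln (g \<omega>) \<partial>R)"
proof (cases "relative_entropy Q R = \<infinity>")
  case True
  then show ?thesis using inf by (simp add: cost_def)
next
  case False
  then have ac: "absolutely_continuous R Q" by (auto simp: relative_entropy_def split: if_splits)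
  obtain g :: "'w \<Rightarrow> real" where g: "g \<in> borel_measurable R" "\<And>\<omega>. 0 \<le> g \<omega>" "Q = density R g"
    using real_density_exists[OF Q ac] by blast
  note [measurable] = g(1)
  have i: "integrable R (\<lambda>\<omega>. g \<omega> * ln (g \<omega>))" and re: "relative_entropy Q R = ereal (\<integral>\<omega>. g \<omega> * ln (g \<omega>) \<partial>R)"
    using False relative_entropy_density[OF g(1,2)] g(3) by (auto split: if_splits)
  note n = nn_integral_f[OF Q(2) ac]
  show ?thesis
  proof (cases "emeasure Q (space Q - E) = 0")
    case False
    then have "cost Q = \<infinity>" using n re by (simp add: cost_def ennreal_top_mult)
    then show ?thesis by (rule inf)
  next
    case True
    have "(\<integral>\<^sup>+ \<omega>. ennreal (g \<omega>) * indicator (space R - E) \<omega> \<partial>R) = 0"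
      using True unfolding g(3) by (subst (asm) emeasure_density) auto
    then have "AE \<omega> in R. ennreal (g \<omega>) * indicator (space R - E) \<omega> = 0"
      by (subst (asm) nn_integral_0_iff_AE) auto
    then have "AE \<omega> in R. \<omega> \<notin> E \<longrightarrow> g \<omega> = 0"
      using AE_space by eventually_elim (use g(2) in \<open>auto simp: indicator_def ennreal_eq_0_iff intro: antisym\<close>)
    moreover have "cost Q = ereal (\<integral>\<omega>. g \<omega> * ln (g \<omega>) \<partial>R)"
      using True n re by (simp add: cost_def zero_ennreal.rep_eq)
    ultimately show ?thesis using fin g i by blast
  qed
qed

text \<open>A competitor of finite cost would have a density confined to a null set, hence total
  mass \<open>0\<close>.\<close>

lemma cost_infinite:
  assumes "prob E = 0" and Q: "prob_space Q" "sets Q = sets R"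
  shows "cost Q = \<infinity>"
  using Q
proof (cases rule: cost_cases)
  case (fin g)
  have "AE \<omega> in R. \<omega> \<notin> E" using assms(1) E by (subst AE_iff_measurable[of E]) (use sets.sets_into_space[OF E] in \<open>auto simp: emeasure_eq_measure\<close>)
  then have ae: "AE \<omega> in R. g \<omega> = 0" using fin(4) by eventually_elim auto
  interpret Q: prob_space Q by (rule Q(1))
  have "emeasure Q (space Q) = (\<integral>\<^sup>+ \<omega>. ennreal (g \<omega>) * indicator (space R) \<omega> \<partial>R)"
    unfolding fin(3) using fin(1) by (subst emeasure_density) auto
  also have "\<dots> = (\<integral>\<^sup>+ \<omega>. 0 \<partial>R)" by (rule nn_integral_cong_AE) (use ae in \<open>auto elim: eventually_mono\<close>)
  finally show ?thesis using Q.emeasure_space_1 by simp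
qed

context
  assumes pos: "0 < prob E"
begin

lemma prob_given_E: "prob_space given_E"
proof (rule prob_spaceI)
  have "emeasure given_E (space given_E) = (\<integral>\<^sup>+ \<omega>. ennreal (1 / prob E) * indicator E \<omega> \<partial>R)"
    unfolding given_E_def by (subst emeasure_density) (auto intro!: nn_integral_cong simp: indicator_def)
  also have "\<dots> = ennreal (1 / prob E) * ennreal (prob E)"
    by (subst nn_integral_cmult_indicator) (auto simp: emeasure_eq_measure)
  also have "\<dots> = 1" using pos by (simp add: ennreal_mult[symmetric])
  finally show "emeasure given_E (space given_E) = 1" .
qed

text \<open>Entropy relative to \<open>given_E\<close> equals entropy relative to \<open>R\<close>
  plus \<open>ln (prob E)\<close>, because on \<open>E\<close> the density with respect to
  \<open>given_E\<close> is \<open>g * prob E\<close>. Both claims are then nonnegativity of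
  relative entropy and its equality case.\<close>

lemma cost_finite_eq:
  fixes g :: "'w \<Rightarrow> real"
  assumes g [measurable]: "g \<in> borel_measurable R" "\<And>\<omega>. 0 \<le> g \<omega>" and Q: "prob_space (density R g)"
    and E0: "AE \<omega> in R. \<omega> \<notin> E \<longrightarrow> g \<omega> = 0" and i: "integrable R (\<lambda>\<omega>. g \<omega> * ln (g \<omega>))"
  shows "- ln (prob E) \<le> (\<integral>\<omega>. g \<omega> * ln (g \<omega>) \<partial>R)"
    and "(\<integral>\<omega>. g \<omega> * ln (g \<omega>) \<partial>R) = - ln (prob E) \<longleftrightarrow> density R g = given_E"
proof -
  let ?k = "\<lambda>\<omega>. indicator E \<omega> / prob E :: real"
  interpret G: prob_space given_E by (rule prob_given_E)
  interpret G: information_space given_E "exp 1" by unfold_locales simp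
  interpret Q: prob_space "density R g" by (rule Q)
  have k: "?k \<in> borel_measurable R" "AE \<omega> in R. 0 \<le> ?k \<omega>" by auto
  \<comment> \<open>Dividing by \<open>?k\<close> is harmless: off \<open>E\<close>, where
    \<open>?k\<close> is \<open>0\<close>, almost surely \<open>g\<close> vanishes as well.\<close>
  have eq: "density given_E (\<lambda>\<omega>. g \<omega> / ?k \<omega>) = density R g"
    unfolding given_E_def
    by (rule density_density_divide[OF k g(1)]) (use g(2) E0 pos in \<open>auto elim!: eventually_mono simp: indicator_def split: if_splits\<close>)
  have gm: "(\<lambda>\<omega>. g \<omega> / ?k \<omega>) \<in> borel_measurable given_E" unfolding given_E_def by measurable
  have gi: "integrable R g"
  proof (rule integrableI_nonneg)
    have "(\<integral>\<^sup>+ \<omega>. ennreal (g \<omega>) \<partial>R) = emeasure (density R g) (space (density R g))"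
      by (simp add: emeasure_density cong: nn_integral_cong)
    then show "(\<integral>\<^sup>+ \<omega>. ennreal (g \<omega>) \<partial>R) < \<infinity>" using Q.emeasure_space_1 by simp
  qed (use g(2) in auto)
  have g1: "(\<integral>\<omega>. g \<omega> \<partial>R) = 1"
  proof -
    have "ennreal (\<integral>\<omega>. g \<omega> \<partial>R) = (\<integral>\<^sup>+ \<omega>. ennreal (g \<omega>) \<partial>R)"
      using g(2) by (intro nn_integral_eq_integral[symmetric] gi) auto
    also have "\<dots> = emeasure (density R g) (space (density R g))"
      by (simp add: emeasure_density cong: nn_integral_cong)
    also have "\<dots> = 1" by (rule Q.emeasure_space_1)
    finally show ?thesis by simp
  qed
  have ae: "AE \<omega> in R. ?k \<omega> * ((g \<omega> / ?k \<omega>) * log (exp 1) (g \<omega> / ?k \<omega>)) = g \<omega> * ln (g \<omega>) + ln (prob E) * g \<omega>"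
    using E0
  proof eventually_elim
    case (elim \<omega>)
    show ?case
    proof (cases "\<omega> \<in> E \<and> g \<omega> \<noteq> 0")
      case True
      then have "0 < g \<omega>" using g(2)[of \<omega>] by simp
      then have "ln (g \<omega> / ?k \<omega>) = ln (g \<omega>) + ln (prob E)" using True pos by (simp add: ln_mult)
      then show ?thesis using True pos unfolding log_exp_1 by (simp add: algebra_simps)
    qed (use elim in auto)
  qed
  have int: "integrable R (\<lambda>\<omega>. g \<omega> * ln (g \<omega>) + ln (prob E) * g \<omega>)" using i gi by simp
  have int': "integrable R (\<lambda>\<omega>. ?k \<omega> * ((g \<omega> / ?k \<omega>) * log (exp 1) (g \<omega> / ?k \<omega>)))"
    using ae by (intro integrable_cong_AE_imp[OF int]) (auto elim: eventually_mono)
  have intG: "integrable given_E (\<lambda>\<omega>. (g \<omega> / ?k \<omega>) * log (exp 1) (g \<omega> / ?k \<omega>))"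
    unfolding given_E_def using int' by (subst integrable_density) auto
  have nn: "AE \<omega> in given_E. 0 \<le> g \<omega> / ?k \<omega>" using g(2) by auto
  have "KL_divergence (exp 1) given_E (density R g) = (\<integral>\<omega>. (g \<omega> / ?k \<omega>) * log (exp 1) (g \<omega> / ?k \<omega>) \<partial>given_E)"
    unfolding eq[symmetric] by (rule G.KL_density[OF _ gm nn]) simp
  also have "\<dots> = (\<integral>\<omega>. ?k \<omega> * ((g \<omega> / ?k \<omega>) * log (exp 1) (g \<omega> / ?k \<omega>)) \<partial>R)"
    unfolding given_E_def by (subst integral_density) auto
  also have "\<dots> = (\<integral>\<omega>. g \<omega> * ln (g \<omega>) + ln (prob E) * g \<omega> \<partial>R)"
    by (rule integral_cong_AE[OF _ _ ae]) measurable
  also have "\<dots> = (\<integral>\<omega>. g \<omega> * ln (g \<omega>) \<partial>R) + ln (prob E)"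
    using i gi g1 by simp
  finally have KL: "KL_divergence (exp 1) given_E (density R g) = (\<integral>\<omega>. g \<omega> * ln (g \<omega>) \<partial>R) + ln (prob E)" .
  have Q': "prob_space (density given_E (\<lambda>\<omega>. g \<omega> / ?k \<omega>))" unfolding eq by (rule Q)
  show "- ln (prob E) \<le> (\<integral>\<omega>. g \<omega> * ln (g \<omega>) \<partial>R)"
    using G.KL_nonneg[OF Q' gm nn intG] unfolding eq KL by simp
  show "(\<integral>\<omega>. g \<omega> * ln (g \<omega>) \<partial>R) = - ln (prob E) \<longleftrightarrow> density R g = given_E"
    using G.KL_eq_0_iff_eq[OF Q' gm nn intG] unfolding eq KL by auto
qed

lemma cost_ge:
  assumes Q: "prob_space Q" "sets Q = sets R"
  shows "ereal (- ln (prob E)) \<le> cost Q"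
  using Q
proof (cases rule: cost_cases)
  case (fin g)
  then show ?thesis using cost_finite_eq(1)[of g] Q by simp
qed simp

text \<open>\<open>given_E\<close> is itself given by a density confined to \<open>E\<close>, so the
  equality case of \<open>cost_finite_eq\<close> computes its entropy.\<close>

lemma cost_given_E: "cost given_E = ereal (- ln (prob E))"
proof -
  let ?k = "\<lambda>\<omega>. indicator E \<omega> / prob E :: real"
  have k: "?k \<in> borel_measurable R" "\<And>\<omega>. 0 \<le> ?k \<omega>" by auto
  have i: "integrable R (\<lambda>\<omega>. ?k \<omega> * ln (?k \<omega>))"
    by (rule integrable_const_bound[of _ "\<bar>1 / prob E * ln (1 / prob E)\<bar>"]) (auto simp: indicator_def)
  have ac: "absolutely_continuous R given_E"
    unfolding given_E_def by (rule absolutely_continuousI_density) simp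
  have "emeasure given_E (space given_E - E) = (\<integral>\<^sup>+ \<omega>. 0 \<partial>R)"
    unfolding given_E_def by (subst emeasure_density, simp, simp, rule nn_integral_cong, simp add: indicator_def)
  then have "(\<integral>\<^sup>+ \<omega>. f \<omega> \<partial>completion given_E) = 0"
    using nn_integral_f[OF sets_given_E ac] by simp
  moreover have "relative_entropy given_E R = ereal (\<integral>\<omega>. ?k \<omega> * ln (?k \<omega>) \<partial>R)"
    unfolding given_E_def using relative_entropy_density[OF k] i by simp
  moreover have "(\<integral>\<omega>. ?k \<omega> * ln (?k \<omega>) \<partial>R) = - ln (prob E)"
    using cost_finite_eq(2)[OF k _ _ i] prob_given_E unfolding given_E_def[symmetric] by simp
  ultimately show ?thesis by (simp add: cost_def zero_ennreal.rep_eq)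
qed

lemma cost_minimal_iff:
  assumes Q: "prob_space Q" "sets Q = sets R"
  shows "cost Q = ereal (- ln (prob E)) \<longleftrightarrow> Q = given_E"
proof
  assume c: "cost Q = ereal (- ln (prob E))"
  from Q show "Q = given_E"
  proof (cases rule: cost_cases)
    case (fin g)
    then show ?thesis using c cost_finite_eq(2)[of g] Q by simp
  qed (use c in simp)
qed (simp add: cost_given_E)

end

end

section \<open>Augmentation of a filtration\<close>

text \<open>The usual augmentation by the null sets of \<open>N\<close>. It is called for because
  the original filtration is tied to the reference law, while the hitting event, the kernel and the
  compensated sums agree with adapted versions only almost surely under the conditioned law.\<close>

definition augment :: "'w measure \<Rightarrow> 'w measure \<Rightarrow> 'w measure" where
  "augment N G = sigma (space N) {C \<in> sets N. \<exists>C'\<in>sets G. AE \<omega> in N. \<omega> \<in> C \<longleftrightarrow> \<omega> \<in> C'}"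

lemma space_augment: "space (augment N G) = space N"
  unfolding augment_def by (rule space_measure_of) (auto dest: sets.sets_into_space)

lemma sets_augment:
  assumes "space G = space N"
  shows "sets (augment N G) = {C \<in> sets N. \<exists>C'\<in>sets G. AE \<omega> in N. \<omega> \<in> C \<longleftrightarrow> \<omega> \<in> C'}" (is "_ = ?S")
  unfolding augment_def
proof (rule sigma_algebra.sets_measure_of_eq)
  show "sigma_algebra (space N) ?S"
    unfolding sigma_algebra_iff2
  proof (intro conjI ballI allI impI)
    show "?S \<subseteq> Pow (space N)" by (auto dest: sets.sets_into_space)
    show "{} \<in> ?S" by auto
    fix C assume "C \<in> ?S"
    then obtain C' where C: "C \<in> sets N" "C' \<in> sets G" "AE \<omega> in N. \<omega> \<in> C \<longleftrightarrow> \<omega> \<in> C'" by auto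
    have "space G - C' \<in> sets G" using C by auto
    moreover have "AE \<omega> in N. \<omega> \<in> space N - C \<longleftrightarrow> \<omega> \<in> space G - C'"
      using C(3) by eventually_elim (auto simp: assms)
    ultimately show "space N - C \<in> ?S" using sets.compl_sets[OF C(1)] by blast
  next
    fix Cs :: "nat \<Rightarrow> _" assume "range Cs \<subseteq> ?S"
    then have "\<forall>i. \<exists>C'. Cs i \<in> sets N \<and> C' \<in> sets G \<and> (AE \<omega> in N. \<omega> \<in> Cs i \<longleftrightarrow> \<omega> \<in> C')" by (auto simp: subset_eq)
    then obtain C' where C: "\<And>i. Cs i \<in> sets N" "\<And>i. C' i \<in> sets G" "\<And>i. AE \<omega> in N. \<omega> \<in> Cs i \<longleftrightarrow> \<omega> \<in> C' i"
      by metis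
    have "AE \<omega> in N. \<forall>i. \<omega> \<in> Cs i \<longleftrightarrow> \<omega> \<in> C' i" using C(3) by (simp add: AE_all_countable)
    then have "AE \<omega> in N. \<omega> \<in> (\<Union>i. Cs i) \<longleftrightarrow> \<omega> \<in> (\<Union>i. C' i)" by eventually_elim auto
    moreover have "(\<Union>i. C' i) \<in> sets G" "(\<Union>i. Cs i) \<in> sets N" using C by auto
    ultimately show "(\<Union>i. Cs i) \<in> ?S" by blast
  qed
qed

lemma subalgebra_augment: "space G = space N \<Longrightarrow> subalgebra N (augment N G)"
  by (auto simp: subalgebra_def space_augment sets_augment)

lemma sets_augment_mono: "space G = space N \<Longrightarrow> space G' = space N \<Longrightarrow> sets G \<subseteq> sets G' \<Longrightarrow>
    sets (augment N G) \<subseteq> sets (augment N G')"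
  by (auto simp: sets_augment)

text \<open>A function with an adapted version is itself adapted after augmentation, which ends the
  bookkeeping with versions.\<close>

lemma augment_measurable:
  assumes sp: "space G = space (completion N)" and G: "sets G \<subseteq> sets (completion N)"
    and f: "f \<in> G \<rightarrow>\<^sub>M K" and ae: "AE \<omega> in completion N. f \<omega> = g \<omega>"
    and g: "\<And>\<omega>. \<omega> \<in> space N \<Longrightarrow> g \<omega> \<in> space K"
  shows "g \<in> augment (completion N) G \<rightarrow>\<^sub>M K"
proof (rule measurableI)
  show "g \<omega> \<in> space K" if "\<omega> \<in> space (augment (completion N) G)" for \<omega>
    using g that by (simp add: space_augment)
  have fN: "f \<in> completion N \<rightarrow>\<^sub>M K"
    by (rule measurable_from_subalg[OF _ f]) (use sp G in \<open>simp add: subalgebra_def\<close>)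
  fix C assume C: "C \<in> sets K"
  have "g -` C \<inter> space (completion N) \<in> sets (completion N)"
    using measurable_sets[OF completion_measurable_AE[OF fN ae g] C] .
  moreover have "f -` C \<inter> space G \<in> sets G" using measurable_sets[OF f C] .
  moreover have "AE \<omega> in completion N. \<omega> \<in> g -` C \<inter> space (completion N) \<longleftrightarrow> \<omega> \<in> f -` C \<inter> space G"
    using ae by eventually_elim (auto simp: sp)
  ultimately show "g -` C \<inter> space (augment (completion N) G) \<in> sets (augment (completion N) G)"
    unfolding sets_augment[OF sp] space_augment by blast
qed

text \<open>A set in all later augmented sigma-algebras has representatives at times decreasing to
  \<open>t\<close>. Their limit superior depends on late representatives only, so it lies in every
  later \<open>F s\<close>, and right-continuity of \<open>F\<close> puts it into
  \<open>F t\<close>.\<close>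

lemma right_continuous_augment:
  fixes F :: "real \<Rightarrow> 'w measure"
  assumes sp: "\<And>t. space (F t) = space N" and mono: "\<And>s t. s \<le> t \<Longrightarrow> sets (F s) \<subseteq> sets (F t)"
    and rc: "\<And>t. 0 \<le> t \<Longrightarrow> sets (F t) = (\<Inter>s\<in>{t<..}. sets (F s))"
  shows "right_continuous_filtration N (\<lambda>t. augment N (F t))"
  unfolding right_continuous_filtration_def
proof (intro conjI allI impI)
  show "filtration (space N) (\<lambda>t. augment N (F t))"
    by unfold_locales (auto simp: space_augment intro: sets_augment_mono[OF sp sp mono, THEN subsetD])
  show "subalgebra N (augment N (F t))" for t by (rule subalgebra_augment[OF sp])
  fix t :: real assume t: "0 \<le> t"
  show "sets (augment N (F t)) = (\<Inter>s\<in>{t<..}. sets (augment N (F s)))"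
  proof (intro equalityI subsetI)
    fix C assume C: "C \<in> sets (augment N (F t))"
    show "C \<in> (\<Inter>s\<in>{t<..}. sets (augment N (F s)))"
    proof
      fix s assume "s \<in> {t<..}"
      then have "sets (augment N (F t)) \<subseteq> sets (augment N (F s))"
        by (intro sets_augment_mono sp mono) simp
      with C show "C \<in> sets (augment N (F s))" by blast
    qed
  next
    fix C assume C: "C \<in> (\<Inter>s\<in>{t<..}. sets (augment N (F s)))"
    define v where "v n = t + inverse (real (Suc n))" for n
    have v: "t < v n" for n unfolding v_def by simp
    have CN: "C \<in> sets N" and "\<forall>n. \<exists>C'. C' \<in> sets (F (v n)) \<and> (AE \<omega> in N. \<omega> \<in> C \<longleftrightarrow> \<omega> \<in> C')"
      using C v unfolding sets_augment[OF sp] by blast+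
    then obtain C' where C': "\<And>n. C' n \<in> sets (F (v n))" "\<And>n. AE \<omega> in N. \<omega> \<in> C \<longleftrightarrow> \<omega> \<in> C' n" by metis
    have v_dec: "v n \<le> v m" if "m \<le> n" for m n
      unfolding v_def using that by (intro add_left_mono le_imp_inverse_le) auto
    define S where "S = (\<Inter>m. \<Union>n\<in>{m..}. C' n)"
    have "S \<in> sets (F s)" if s: "t < s" for s
    proof -
      obtain m0 where "inverse (real (Suc m0)) < s - t" using reals_Archimedean[of "s - t"] s by auto
      then have m0: "v m0 \<le> s" unfolding v_def by simp
      have "C' n \<in> sets (F s)" if "m0 \<le> n" for n
        using C'(1)[of n] mono[OF order_trans[OF v_dec[OF that] m0]] by blast
      then have "(\<Inter>m\<in>{m0..}. \<Union>n\<in>{m..}. C' n) \<in> sets (F s)"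
        by (intro sets.countable_INT'' sets.countable_INT' sets.countable_UN') auto
      moreover have "S = (\<Inter>m\<in>{m0..}. \<Union>n\<in>{m..}. C' n)"
      proof (intro equalityI subsetI)
        fix \<omega> assume *: "\<omega> \<in> (\<Inter>m\<in>{m0..}. \<Union>n\<in>{m..}. C' n)"
        show "\<omega> \<in> S" unfolding S_def
        proof
          fix m :: nat
          from * have "\<omega> \<in> (\<Union>n\<in>{max m m0..}. C' n)" by auto
          then show "\<omega> \<in> (\<Union>n\<in>{m..}. C' n)" by auto
        qed
      qed (auto simp: S_def)
      ultimately show ?thesis by simp
    qed
    then have "S \<in> sets (F t)" using rc[OF t] by simp
    moreover have "AE \<omega> in N. \<forall>n. \<omega> \<in> C \<longleftrightarrow> \<omega> \<in> C' n" using C'(2) by (simp add: AE_all_countable)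
    then have "AE \<omega> in N. \<omega> \<in> C \<longleftrightarrow> \<omega> \<in> S" by eventually_elim (auto simp: S_def)
    ultimately show "C \<in> sets (augment N (F t))" unfolding sets_augment[OF sp] using CN by blast
  qed
qed

section \<open>The conditioned process\<close>

text \<open>\<open>exp_ext\<close> is infinite where \<open>D\<close> is never hit, so a finite
  exponential moment forces that event to be null. The event is written with rational times in order
  to be measurable for \<open>N\<close> itself.\<close>

lemma exp_ext_finite:
  fixes N :: "(real \<Rightarrow> 'a::polish_space) measure"
  assumes pure: "AE \<omega> in N. pure_jump \<omega>" and X: "\<And>u. 0 \<le> u \<Longrightarrow> (\<lambda>\<omega>. \<omega> u) \<in> N \<rightarrow>\<^sub>M borel" and D: "D \<in> sets borel"
    and fin: "(\<integral>\<^sup>+ \<omega>. exp_ext (hitting_time D \<omega>) \<partial>completion N) < \<infinity>"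
  shows "AE \<omega> in N. hitting_time D \<omega> < \<infinity>"
proof -
  have "Measurable.pred N (\<lambda>\<omega>. 0 \<le> q \<longrightarrow> \<omega> q \<notin> D)" for q :: real
  proof (cases "0 \<le> q")
    case True
    have "Measurable.pred borel (\<lambda>y. y \<notin> D)" using D by measurable
    from measurable_compose[OF X[OF True] this] show ?thesis using True by simp
  qed simp
  then have p: "Measurable.pred N (\<lambda>\<omega>. \<forall>q\<in>\<rat>. 0 \<le> q \<longrightarrow> \<omega> q \<notin> D)" by (rule pred_all_rat)
  define V where "V = {\<omega> \<in> space N. \<forall>q\<in>\<rat>. 0 \<le> q \<longrightarrow> \<omega> q \<notin> D}"
  have V: "V \<in> sets N" unfolding V_def using p by (simp add: pred_def)
  have iff: "\<omega> \<in> V \<longleftrightarrow> hitting_time D \<omega> = \<infinity>" if "\<omega> \<in> space N" "pure_jump \<omega>" for \<omega>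
  proof -
    have "(\<forall>q\<in>\<rat>. 0 \<le> q \<longrightarrow> \<omega> q \<notin> D) \<longleftrightarrow> (\<forall>u. alive_before D u \<omega>)"
      unfolding alive_before_def by (meson gt_ex)
    also have "\<dots> \<longleftrightarrow> hitting_time D \<omega> = \<infinity>"
      unfolding alive_before_hitting[OF that(2)] by (metis ereal_less_eq(1) ereal_top)
    finally show ?thesis using that(1) by (simp add: V_def)
  qed
  have "(\<integral>\<^sup>+ \<omega>. \<infinity> * indicator V \<omega> \<partial>completion N) \<le> (\<integral>\<^sup>+ \<omega>. exp_ext (hitting_time D \<omega>) \<partial>completion N)"
  proof (rule nn_integral_mono_AE)
    show "AE \<omega> in completion N. \<infinity> * indicator V \<omega> \<le> exp_ext (hitting_time D \<omega>)"
      using AE_completion[OF pure] AE_space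
      by eventually_elim (auto simp: indicator_def iff exp_ext_def)
  qed
  also note fin
  finally have "\<infinity> * emeasure N V < \<infinity>"
    using V by (subst (asm) nn_integral_cmult_indicator) auto
  then have "emeasure N V = 0" by (cases "emeasure N V = 0") (auto simp: ennreal_top_mult)
  then have "AE \<omega> in N. \<omega> \<notin> V" using V by (intro AE_not_in) (simp add: null_sets_def)
  then show ?thesis using pure AE_space by eventually_elim (auto simp: iff less_top)
qed

locale conditioned_process = hitting_problem L R F x A B h
  for L :: "'a::polish_space \<Rightarrow> 'a measure" and R F x A B h +
  assumes h_pos: "h x \<noteq> 0"
begin

abbreviation "\<tau> \<equiv> hitting_time D"

abbreviation "X_hit \<equiv> stopped_value \<tau>"

definition P :: "(real \<Rightarrow> 'a) measure" where "P = P_AB A B h x R"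

text \<open>Almost surely equal to \<open>h (X_hit \<omega>) / h x\<close> by the boundary values,
  but measurable for \<open>R\<close> without completion.\<close>

definition weight :: "(real \<Rightarrow> 'a) \<Rightarrow> real" where "weight \<omega> = of_bool (hit \<omega>) / h x"

lemma hx: "0 < h x"
  using h_start_nonneg h_pos by simp

lemma weight_nonneg: "0 \<le> weight \<omega>"
  using hx by (simp add: weight_def)

lemma weight_R [measurable]: "weight \<in> borel_measurable R"
  unfolding weight_def using hit_R by measurable

lemma weight_M [measurable]: "weight \<in> borel_measurable M"
  by (rule measurable_completion[OF weight_R])

lemma AE_X_hit: "AE \<omega> in M. X_hit \<omega> \<in> D \<and> (X_hit \<omega> \<in> B \<longleftrightarrow> hit \<omega>) \<and> h (X_hit \<omega>) = of_bool (hit \<omega>)"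
  using AE_hit
proof eventually_elim
  case (elim \<omega>)
  then have w: "pure_jump \<omega>" "\<tau> \<omega> < \<infinity>" by auto
  obtain T where T: "\<tau> \<omega> = ereal T" "\<omega> T \<in> D" "hit \<omega> \<longleftrightarrow> \<omega> T \<in> B" using hitting_fin[OF w] by blast
  then show ?case using h_at_hitting[OF w(1) T(1) w(2)] by (simp add: stopped_value_def)
qed

text \<open>With a density measurable for \<open>R\<close>, completing and then restricting to the
  path space cancel out. In this form \<open>P\<close> is visibly \<open>R\<close> conditioned on
  \<open>hit\<close>.\<close>

lemma P_eq: "P = density R (\<lambda>\<omega>. ennreal (weight \<omega>))"
proof -
  let ?g = "\<lambda>\<omega>. ennreal (h (X_hit \<omega>) / h x)"
  have ae: "AE \<omega> in M. ennreal (weight \<omega>) = ?g \<omega>"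
    using AE_X_hit by eventually_elim (simp add: weight_def)
  have m: "(\<lambda>\<omega>. ennreal (weight \<omega>)) \<in> borel_measurable M" by measurable
  have gm: "?g \<in> borel_measurable M"
    by (rule completion_measurable_AE[OF m ae]) simp
  have d: "density M ?g = density M (\<lambda>\<omega>. ennreal (weight \<omega>))"
    using ae by (intro density_cong gm m) (auto elim: eventually_mono)
  have sa: "subalgebra (density M (\<lambda>\<omega>. ennreal (weight \<omega>))) path_space"
    using sets_R by (auto simp: subalgebra_def space_R space_path_space)
  show ?thesis unfolding P_def P_AB_def d
  proof (rule measure_eqI)
    show "sets (restr_to_subalg (density M (\<lambda>\<omega>. ennreal (weight \<omega>))) path_space) = sets (density R (\<lambda>\<omega>. ennreal (weight \<omega>)))"
      by (simp add: sets_restr_to_subalg[OF sa] sets_R)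
    fix C assume "C \<in> sets (restr_to_subalg (density M (\<lambda>\<omega>. ennreal (weight \<omega>))) path_space)"
    then have C: "C \<in> sets path_space" by (simp add: sets_restr_to_subalg[OF sa])
    then have CR: "C \<in> sets R" by (simp add: sets_R)
    have "emeasure (restr_to_subalg (density M (\<lambda>\<omega>. ennreal (weight \<omega>))) path_space) C = (\<integral>\<^sup>+ \<omega>. ennreal (weight \<omega>) * indicator C \<omega> \<partial>M)"
      using CR by (simp add: emeasure_restr_to_subalg[OF sa C] emeasure_density)
    also have "\<dots> = (\<integral>\<^sup>+ \<omega>. ennreal (weight \<omega>) * indicator C \<omega> \<partial>R)" by (rule nn_integral_completion)
    also have "\<dots> = emeasure (density R (\<lambda>\<omega>. ennreal (weight \<omega>))) C"
      using CR by (simp add: emeasure_density)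
    finally show "emeasure (restr_to_subalg (density M (\<lambda>\<omega>. ennreal (weight \<omega>))) path_space) C = emeasure (density R (\<lambda>\<omega>. ennreal (weight \<omega>))) C" .
  qed
qed

lemma sets_P: "sets P = sets R" and space_P: "space P = cadlag_paths"
  by (simp_all add: P_eq space_R)

lemma prob_P: "prob_space P"
proof (rule prob_spaceI)
  have "emeasure P (space P) = (\<integral>\<^sup>+ \<omega>. ennreal (1 / h x) * indicator {\<omega> \<in> space R. hit \<omega>} \<omega> \<partial>R)"
    unfolding P_eq
    by (subst emeasure_density, simp, simp, rule nn_integral_cong, simp add: indicator_def weight_def)
  also have "\<dots> = ennreal (1 / h x) * emeasure R {\<omega> \<in> space R. hit \<omega>}"
    by (rule nn_integral_cmult_indicator[OF hit_event_R])
  also have "emeasure R {\<omega> \<in> space R. hit \<omega>} = ennreal (h x)"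
    using prob_R hit_probability_R by (simp add: finite_measure.emeasure_eq_measure prob_space_def)
  also have "ennreal (1 / h x) * ennreal (h x) = 1" using hx by (simp add: ennreal_mult[symmetric])
  finally show "emeasure P (space P) = 1" .
qed

lemma P_paths: "P \<in> path_measures"
  using prob_P sets_P sets_R by (simp add: path_measures_def space_prob_algebra)

abbreviation "MP \<equiv> completion P"

text \<open>The density vanishes off \<open>hit\<close>, so null sets of \<open>R\<close> and paths
  that do not reach \<open>B\<close> first may both be ignored under \<open>P\<close>.\<close>

lemma AE_P: assumes "AE \<omega> in M. hit \<omega> \<longrightarrow> Q \<omega>" shows "AE \<omega> in MP. Q \<omega>"
proof -
  have "AE \<omega> in R. hit \<omega> \<longrightarrow> Q \<omega>" using assms by (simp add: AE_completion_iff)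
  then have "AE \<omega> in R. 0 < ennreal (weight \<omega>) \<longrightarrow> Q \<omega>"
    by eventually_elim (simp add: weight_def)
  then have "AE \<omega> in P. Q \<omega>"
    unfolding P_eq by (subst AE_density) simp_all
  then show ?thesis by (rule AE_completion)
qed

lemma sets_M_MP: "sets M \<subseteq> sets MP"
proof
  fix C assume "C \<in> sets M"
  then obtain S V V' where C: "C = S \<union> V" "V \<subseteq> V'" "V' \<in> null_sets R" "S \<in> sets R" by (auto elim: sets_completionE)
  have "absolutely_continuous R P" unfolding P_eq by (rule absolutely_continuousI_density) measurable
  then have "V' \<in> null_sets P" using C(3) by (auto simp: absolutely_continuous_def)
  then show "C \<in> sets MP" using C sets_P by (intro sets_completionI[of _ S V V']) auto
qed

lemma M_MP: "f \<in> M \<rightarrow>\<^sub>M K \<Longrightarrow> f \<in> MP \<rightarrow>\<^sub>M K"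
  by (rule measurable_from_subalg[of MP M]) (use sets_M_MP in \<open>auto simp: subalgebra_def space_P space_R\<close>)

text \<open>The function is measurable for the completion of \<open>R\<close>, possibly not for
  \<open>R\<close>, so the change of density is carried out on a version and transferred
  back.\<close>

lemma
  fixes f :: "(real \<Rightarrow> 'a) \<Rightarrow> real"
  assumes f: "f \<in> borel_measurable M"
  shows integrable_MP: "integrable MP f \<longleftrightarrow> integrable M (\<lambda>\<omega>. weight \<omega> * f \<omega>)"
    and integral_MP: "(\<integral>\<omega>. f \<omega> \<partial>MP) = (\<integral>\<omega>. weight \<omega> * f \<omega> \<partial>M)"
proof -
  obtain g where g: "g \<in> borel_measurable R" "AE \<omega> in R. f \<omega> = g \<omega>"
    using completion_ex_borel_measurable_real[OF f] by blast
  have gP: "g \<in> borel_measurable P" using g(1) measurable_cong_sets[OF sets_P refl] by blast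
  have aeM: "AE \<omega> in M. f \<omega> = g \<omega>" by (rule AE_completion[OF g(2)])
  have aeP: "AE \<omega> in MP. f \<omega> = g \<omega>" by (rule AE_P) (use aeM in \<open>auto elim: eventually_mono\<close>)
  have fP: "f \<in> borel_measurable MP" by (rule M_MP[OF f])
  have gP': "g \<in> borel_measurable MP" by (rule measurable_completion[OF gP])
  have wg: "(\<lambda>\<omega>. weight \<omega> * g \<omega>) \<in> borel_measurable R" using g(1) by measurable
  have wM: "(\<lambda>\<omega>. weight \<omega> * f \<omega>) \<in> borel_measurable M" "(\<lambda>\<omega>. weight \<omega> * g \<omega>) \<in> borel_measurable M"
    using f measurable_completion[OF wg] by measurable
  have ae: "AE \<omega> in M. weight \<omega> * f \<omega> = weight \<omega> * g \<omega>" using aeM by eventually_elim simp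
  have "integrable MP f \<longleftrightarrow> integrable MP g" by (rule integrable_cong_AE[OF fP gP' aeP])
  also have "\<dots> \<longleftrightarrow> integrable P g" by (rule integrable_completion[OF gP])
  also have "\<dots> \<longleftrightarrow> integrable R (\<lambda>\<omega>. weight \<omega> * g \<omega>)"
    unfolding P_eq using weight_nonneg g(1) by (subst integrable_density) auto
  also have "\<dots> \<longleftrightarrow> integrable M (\<lambda>\<omega>. weight \<omega> * g \<omega>)" by (rule integrable_completion[OF wg, symmetric])
  also have "\<dots> \<longleftrightarrow> integrable M (\<lambda>\<omega>. weight \<omega> * f \<omega>)" by (rule integrable_cong_AE[OF wM ae, symmetric])
  finally show "integrable MP f \<longleftrightarrow> integrable M (\<lambda>\<omega>. weight \<omega> * f \<omega>)" .
  have "(\<integral>\<omega>. f \<omega> \<partial>MP) = (\<integral>\<omega>. g \<omega> \<partial>MP)" by (rule integral_cong_AE[OF fP gP' aeP])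
  also have "\<dots> = (\<integral>\<omega>. g \<omega> \<partial>P)" by (rule integral_completion[OF gP])
  also have "\<dots> = (\<integral>\<omega>. weight \<omega> * g \<omega> \<partial>R)"
    unfolding P_eq using weight_nonneg g(1) by (subst integral_density) auto
  also have "\<dots> = (\<integral>\<omega>. weight \<omega> * g \<omega> \<partial>M)" by (rule integral_completion[OF wg, symmetric])
  also have "\<dots> = (\<integral>\<omega>. weight \<omega> * f \<omega> \<partial>M)" by (rule integral_cong_AE[OF wM ae, symmetric])
  finally show "(\<integral>\<omega>. f \<omega> \<partial>MP) = (\<integral>\<omega>. weight \<omega> * f \<omega> \<partial>M)" .
qed

subsection \<open>Disintegration\<close>

text \<open>\<open>hits_in\<close> provides a measurable version of each preimage, and the
  completion absorbs the difference.\<close>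

lemma X_hit_measurable: "X_hit \<in> M \<rightarrow>\<^sub>M borel"
proof (rule measurableI)
  fix C :: "'a set" assume C: "C \<in> sets borel"
  have "Measurable.pred M (hits_in D C)" by (rule hits_in_measurable[OF coord_M D C])
  then have m: "{\<omega> \<in> space M. hits_in D C \<omega>} \<in> sets M" by (simp add: pred_def)
  show "X_hit -` C \<inter> space M \<in> sets M"
  proof (rule completion.in_sets_AE[OF _ m])
    show "AE \<omega> in M. \<omega> \<in> {\<omega> \<in> space M. hits_in D C \<omega>} \<longleftrightarrow> \<omega> \<in> X_hit -` C \<inter> space M"
      using AE_hit by eventually_elim (auto simp: hits_in_iff)
  qed simp
qed simp

text \<open>Almost surely the density depends on the path through \<open>X_hit\<close> only. So it
  is enough to know the image under \<open>X_hit\<close> of \<open>R\<close> restricted to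
  \<open>C\<close>, and by the defining property of conditional measures this image has density
  \<open>emeasure (K \<eta>) C\<close>.\<close>

lemma disintegration:
  assumes K: "conditional_measures R X_hit K" and C: "C \<in> sets path_space"
  shows "emeasure P C = (\<integral>\<^sup>+ \<eta>. emeasure (K \<eta>) C * ennreal (h \<eta> / h x) \<partial>law_of R X_hit)"
proof -
  have Km: "K \<in> borel \<rightarrow>\<^sub>M prob_algebra path_space"
    and Ke: "\<And>V. V \<in> sets borel \<Longrightarrow> emeasure M {\<omega> \<in> C. X_hit \<omega> \<in> V} = (\<integral>\<^sup>+ \<eta>\<in>V. emeasure (K \<eta>) C \<partial>law_of R X_hit)"
    using K C by (auto simp: conditional_measures_def)
  have CR: "C \<in> sets R" using C by (simp add: sets_R)
  have [measurable]: "(\<lambda>\<eta>. emeasure (K \<eta>) C) \<in> borel_measurable borel"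
    using measurable_emeasure_kernel[OF measurable_prob_algebraD[OF Km] C] .
  note [measurable] = X_hit_measurable
  have law: "sets (law_of R X_hit) = sets borel" "law_of R X_hit = distr M borel X_hit" by (simp_all add: law_of_def)
  note [measurable_cong] = law(1)
  have eq: "distr (density M (indicator C)) borel X_hit = density (law_of R X_hit) (\<lambda>\<eta>. emeasure (K \<eta>) C)"
  proof (rule measure_eqI)
    fix V assume "V \<in> sets (distr (density M (indicator C)) borel X_hit)"
    then have V: "V \<in> sets borel" by simp
    have "emeasure (distr (density M (indicator C)) borel X_hit) V = emeasure (density M (indicator C)) (X_hit -` V \<inter> space M)"
      using V by (subst emeasure_distr) auto
    also have "\<dots> = (\<integral>\<^sup>+ \<omega>. indicator C \<omega> * indicator (X_hit -` V \<inter> space M) \<omega> \<partial>M)"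
      using borel_measurable_indicator[OF sets_completionI_sets[OF CR]] measurable_sets[OF X_hit_measurable V]
      by (intro emeasure_density)
    also have "\<dots> = (\<integral>\<^sup>+ \<omega>. indicator (C \<inter> (X_hit -` V \<inter> space M)) \<omega> \<partial>M)"
      by (intro nn_integral_cong) (auto simp: indicator_def)
    also have "\<dots> = emeasure M (C \<inter> (X_hit -` V \<inter> space M))"
      by (rule nn_integral_indicator[OF sets.Int[OF sets_completionI_sets[OF CR] measurable_sets[OF X_hit_measurable V]]])
    also have "C \<inter> (X_hit -` V \<inter> space M) = {\<omega> \<in> C. X_hit \<omega> \<in> V}"
      using sets.sets_into_space[OF CR] by auto
    also have "emeasure M \<dots> = emeasure (density (law_of R X_hit) (\<lambda>\<eta>. emeasure (K \<eta>) C)) V"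
      using V law by (subst Ke) (auto simp: emeasure_density)
    finally show "emeasure (distr (density M (indicator C)) borel X_hit) V = emeasure (density (law_of R X_hit) (\<lambda>\<eta>. emeasure (K \<eta>) C)) V" .
  qed (simp add: law)
  have "emeasure P C = (\<integral>\<^sup>+ \<omega>. ennreal (weight \<omega>) * indicator C \<omega> \<partial>R)"
    unfolding P_eq using CR by (simp add: emeasure_density)
  also have "\<dots> = (\<integral>\<^sup>+ \<omega>. ennreal (weight \<omega>) * indicator C \<omega> \<partial>M)" by (simp add: nn_integral_completion)
  also have "\<dots> = (\<integral>\<^sup>+ \<omega>. indicator C \<omega> * ennreal (h (X_hit \<omega>) / h x) \<partial>M)"
    by (rule nn_integral_cong_AE, use AE_X_hit in eventually_elim) (simp add: weight_def mult.commute)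
  also have "\<dots> = (\<integral>\<^sup>+ \<omega>. ennreal (h (X_hit \<omega>) / h x) \<partial>density M (indicator C))"
    using borel_measurable_indicator[OF sets_completionI_sets[OF CR]] by (subst nn_integral_density) auto
  also have "\<dots> = (\<integral>\<^sup>+ \<eta>. ennreal (h \<eta> / h x) \<partial>distr (density M (indicator C)) borel X_hit)"
    by (subst nn_integral_distr) auto
  also have "\<dots> = (\<integral>\<^sup>+ \<eta>. emeasure (K \<eta>) C * ennreal (h \<eta> / h x) \<partial>law_of R X_hit)"
    unfolding eq by (rule nn_integral_density) measurable
  finally show ?thesis .
qed

subsection \<open>The martingale problem\<close>

abbreviation "G t \<equiv> augment MP (F t)"

lemma space_F_MP: "space (F t) = space MP"
  by (simp add: space_F space_P)

lemma F_sub_MP: "sets (F t) \<subseteq> sets MP"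
  using sets_F_M sets_M_MP by blast

lemma G_measurable:
  "f \<in> F t \<rightarrow>\<^sub>M K \<Longrightarrow> AE \<omega> in MP. f \<omega> = g \<omega> \<Longrightarrow> (\<And>\<omega>. \<omega> \<in> space P \<Longrightarrow> g \<omega> \<in> space K) \<Longrightarrow> g \<in> G t \<rightarrow>\<^sub>M K"
  by (rule augment_measurable[OF space_F_MP F_sub_MP])

lemma right_continuous_G: "right_continuous_filtration MP (\<lambda>t. G t)"
  by (rule right_continuous_augment[OF space_F_MP sets_F_mono]) (use F in \<open>auto simp: right_continuous_filtration_def\<close>)

lemma AE_good_P: "AE \<omega> in MP. \<omega> \<in> cadlag_paths \<and> pure_jump \<omega> \<and> \<omega> 0 = x"
  by (rule AE_P) (use AE_good in \<open>auto elim: eventually_mono\<close>)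

lemma adapted_G: "0 \<le> t \<Longrightarrow> (\<lambda>\<omega>. \<omega> t) \<in> G t \<rightarrow>\<^sub>M borel"
  by (rule G_measurable[OF adapted]) auto

lemma hitting_event_G:
  assumes t: "0 \<le> t" shows "{\<omega> \<in> space P. \<tau> \<omega> \<le> ereal t} \<in> sets (G t)"
proof -
  have "Measurable.pred (F t) (\<lambda>\<omega>. \<not> alive D t \<omega>)"
    using alive_measurable[OF t coord_F D] by simp
  then have "Measurable.pred (G t) (\<lambda>\<omega>. \<tau> \<omega> \<le> ereal t)"
  proof (rule G_measurable)
    show "AE \<omega> in MP. (\<not> alive D t \<omega>) = (\<tau> \<omega> \<le> ereal t)"
      using AE_good_P by eventually_elim (use t in \<open>auto simp: alive_hitting not_less\<close>)
  qed simp
  then show ?thesis by (simp add: pred_def space_augment)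
qed

text \<open>On a pure jump path the kernel of a rectangle is a time integral of a progressively
  measurable integrand, with survival in place of the indicator of times before
  \<open>\<tau>\<close>. The remaining paths form a null set, which the augmentation covers.\<close>

lemma kernel_predictable_G: "kernel_predictable (levy_kernel_AB L A B h) (\<lambda>t. G t)"
  unfolding kernel_predictable_def
proof (intro allI impI, elim conjE)
  fix t s :: real and C :: "'a set" assume s: "0 \<le> s" "s \<le> t" and C: "C \<in> sets borel"
  let ?X = "\<lambda>p. snd p (max 0 (min s (fst p))) :: 'a"
  let ?in = "\<lambda>z. \<integral>\<^sup>+ y. indicator C y * ennreal (h y / h z) \<partial>L z"
  let ?f = "\<lambda>p. of_bool (alive D (max 0 (min s (fst p))) (snd p)) * ?in (?X p) * indicator {0<..s} (fst p)"
  note [measurable] = C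
  have in_m: "?in \<in> borel_measurable borel"
    by (rule nn_integral_L_measurable) measurable
  have "(\<lambda>p. of_bool (alive D (max 0 (min s (fst p))) (snd p)) :: ennreal) \<in> borel_measurable (borel \<Otimes>\<^sub>M F s)"
    using alive_progressive[OF s(1) D] by measurable
  moreover have "(\<lambda>p. ?in (?X p)) \<in> borel_measurable (borel \<Otimes>\<^sub>M F s)"
    by (rule measurable_compose[OF coord_progressive[OF s(1)] in_m])
  ultimately have "?f \<in> borel_measurable (borel \<Otimes>\<^sub>M F s)"
    by measurable
  from swap_measurable[OF this]
  have "(\<lambda>\<omega>. \<integral>\<^sup>+ u. ?f (u, \<omega>) \<partial>lborel) \<in> borel_measurable (F s)"
    by (rule lborel.borel_measurable_nn_integral)
  from F_mono[OF this s(2)]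
  show "(\<lambda>\<omega>. emeasure (levy_kernel_AB L A B h \<omega>) ({0<..s} \<times> C)) \<in> borel_measurable (G t)"
  proof (rule G_measurable)
    show "AE \<omega> in MP. (\<integral>\<^sup>+ u. ?f (u, \<omega>) \<partial>lborel) = emeasure (levy_kernel_AB L A B h \<omega>) ({0<..s} \<times> C)"
      using AE_good_P
    proof eventually_elim
      case (elim \<omega>)
      then have w: "\<omega> \<in> cadlag_paths" "pure_jump \<omega>" by auto
      show ?case unfolding emeasure_levy_AB[OF w h_measurable C]
      proof (rule nn_integral_cong)
        fix u
        show "?f (u, \<omega>) = (\<integral>\<^sup>+ y. indicator {s. ereal s < \<tau> \<omega>} u * (indicator C y * ennreal (h y / h (\<omega> (max 0 u)))) \<partial>L (\<omega> (max 0 u))) * indicator {0<..s} u"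
        proof (cases "u \<in> {0<..s}")
          case True
          then have "max 0 (min s u) = u" "max 0 u = u" by auto
          then show ?thesis using True alive_hitting[OF w(2), of u D] by (cases "alive D u \<omega>") auto
        qed simp
      qed
    qed
  qed simp
qed

lemma h_mass_nn: "(\<integral>\<^sup>+ y. ennreal (h_ratio z y) \<partial>L z) = ennreal (h_mass z)"
  unfolding h_mass_def
  by (rule nn_integral_eq_integral[OF integrable_L[OF h_ratio_slice h_ratio_le]]) (simp add: h_ratio_nonneg)

text \<open>Weighted with \<open>hit\<close>, the total rate up to \<open>t\<close> has finite mean,
  so it is finite for almost every path with \<open>hit\<close>; these are the only paths that
  \<open>P\<close> charges. This meets the finiteness hypothesis of
  \<open>levy_AB_set_integral\<close>.\<close>

lemma AE_mass_finite:
  assumes t: "0 \<le> t"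
  shows "AE \<omega> in MP. (\<integral>\<^sup>+ u. ennreal (indicator {0<..t} u *
      (of_bool (alive D (max 0 (min t u)) \<omega>) * h_mass (\<omega> (max 0 (min t u))))) \<partial>lborel) < \<infinity>"
proof (rule AE_P)
  let ?g = "\<lambda>u \<omega>. ennreal (indicator {0<..t} u * (of_bool (hit \<omega>) *
      (of_bool (alive D (max 0 (min t u)) \<omega>) * h_mass (\<omega> (max 0 (min t u))))))"
  have "(\<lambda>(u, \<omega>). ?g u \<omega>) \<in> borel_measurable (lborel \<Otimes>\<^sub>M M)"
    using progressive_M[OF h_mass_progressive[OF t]] by measurable
  then have "(\<lambda>(\<omega>, u). ?g u \<omega>) \<in> borel_measurable (M \<Otimes>\<^sub>M lborel)"
    by (subst (asm) measurable_pair_swap_iff) simp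
  then have "(\<lambda>\<omega>. \<integral>\<^sup>+ u. ?g u \<omega> \<partial>lborel) \<in> borel_measurable M"
    by (rule lborel.borel_measurable_nn_integral)
  then have "AE \<omega> in M. (\<integral>\<^sup>+ u. ?g u \<omega> \<partial>lborel) \<noteq> \<infinity>"
    using mass_product(1)[OF t] by (intro nn_integral_PInf_AE) auto
  then show "AE \<omega> in M. hit \<omega> \<longrightarrow> (\<integral>\<^sup>+ u. ennreal (indicator {0<..t} u *
      (of_bool (alive D (max 0 (min t u)) \<omega>) * h_mass (\<omega> (max 0 (min t u))))) \<partial>lborel) < \<infinity>"
    by eventually_elim (auto simp: less_top)
qed

definition compensated :: "(real \<times> 'a \<times> 'a \<Rightarrow> real) \<Rightarrow> real \<Rightarrow> real \<Rightarrow> (real \<Rightarrow> 'a) \<Rightarrow> real" where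
  "compensated \<phi> s t \<omega> = alive_sum D \<phi> s t \<omega> - h_drift \<phi> s t \<omega>"

lemma AE_compensated_AB:
  assumes \<phi>: "bounded_test \<phi> c" and t: "0 \<le> t"
  shows "AE \<omega> in MP. compensated_jumps \<tau> (levy_kernel_AB L A B h) \<phi> t \<omega> = compensated \<phi> 0 t \<omega>"
  using AE_good_P AE_mass_finite[OF t]
proof eventually_elim
  case (elim \<omega>)
  then have w: "\<omega> \<in> cadlag_paths" "pure_jump \<omega>" by auto
  have J: "{s \<in> jump_times \<omega>. s \<le> t \<and> ereal s \<le> \<tau> \<omega>} = {u \<in> jumps_in \<omega> 0 t. alive_before D u \<omega>}"
    using jump_times_pos by (auto simp: alive_before_hitting[OF w(2)])
  have S: "(\<Sum>s\<in>{s \<in> jump_times \<omega>. s \<le> t \<and> ereal s \<le> \<tau> \<omega>}. \<phi> (s, left_lim \<omega> s, \<omega> s)) = alive_sum D \<phi> 0 t \<omega>"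
    unfolding J alive_sum_def sum.inter_filter[OF pure_jump_finite[OF w(2)]] by (intro sum.cong) auto
  let ?i = "\<lambda>u. indicator {s. ereal s < \<tau> \<omega>} u"
  have al: "alive D u \<omega> \<longleftrightarrow> ereal u < \<tau> \<omega>" if "u \<in> {0<..t}" for u
    using that alive_hitting[OF w(2), of u D] by simp
  have c0: "0 \<le> c" by (rule bounded_test_nonneg[OF \<phi>])
  have "(LINT (u, y) : {0<..t} \<times> UNIV | levy_kernel_AB L A B h \<omega>. \<phi> (u, left_lim \<omega> u, y)) =
     (LINT u : {0<..t} | lborel. ?i u * (\<integral>y. \<phi> (u, \<omega> (max 0 u), y) * max 0 (h y / h (\<omega> (max 0 u))) \<partial>L (\<omega> (max 0 u))))"
  proof (rule levy_AB_set_integral[OF w h_measurable bounded_test_measurable[OF \<phi>]])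
    have "(\<integral>\<^sup>+ u\<in>{0<..t}. (\<integral>\<^sup>+ y. ?i u * ennreal (\<bar>\<phi> (u, \<omega> (max 0 u), y)\<bar> * max 0 (h y / h (\<omega> (max 0 u)))) \<partial>L (\<omega> (max 0 u))) \<partial>lborel)
      \<le> (\<integral>\<^sup>+ u. ennreal c * ennreal (indicator {0<..t} u *
      (of_bool (alive D (max 0 (min t u)) \<omega>) * h_mass (\<omega> (max 0 (min t u))))) \<partial>lborel)"
    proof (rule nn_integral_mono)
      fix u
      show "(\<integral>\<^sup>+ y. ?i u * ennreal (\<bar>\<phi> (u, \<omega> (max 0 u), y)\<bar> * max 0 (h y / h (\<omega> (max 0 u)))) \<partial>L (\<omega> (max 0 u))) * indicator {0<..t} u
        \<le> ennreal c * ennreal (indicator {0<..t} u * (of_bool (alive D (max 0 (min t u)) \<omega>) * h_mass (\<omega> (max 0 (min t u)))))"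
      proof (cases "u \<in> {0<..t} \<and> alive D u \<omega>")
        case True
        then have u: "max 0 (min t u) = u" "max 0 u = u" by auto
        have "(\<integral>\<^sup>+ y. ennreal (\<bar>\<phi> (u, \<omega> u, y)\<bar> * h_ratio (\<omega> u) y) \<partial>L (\<omega> u)) \<le> (\<integral>\<^sup>+ y. ennreal c * ennreal (h_ratio (\<omega> u) y) \<partial>L (\<omega> u))"
          using bounded_test_le[OF \<phi>] c0 h_ratio_nonneg
          by (intro nn_integral_mono) (auto simp: ennreal_mult[symmetric] intro!: ennreal_leI mult_right_mono)
        also have "\<dots> = ennreal c * ennreal (h_mass (\<omega> u))"
          using h_ratio_slice by (simp add: nn_integral_cmult h_mass_nn)
        finally show ?thesis using True alive_hitting[OF w(2), of u D] unfolding u h_ratio_def by auto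
      next
        case False
        then show ?thesis using al[of u] by (cases "u \<in> {0<..t}") auto
      qed
    qed
    also have "\<dots> = ennreal c * (\<integral>\<^sup>+ u. ennreal (indicator {0<..t} u *
      (of_bool (alive D (max 0 (min t u)) \<omega>) * h_mass (\<omega> (max 0 (min t u))))) \<partial>lborel)"
    proof (rule nn_integral_cmult)
      have "(\<lambda>u. of_bool (alive D (max 0 (min t u)) \<omega>) * h_mass (\<omega> (max 0 (min t u)))) \<in> borel_measurable borel"
        using measurable_compose[OF measurable_Pair2'[of \<omega> "F t" borel] h_mass_progressive[OF t]] w(1) by (simp add: space_F)
      then show "(\<lambda>u. ennreal (indicator {0<..t} u *
        (of_bool (alive D (max 0 (min t u)) \<omega>) * h_mass (\<omega> (max 0 (min t u)))))) \<in> borel_measurable lborel" by measurable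
    qed
    also have "\<dots> < \<infinity>" using elim(2) by (simp add: ennreal_mult_less_top)
    finally show "(\<integral>\<^sup>+ u\<in>{0<..t}. (\<integral>\<^sup>+ y. ?i u * ennreal (\<bar>\<phi> (u, \<omega> (max 0 u), y)\<bar> * max 0 (h y / h (\<omega> (max 0 u)))) \<partial>L (\<omega> (max 0 u))) \<partial>lborel) < \<infinity>" .
  qed
  also have "\<dots> = h_drift \<phi> 0 t \<omega>"
    unfolding h_drift_def
  proof (rule set_lebesgue_integral_cong)
    show "\<forall>u. u \<in> {0<..t} \<longrightarrow> ?i u * (\<integral>y. \<phi> (u, \<omega> (max 0 u), y) * max 0 (h y / h (\<omega> (max 0 u))) \<partial>L (\<omega> (max 0 u))) =
      of_bool (alive D (max 0 (min t u)) \<omega>) * h_rate \<phi> u (\<omega> (max 0 (min t u)))"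
      using al by (auto simp: h_rate_def h_ratio_def indicator_def)
  qed simp
  finally show ?case unfolding compensated_jumps_def S compensated_def by simp
qed

text \<open>No bound on the transformed drift is at hand, so its additivity over adjacent intervals
  comes from the almost sure finiteness of the total rate.\<close>

lemma AE_compensated_diff:
  assumes \<phi>: "bounded_test \<phi> c" and s: "0 \<le> s" "s \<le> t"
  shows "AE \<omega> in MP. compensated \<phi> 0 t \<omega> = compensated \<phi> 0 s \<omega> + compensated \<phi> s t \<omega>"
proof -
  have t: "0 \<le> t" using s by simp
  show ?thesis
    using AE_good_P AE_mass_finite[OF t]
  proof eventually_elim
    case (elim \<omega>)
    then have w: "\<omega> \<in> cadlag_paths" "pure_jump \<omega>" by auto
    have J: "jumps_in \<omega> 0 t = jumps_in \<omega> 0 s \<union> jumps_in \<omega> s t" "jumps_in \<omega> 0 s \<inter> jumps_in \<omega> s t = {}" using s by auto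
    then have 1: "alive_sum D \<phi> 0 t \<omega> = alive_sum D \<phi> 0 s \<omega> + alive_sum D \<phi> s t \<omega>"
      unfolding alive_sum_def J(1) by (intro sum.union_disjoint pure_jump_finite[OF w(2)])
    let ?k = "\<lambda>u. of_bool (alive D (max 0 (min t u)) \<omega>) * h_rate \<phi> u (\<omega> (max 0 (min t u)))"
    let ?m = "\<lambda>u. of_bool (alive D (max 0 (min t u)) \<omega>) * h_mass (\<omega> (max 0 (min t u)))"
    have km: "?k \<in> borel_measurable borel"
      using measurable_compose[OF measurable_Pair2'[of \<omega> "F t" borel] h_rate_progressive[OF \<phi> t]] w(1) by (simp add: space_F)
    have mm: "?m \<in> borel_measurable borel"
      using measurable_compose[OF measurable_Pair2'[of \<omega> "F t" borel] h_mass_progressive[OF t]] w(1) by (simp add: space_F)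
    have mi: "integrable lborel (\<lambda>u. indicator {0<..t} u * ?m u)"
    proof (rule integrableI_nonneg)
      show "(\<lambda>u. indicator {0<..t} u * ?m u) \<in> borel_measurable lborel" using mm by measurable
      show "AE u in lborel. 0 \<le> indicator {0<..t} u * ?m u" using h_mass_nonneg by (intro AE_I2) auto
      show "(\<integral>\<^sup>+ u. ennreal (indicator {0<..t} u * ?m u) \<partial>lborel) < \<infinity>" by (rule elim(2))
    qed
    have ki: "set_integrable lborel {0<..t} ?k"
      unfolding set_integrable_def
    proof (rule Bochner_Integration.integrable_bound)
      show "integrable lborel (\<lambda>u. c * (indicator {0<..t} u * ?m u))" using mi by simp
      show "(\<lambda>u. indicator {0<..t} u *\<^sub>R ?k u) \<in> borel_measurable lborel" using km by measurable
      show "AE u in lborel. norm (indicator {0<..t} u *\<^sub>R ?k u) \<le> norm (c * (indicator {0<..t} u * ?m u))"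
      proof (rule AE_I2)
        fix u
        have "\<bar>h_rate \<phi> u (\<omega> (max 0 (min t u)))\<bar> \<le> c * h_mass (\<omega> (max 0 (min t u)))" by (rule h_rate_le[OF \<phi>])
        then show "norm (indicator {0<..t} u *\<^sub>R ?k u) \<le> norm (c * (indicator {0<..t} u * ?m u))"
          by (auto simp: indicator_def)
      qed
    qed
    have i1: "set_integrable lborel {0<..s} ?k" "set_integrable lborel {s<..t} ?k"
      using s by (auto intro: set_integrable_subset[OF ki])
    have un: "{0<..t} = {0<..s} \<union> {s<..t}" using s by auto
    have "h_drift \<phi> 0 t \<omega> = (LINT u : {0<..s} | lborel. ?k u) + (LINT u : {s<..t} | lborel. ?k u)"
      unfolding h_drift_def un by (rule set_integral_Un[OF _ i1]) auto
    also have "(LINT u : {0<..s} | lborel. ?k u) = h_drift \<phi> 0 s \<omega>"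
      unfolding h_drift_def using s by (intro set_lebesgue_integral_cong) auto
    finally have "h_drift \<phi> 0 t \<omega> = h_drift \<phi> 0 s \<omega> + h_drift \<phi> s t \<omega>" by (simp add: h_drift_def)
    with 1 show ?case by (simp add: compensated_def)
  qed
qed

lemma compensated_measurable: "bounded_test \<phi> c \<Longrightarrow> 0 \<le> s \<Longrightarrow> s \<le> t \<Longrightarrow> compensated \<phi> s t \<in> borel_measurable M"
  unfolding compensated_def
  by (intro borel_measurable_diff alive_sum_measurable[OF _ _ _ D] F_M[OF h_drift_measurable]) auto

text \<open>Under \<open>R\<close> the jump sum and the drift, both weighted with
  \<open>hit\<close>, have the same mean on \<open>C\<close>, namely that of
  \<open>alive_drift D (h_test \<phi>)\<close>: the jumps by \<open>hit_alive_sum\<close> and the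
  compensator formula for \<open>h_test \<phi>\<close>, the drift by
  \<open>hit_h_drift\<close>.\<close>

lemma
  assumes \<phi>: "bounded_test \<phi> c" and s: "0 \<le> s" "s \<le> t" and C: "C \<in> sets (F s)"
  shows compensated_integrable: "integrable MP (\<lambda>\<omega>. indicator C \<omega> * compensated \<phi> s t \<omega>)"
    and compensated_integral: "(\<integral>\<omega>. indicator C \<omega> * compensated \<phi> s t \<omega> \<partial>MP) = 0"
proof -
  have CM: "C \<in> sets M" by (rule sets_F_M[OF C])
  let ?a = "\<lambda>\<omega>. indicator C \<omega> * (of_bool (hit \<omega>) * alive_sum D \<phi> s t \<omega>)"
  let ?d = "\<lambda>\<omega>. indicator C \<omega> * (of_bool (hit \<omega>) * h_drift \<phi> s t \<omega>)"
  have m: "(\<lambda>\<omega>. indicator C \<omega> * compensated \<phi> s t \<omega>) \<in> borel_measurable M"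
    using CM compensated_measurable[OF \<phi> s] by measurable
  have eq: "weight \<omega> * (indicator C \<omega> * compensated \<phi> s t \<omega>) = (1 / h x) * (?a \<omega> - ?d \<omega>)" for \<omega>
    by (simp add: weight_def compensated_def right_diff_distrib)
  have ai: "integrable M ?a"
  proof (rule integrable_by_jump_count[where c = c, OF _ _ s])
    show "?a \<in> borel_measurable M"
      by (intro borel_measurable_times borel_measurable_indicator CM hit_borel alive_sum_measurable[OF \<phi> s D])
    show "AE \<omega> in M. \<bar>?a \<omega>\<bar> \<le> c * jump_count s t \<omega>"
    proof (rule AE_I2)
      fix \<omega>
      show "\<bar>?a \<omega>\<bar> \<le> c * jump_count s t \<omega>"
        using alive_sum_bound[OF \<phi>, of D s t \<omega>] bounded_test_nonneg[OF \<phi>]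
        by (auto simp: indicator_def jump_count_eq)
    qed
  qed
  note di = hit_h_drift(2)[OF \<phi> s C]
  show "integrable MP (\<lambda>\<omega>. indicator C \<omega> * compensated \<phi> s t \<omega>)"
    unfolding integrable_MP[OF m] eq using ai di by simp
  have "(\<integral>\<omega>. indicator C \<omega> * compensated \<phi> s t \<omega> \<partial>MP) = (1 / h x) * ((\<integral>\<omega>. ?a \<omega> \<partial>M) - (\<integral>\<omega>. ?d \<omega> \<partial>M))"
    unfolding integral_MP[OF m] eq using ai di by simp
  also have "(\<integral>\<omega>. ?a \<omega> \<partial>M) = (\<integral>\<omega>. indicator C \<omega> * alive_drift D (h_test \<phi>) s t \<omega> \<partial>M)"
    unfolding hit_alive_sum[OF \<phi> s C] by (rule alive_sum_expectation[OF bounded_h_test[OF \<phi>] s D C])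
  also have "\<dots> = (\<integral>\<omega>. ?d \<omega> \<partial>M)" by (rule hit_h_drift(1)[OF \<phi> s C, symmetric])
  finally show "(\<integral>\<omega>. indicator C \<omega> * compensated \<phi> s t \<omega> \<partial>MP) = 0" by simp
qed

lemma martingale_P:
  assumes \<phi>: "bounded_test \<phi> c"
  shows "is_martingale MP (\<lambda>t. G t) (compensated_jumps \<tau> (levy_kernel_AB L A B h) \<phi>)"
proof -
  let ?Z = "compensated_jumps \<tau> (levy_kernel_AB L A B h) \<phi>"
  have Zm: "?Z t \<in> borel_measurable (G t)" if t: "0 \<le> t" for t
  proof -
    obtain g where g: "g \<in> borel_measurable (F t)" "AE \<omega> in M. g \<omega> = alive_sum D \<phi> 0 t \<omega>"
      using alive_sum_version[OF \<phi> _ t D] by auto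
    have "(\<lambda>\<omega>. g \<omega> - h_drift \<phi> 0 t \<omega>) \<in> borel_measurable (F t)"
      using g(1) h_drift_measurable[OF \<phi> t] by measurable
    then show ?thesis
    proof (rule G_measurable)
      have "AE \<omega> in MP. g \<omega> = alive_sum D \<phi> 0 t \<omega>" by (rule AE_P) (use g(2) in \<open>auto elim: eventually_mono\<close>)
      then show "AE \<omega> in MP. g \<omega> - h_drift \<phi> 0 t \<omega> = ?Z t \<omega>"
        using AE_compensated_AB[OF \<phi> t] by eventually_elim (simp add: compensated_def)
    qed simp
  qed
  have ZMP: "?Z t \<in> borel_measurable MP" if "0 \<le> t" for t
    by (rule measurable_from_subalg[OF subalgebra_augment[OF space_F_MP] Zm[OF that]])
  have sp: "cadlag_paths \<in> sets (F 0)" using sets.top[of "F 0"] by (simp add: space_F)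
  have Vi: "integrable MP (compensated \<phi> 0 t)" if t: "0 \<le> t" for t
  proof (rule integrable_cong_AE_imp[OF compensated_integrable[OF \<phi> order_refl t sp]])
    show "compensated \<phi> 0 t \<in> borel_measurable MP" by (rule M_MP[OF compensated_measurable[OF \<phi> order_refl t]])
    show "AE \<omega> in MP. indicator cadlag_paths \<omega> * compensated \<phi> 0 t \<omega> = compensated \<phi> 0 t \<omega>"
      using AE_good_P by eventually_elim simp
  qed
  have Zi: "integrable MP (?Z t)" if t: "0 \<le> t" for t
    by (rule integrable_cong_AE_imp[OF Vi[OF t] ZMP[OF t]])
       (use AE_compensated_AB[OF \<phi> t] in \<open>auto elim: eventually_mono\<close>)
  interpret MP: prob_space MP using prob_P by (simp add: prob_space.prob_space_completion)
  have "AE \<omega> in MP. real_cond_exp MP (G s) (?Z t) \<omega> = ?Z s \<omega>" if s: "0 \<le> s" "s \<le> t" for s t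
  proof -
    have t: "0 \<le> t" using s by simp
    interpret Gs: finite_measure_subalgebra MP "G s" by unfold_locales (rule subalgebra_augment[OF space_F_MP])
    show ?thesis
    proof (rule Gs.real_cond_exp_charact[OF _ Zi[OF t] Zi[OF s(1)] Zm[OF s(1)]])
      fix C assume "C \<in> sets (G s)"
      \<comment> \<open>An event of the augmented past is replaced by an almost surely equal event
        of \<open>F s\<close>, for which increments are known to have mean \<open>0\<close>.\<close>
      then obtain C' where C: "C \<in> sets MP" "C' \<in> sets (F s)" "AE \<omega> in MP. \<omega> \<in> C \<longleftrightarrow> \<omega> \<in> C'"
        unfolding sets_augment[OF space_F_MP] by blast
      have C'P: "C' \<in> sets MP" using C(2) F_sub_MP by blast
      have Im: "(\<lambda>\<omega>. indicator S \<omega> * f \<omega> :: real) \<in> borel_measurable MP"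
        if "S \<in> sets MP" "f \<in> borel_measurable MP" for S f using that by measurable
      have Ii: "integrable MP (\<lambda>\<omega>. indicator C' \<omega> * compensated \<phi> 0 s \<omega>)"
        using integrable_mult_indicator[OF C'P Vi[OF s(1)]] by simp
      have "(\<integral>\<omega>\<in>C. ?Z t \<omega> \<partial>MP) = (\<integral>\<omega>. indicator C' \<omega> * compensated \<phi> 0 s \<omega> + indicator C' \<omega> * compensated \<phi> s t \<omega> \<partial>MP)"
        unfolding set_lebesgue_integral_def real_scaleR_def
      proof (rule integral_cong_AE)
        show "AE \<omega> in MP. indicator C \<omega> * ?Z t \<omega> = indicator C' \<omega> * compensated \<phi> 0 s \<omega> + indicator C' \<omega> * compensated \<phi> s t \<omega>"
          using C(3) AE_compensated_AB[OF \<phi> t] AE_compensated_diff[OF \<phi> s]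
          by eventually_elim (auto simp: indicator_def)
        show "(\<lambda>\<omega>. indicator C' \<omega> * compensated \<phi> 0 s \<omega> + indicator C' \<omega> * compensated \<phi> s t \<omega>) \<in> borel_measurable MP"
          using Ii compensated_integrable[OF \<phi> s C(2)] by auto
      qed (rule Im[OF C(1) ZMP[OF t]])
      also have "\<dots> = (\<integral>\<omega>. indicator C' \<omega> * compensated \<phi> 0 s \<omega> \<partial>MP)"
        using Ii compensated_integrable[OF \<phi> s C(2)] compensated_integral[OF \<phi> s C(2)] by simp
      also have "\<dots> = (\<integral>\<omega>\<in>C. ?Z s \<omega> \<partial>MP)"
        unfolding set_lebesgue_integral_def real_scaleR_def
      proof (rule integral_cong_AE)
        show "AE \<omega> in MP. indicator C' \<omega> * compensated \<phi> 0 s \<omega> = indicator C \<omega> * ?Z s \<omega>"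
          using C(3) AE_compensated_AB[OF \<phi> s(1)] by eventually_elim (auto simp: indicator_def)
      qed (use Ii Im[OF C(1) ZMP[OF s(1)]] in auto)
      finally show "(\<integral>\<omega>\<in>C. ?Z t \<omega> \<partial>MP) = (\<integral>\<omega>\<in>C. ?Z s \<omega> \<partial>MP)" .
    qed
  qed
  then show ?thesis unfolding is_martingale_def using Zm Zi by blast
qed

lemma solves_MP_P: "solves_MP_upto \<tau> P (levy_kernel_AB L A B h) (return borel x)"
  unfolding solves_MP_upto_def
proof (intro conjI exI[of _ "\<lambda>t. G t"] allI impI ballI P_paths right_continuous_G adapted_G hitting_event_G kernel_predictable_G)
  have ae: "AE \<omega> in P. \<omega> 0 = x"
    using AE_good_P unfolding AE_completion_iff by eventually_elim simp
  have c0: "(\<lambda>\<omega>. \<omega> 0) \<in> P \<rightarrow>\<^sub>M borel"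
    using coordinate_measurable[of 0] measurable_cong_sets[OF sets_P refl] measurable_cong_sets[OF sets_R refl] by blast
  have "distr P borel (\<lambda>\<omega>. \<omega> 0) = distr P borel (\<lambda>_. x)"
    by (rule distr_cong_AE[OF refl refl ae c0]) simp
  then show "distr P borel (\<lambda>\<omega>. \<omega> 0) = return borel x"
    using prob_space.distr_const[OF prob_P, of x borel] by simp
  show "AE \<omega> in P. \<forall>t\<ge>0. finite {s \<in> jump_times \<omega>. s \<le> t \<and> ereal s \<le> \<tau> \<omega>}"
    using AE_good_P unfolding AE_completion_iff
  proof eventually_elim
    case (elim \<omega>)
    show ?case
    proof (intro allI impI)
      fix t :: real assume "0 \<le> t"
      then have "finite (jump_times \<omega> \<inter> {..t})" using elim by (simp add: pure_jump_def)
      then show "finite {s \<in> jump_times \<omega>. s \<le> t \<and> ereal s \<le> \<tau> \<omega>}" by (rule finite_subset[rotated]) auto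
    qed
  qed
  fix \<phi> :: "real \<times> 'a \<times> 'a \<Rightarrow> real"
  assume "\<phi> \<in> borel_measurable (borel \<Otimes>\<^sub>M borel \<Otimes>\<^sub>M borel)" "bounded (range \<phi>)"
  then obtain c where "bounded_test \<phi> c" by (auto simp: bounded_test_def bounded_iff)
  then show "is_martingale MP (\<lambda>t. G t) (compensated_jumps \<tau> (levy_kernel_AB L A B h) \<phi>)" by (rule martingale_P)
qed

end

section \<open>The variational problem\<close>

context hitting_problem
begin

text \<open>Almost every path reaches \<open>D\<close>, and since \<open>A\<close> and
  \<open>B\<close> are disjoint it pays nothing exactly when it lands in \<open>B\<close>.\<close>

lemma AE_f_AB: "AE \<omega> in R. f_AB A (stopped_value (hitting_time D) \<omega>) = (if \<omega> \<in> {\<omega> \<in> space R. hit \<omega>} then 0 else \<infinity>)"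
proof -
  have "AE \<omega> in M. f_AB A (stopped_value (hitting_time D) \<omega>) = (if \<omega> \<in> {\<omega> \<in> space R. hit \<omega>} then 0 else \<infinity>)"
    using AE_hit AE_space
  proof eventually_elim
    case (elim \<omega>)
    then have w: "pure_jump \<omega>" "hitting_time D \<omega> < \<infinity>" by auto
    obtain T where T: "hitting_time D \<omega> = ereal T" "\<omega> T \<in> D" "hit \<omega> \<longleftrightarrow> \<omega> T \<in> B" using hitting_fin[OF w] by blast
    then show ?case using AB elim by (auto simp: stopped_value_def f_AB_def)
  qed
  then show ?thesis by (simp add: AE_completion_iff)
qed

sublocale given_hit: conditioning R "{\<omega> \<in> space R. hit \<omega>}" "\<lambda>\<omega>. f_AB A (stopped_value (hitting_time D) \<omega>)"
  by (intro conditioning.intro conditioning_axioms.intro prob_R hit_event_R AE_f_AB)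

lemma path_measures_iff: "Q \<in> path_measures \<longleftrightarrow> prob_space Q \<and> sets Q = sets R"
  using sets_R by (auto simp: path_measures_def space_prob_algebra)

lemma sto_cost_eq: "sto_cost A B R Q = given_hit.cost Q"
  by (simp add: sto_cost_def given_hit.cost_def)

text \<open>If \<open>h x = 0\<close>, hitting \<open>B\<close> first has probability
  \<open>0\<close>, so every competitor costs \<open>\<infinity>\<close>, in agreement with
  \<open>neg_log 0\<close>. Otherwise the lower bound is attained by the conditioned law.\<close>

lemma gamma_sto_eq: "gamma_sto A B R = neg_log (h x)"
proof (cases "h x = 0")
  case True
  then have "sto_cost A B R Q = \<infinity>" if "Q \<in> path_measures" for Q
    using that given_hit.cost_infinite hit_probability_R by (simp add: sto_cost_eq path_measures_iff)
  then have "gamma_sto A B R = (INF Q\<in>path_measures :: (real \<Rightarrow> 'a) measure set. \<infinity>)"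
    unfolding gamma_sto_def by (intro INF_cong) auto
  then show ?thesis using True by (simp add: neg_log_def top_ereal_def[symmetric])
next
  case False
  then have pos: "0 < measure R {\<omega> \<in> space R. hit \<omega>}" using h_start_nonneg hit_probability_R by simp
  show ?thesis unfolding gamma_sto_def
  proof (rule antisym)
    have "given_hit.given_E \<in> path_measures" using given_hit.prob_given_E[OF pos] given_hit.sets_given_E by (simp add: path_measures_iff)
    then have "(INF Q\<in>path_measures. sto_cost A B R Q) \<le> sto_cost A B R given_hit.given_E" by (rule INF_lower)
    then show "(INF Q\<in>path_measures. sto_cost A B R Q) \<le> neg_log (h x)"
      using given_hit.cost_given_E[OF pos] False by (simp add: sto_cost_eq neg_log_def hit_probability_R)
    show "neg_log (h x) \<le> (INF Q\<in>path_measures. sto_cost A B R Q)"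
      using given_hit.cost_ge[OF pos] False by (intro INF_greatest) (simp add: sto_cost_eq neg_log_def hit_probability_R path_measures_iff)
  qed
qed

end

context conditioned_process
begin

lemma given_E_eq: "given_hit.given_E = P"
  unfolding given_hit.given_E_def P_eq hit_probability_R
  by (intro density_cong) (auto simp: weight_def indicator_def)

lemma minimizers: "{Q \<in> path_measures. sto_cost A B R Q = gamma_sto A B R} = {P}"
proof -
  have pos: "0 < measure R {\<omega> \<in> space R. hit \<omega>}" using hx hit_probability_R by simp
  have "sto_cost A B R Q = gamma_sto A B R \<longleftrightarrow> Q = P" if "Q \<in> path_measures" for Q
    using given_hit.cost_minimal_iff[OF pos, of Q] that h_pos
    by (simp add: path_measures_iff sto_cost_eq gamma_sto_eq neg_log_def hit_probability_R given_E_eq)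
  then show ?thesis using P_paths by blast
qed

end

theorem theorem4p2:
  fixes A B :: "'a::polish_space set" and L :: "'a \<Rightarrow> 'a measure"
    and R0 :: "'a measure" and R :: "(real \<Rightarrow> 'a) measure" and Rx :: "'a \<Rightarrow> (real \<Rightarrow> 'a) measure"
    and h :: "'a \<Rightarrow> real" and x :: 'a
  assumes "A \<in> sets borel" "B \<in> sets borel" "A \<noteq> {}" "B \<noteq> {}" "A \<inter> B = {}"
    and "bounded_rate_kernel L"
    and "R0 \<in> space (prob_algebra borel)"
    and "unique_jump_process_law L R0 R"
    and "started_family L R0 R Rx"
    and "positive_process Rx"
    and "bvp_solution L A B h" and "\<And>g. bvp_solution L A B g \<Longrightarrow> g = h"
    and "x \<notin> A \<union> B"
    and "(\<integral>\<^sup>+ \<omega>. exp_ext (hitting_time (A \<union> B) \<omega>) \<partial>completion (Rx x)) < \<infinity>"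
  shows "(h x \<noteq> 0 \<longrightarrow>
           {Q \<in> path_measures. sto_cost A B (Rx x) Q = gamma_sto A B (Rx x)} = {P_AB A B h x (Rx x)} \<and>
           (\<forall>K. conditional_measures (Rx x) (stopped_value (hitting_time (A \<union> B))) K \<longrightarrow>
             (\<forall>C \<in> sets path_space. emeasure (P_AB A B h x (Rx x)) C =
               (\<integral>\<^sup>+ \<eta>. emeasure (K \<eta>) C * ennreal (h \<eta> / h x)
                  \<partial>law_of (Rx x) (stopped_value (hitting_time (A \<union> B)))))))
       \<and> gamma_sto A B (Rx x) = neg_log (h x)
       \<and> (h x \<noteq> 0 \<longrightarrow>
           solves_MP_upto (hitting_time (A \<union> B)) (P_AB A B h x (Rx x)) (levy_kernel_AB L A B h) (return borel x))"
proof -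
  have law: "jump_process_law L (return borel x) (Rx x)"
    using assms(9) by (simp add: started_family_def unique_jump_process_law_def)
  \<comment> \<open>One filtration that witnesses the martingale problem started at \<open>x\<close>
    is fixed here; all conditioning on the past refers to it.\<close>
  then obtain F where F: "right_continuous_filtration (completion (Rx x)) F"
    "\<And>t. 0 \<le> t \<Longrightarrow> (\<lambda>\<omega>. \<omega> t) \<in> F t \<rightarrow>\<^sub>M borel" "distr (Rx x) borel (\<lambda>\<omega>. \<omega> 0) = return borel x"
    "\<And>\<phi>. \<phi> \<in> borel_measurable (borel \<Otimes>\<^sub>M borel \<Otimes>\<^sub>M borel) \<Longrightarrow> bounded (range \<phi>) \<Longrightarrow>
      is_martingale (completion (Rx x)) F (compensated_jumps (\<lambda>_. \<infinity>) (levy_kernel (\<lambda>_. L)) \<phi>)"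
    unfolding jump_process_law_def solves_MP_upto_def by blast
  interpret jump_law L "Rx x" F x
    using law F assms(6) by unfold_locales (auto simp: jump_process_law_def)
  have fin: "AE \<omega> in Rx x. hitting_time (A \<union> B) \<omega> < \<infinity>"
  proof (rule exp_ext_finite[OF pure])
    show "(\<lambda>\<omega>. \<omega> u) \<in> Rx x \<rightarrow>\<^sub>M borel" if "0 \<le> u" for u
      using coordinate_measurable[OF that] measurable_cong_sets[OF sets_R refl] by blast
  qed (use assms(1,2,14) in auto)
  interpret hitting_problem L "Rx x" F x A B h
    using assms(1,2,5,11,13) fin by unfold_locales auto
  have "{Q \<in> path_measures. sto_cost A B (Rx x) Q = gamma_sto A B (Rx x)} = {P_AB A B h x (Rx x)} \<and>
      (\<forall>K. conditional_measures (Rx x) (stopped_value (hitting_time (A \<union> B))) K \<longrightarrow>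
        (\<forall>C \<in> sets path_space. emeasure (P_AB A B h x (Rx x)) C =
          (\<integral>\<^sup>+ \<eta>. emeasure (K \<eta>) C * ennreal (h \<eta> / h x) \<partial>law_of (Rx x) (stopped_value (hitting_time (A \<union> B)))))) \<and>
      solves_MP_upto (hitting_time (A \<union> B)) (P_AB A B h x (Rx x)) (levy_kernel_AB L A B h) (return borel x)"
    if "h x \<noteq> 0"
  proof -
    interpret conditioned_process L "Rx x" F x A B h by unfold_locales (rule that)
    show ?thesis using minimizers disintegration solves_MP_P unfolding P_def by blast
  qed
  \<comment> \<open>The value formula belongs to \<open>hitting_problem\<close>, which includes the
    degenerate case \<open>h x = 0\<close> where no conditioned law exists.\<close>
  then show ?thesis using gamma_sto_eq by blast
qed
end
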